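(* Let $E$ be an admissible compact set, $F\in\mathcal H(E)$ and $\mu\in\mathcal S(E)$. Let $F_n=\langle F,p_n\rangle_\mu$, define $f(w):=F(\Psi(w))$, and denote the Laurent series of $f$ about $0$ by $\sum_{k=-\infty}^{\infty}f_kw^k$. Then the following limits are equivalent (if one of them holds, so do the other two): (a) $\lim_{n\to\infty}F_n/F_{n+1}=\tau$; (b) $\lim_{n\to\infty}\langle zF,p_n\rangle_\mu/F_n=\lambda$; (c) $\lim_{n\to\infty}f_n/f_{n+1}=\tau$; where $\tau$ and $\lambda$ are finite and related by the formula $\Phi(\lambda)=\tau$.
   Context: Admissible compact set: an infinite compact set $E\subset\mathbb C$ such that $\overline{\mathbb C}\setminus E$ is simply connected and such that, with $\Phi$ the unique conformal map of $\overline{\mathbb C}\setminus E$ onto $\overline{\mathbb C}\setminus\{w:|w|\le 1\}$ satisfying $\Phi(\infty)=\infty$, $\Phi'(\infty)>0$, the inverse $\Psi=\Phi^{-1}$ extends continuously to $\overline{\mathbb C}\setminus\{w:|w|<1\}$. $\mathcal M(E)$ is the set of finite positive Borel measures $\mu$ with infinite support contained in $E$; $\langle g,h\rangle_\mu=\int g\,\overline h\,d\mu$; $p_n(z)=\kappa_n z^n+\cdots$, $\kappa_n>0$, are the orthonormal polynomials with respect to $\mu$; $zF$ denotes the function $z\mapsto zF(z)$. $\mathcal S(E)$ is the set of $\mu\in\mathcal M(E)$ for which there exist positive constants $c_n$ and a holomorphic non-vanishing function $S$ on $\overline{\mathbb C}\setminus E$ such that $\lim_{n\to\infty}p_n(z)/(c_n\Phi^n(z))=S(z)$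 uniformly on compact subsets of $\overline{\mathbb C}\setminus E$ and $\lim_{n\to\infty}c_n/c_{n+1}=1$. $\mathcal H(E)$ is the space of functions holomorphic in some neighborhood of $E$. Since $F\in\mathcal H(E)$, $f=F\circ\Psi$ is holomorphic in some annulus $1<|w|<\rho$ with $\rho>1$, and its Laurent series is taken in that annulus. *)

theory Defs
  imports "HOL-Analysis.Analysis" "HOL-Computational_Algebra.Polynomial"
begin

text \<open>
  The Riemann sphere is the unit sphere of \<^typ>\<open>complex \<times> real\<close>: a finite point is sent to
  the sphere by inverse stereographic projection, and infinity is the north pole.
\<close>

definition sphere_point :: "complex \<Rightarrow> complex \<times> real" where
  "sphere_point z =
     ((2 / ((cmod z)\<^sup>2 + 1)) *\<^sub>R z, ((cmod z)\<^sup>2 - 1) / ((cmod z)\<^sup>2 + 1))"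

definition sphere_complement :: "complex set \<Rightarrow> (complex \<times> real) set" where
  "sphere_complement E = insert (0, 1) (sphere_point ` (- E))"

text \<open>
  A conformal map between the complements of \<open>E\<close> and of the closed unit disk in the sphere that
  fixes infinity is given by its restriction to the finite points. The limit clause says
  \<open>\<Phi>(\<infinity>) = \<infinity>\<close> (with a simple pole there) and \<open>\<Phi>'(\<infinity>) = lim \<Phi>(z)/z > 0\<close>.
  The values of \<open>\<Phi>\<close> on \<open>E\<close> are irrelevant.
\<close>

definition exterior_map :: "complex set \<Rightarrow> (complex \<Rightarrow> complex) \<Rightarrow> bool" where
  "exterior_map E \<Phi> \<longleftrightarrow>
     \<Phi> holomorphic_on (- E) \<and>
     bij_betw \<Phi> (- E) {w. 1 < cmod w} \<and>
     (\<exists>c::real. c > 0 \<and> ((\<lambda>z. \<Phi> z / z) \<longlongrightarrow> complex_of_real c) at_infinity)"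

definition exterior_inverse :: "complex set \<Rightarrow> (complex \<Rightarrow> complex) \<Rightarrow> complex \<Rightarrow> complex" where
  "exterior_inverse E \<Phi> = inv_into (- E) \<Phi>"

text \<open>
  For \<open>E\<close> as in the first three clauses, the exterior map exists by the Riemann mapping theorem
  and is unique on the complement of \<open>E\<close>, so the quantifier over \<open>\<Phi>\<close> is a definite description.
  Continuity of the inverse at infinity is automatic, and so is finiteness of the boundary values
  (the inverse is bounded near the unit circle).
\<close>

definition admissible_compact :: "complex set \<Rightarrow> bool" where
  "admissible_compact E \<longleftrightarrow>
     compact E \<and> infinite E \<and> simply_connected (sphere_complement E) \<and>
     (\<forall>\<Phi>. exterior_map E \<Phi> \<longrightarrow>
        (\<exists>G. continuous_on {w. 1 \<le> cmod w} G \<and>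
             (\<forall>w. 1 < cmod w \<longrightarrow> G w = exterior_inverse E \<Phi> w)))"

definition holo_near :: "complex set \<Rightarrow> (complex \<Rightarrow> complex) set" where
  "holo_near E = {F. \<exists>U. open U \<and> E \<subseteq> U \<and> F holomorphic_on U}"

definition msupport :: "complex measure \<Rightarrow> complex set" where
  "msupport \<mu> = {z. \<forall>U. open U \<and> z \<in> U \<longrightarrow> emeasure \<mu> U > 0}"

definition measures_on :: "complex set \<Rightarrow> complex measure set" where
  "measures_on E = {\<mu>. finite_measure \<mu> \<and> sets \<mu> = sets borel \<and>
                       infinite (msupport \<mu>) \<and> msupport \<mu> \<subseteq> E}"

text \<open>
  The complement of the support is a null set, but the integral is nevertheless taken over the
  support: an element of \<open>holo_near E\<close> is a total function that need not be measurable away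
  from \<open>E\<close>, and the integral over the whole plane would then be the default value 0.
\<close>

definition L2_inner ::
    "complex measure \<Rightarrow> (complex \<Rightarrow> complex) \<Rightarrow> (complex \<Rightarrow> complex) \<Rightarrow> complex" where
  "L2_inner \<mu> g h = (LINT z:msupport \<mu>|\<mu>. g z * cnj (h z))"

definition orthonormal_polys :: "complex measure \<Rightarrow> (nat \<Rightarrow> complex poly) \<Rightarrow> bool" where
  "orthonormal_polys \<mu> p \<longleftrightarrow>
     (\<forall>n. degree (p n) = n \<and> (\<exists>\<kappa>::real. \<kappa> > 0 \<and> lead_coeff (p n) = complex_of_real \<kappa>)) \<and>
     (\<forall>m n. L2_inner \<mu> (poly (p m)) (poly (p n)) = (if m = n then 1 else 0))"

text \<open>
  As before, \<open>\<Phi>\<close> (off \<open>E\<close>) and \<open>p\<close> are uniquely determined, so the outer quantifiers are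
  definite descriptions. The function \<open>S\<close> lives on the complement of \<open>E\<close> in the sphere: it is
  holomorphic and non-vanishing at infinity exactly when it has a finite nonzero limit there.
  Adding infinity to a closed subset \<open>K\<close> of the plane gives a compact subset of the sphere;
  this is why \<open>K\<close> is not required to be bounded. (The values at infinity are obtained from the
  finite ones by continuity.)
\<close>

definition strong_asymp_measures :: "complex set \<Rightarrow> complex measure set" where
  "strong_asymp_measures E =
     {\<mu> \<in> measures_on E. \<forall>\<Phi> p. exterior_map E \<Phi> \<and> orthonormal_polys \<mu> p \<longrightarrow>
        (\<exists>(c::nat \<Rightarrow> real) (S::complex \<Rightarrow> complex).
           (\<forall>n. c n > 0) \<and>
           S holomorphic_on (- E) \<and> (\<forall>z\<in>- E. S z \<noteq> 0) \<and>
           (\<exists>L. L \<noteq> 0 \<and> (S \<longlongrightarrow> L) at_infinity) \<and>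
           (\<forall>K. closed K \<and> K \<subseteq> - E \<longrightarrow>
              uniform_limit K (\<lambda>n z. poly (p n) z / (complex_of_real (c n) * \<Phi> z ^ n))
                S sequentially) \<and>
           (\<lambda>n. c n / c (Suc n)) \<longlonglongrightarrow> 1)}"

text \<open>
  Laurent expansion in some annulus whose inner boundary is the unit circle; this determines the
  coefficients uniquely.
\<close>

definition laurent_coeffs_outside_disk :: "(complex \<Rightarrow> complex) \<Rightarrow> (int \<Rightarrow> complex) \<Rightarrow> bool" where
  "laurent_coeffs_outside_disk f a \<longleftrightarrow>
     (\<exists>\<rho>>1. \<forall>w. 1 < cmod w \<and> cmod w < \<rho> \<longrightarrow>
        ((\<lambda>k::int. a k * w powi k) has_sum f w) UNIV)"

text \<open>
  A limit of quotients presupposes that the quotients are defined for all large \<open>n\<close>; without the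
  first clause, division by zero would turn vanishing denominators into quotients equal to 0.
\<close>

definition ratio_tendsto :: "(nat \<Rightarrow> complex) \<Rightarrow> (nat \<Rightarrow> complex) \<Rightarrow> complex \<Rightarrow> bool" where
  "ratio_tendsto a b l \<longleftrightarrow>
     (\<forall>\<^sub>F n in sequentially. b n \<noteq> 0) \<and> (\<lambda>n. a n / b n) \<longlonglongrightarrow> l"

end

theory Submission
  imports Defs "HOL-Complex_Analysis.Complex_Analysis"
begin

text \<open>
  Put \<open>u = 1 / w\<close> and let \<open>g\<^sub>m(u) = p\<^sub>m(\<Psi>(w)) / (c\<^sub>m w\<^sup>m)\<close>, which is holomorphic in the unit disk and
  converges to the non-vanishing function \<open>S(\<Psi>(w))\<close>. With \<open>y\<^sub>n = c\<^sub>n F\<^sub>n\<close> the expansion of \<open>F\<close> in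
  orthonormal polynomials becomes an upper triangular system \<open>f = A y\<close>, where row \<open>n\<close> of \<open>A\<close>
  converges to the Taylor coefficients of \<open>S \<circ> \<Psi>\<close>; the rows of the inverse system converge to
  those of \<open>1 / (S \<circ> \<Psi>)\<close>. All entries grow subexponentially, while \<open>f\<close> and \<open>y\<close> decay
  exponentially, so ratio limits pass through both systems by dominated convergence; this is the
  equivalence of (a) and (c).

  For (b), factor \<open>\<Psi>(w) - \<lambda> = (w - \<tau>) \<phi>(1 / w)\<close> with \<open>\<phi>\<close> zero-free, where \<open>\<tau> = \<Phi>(\<lambda>)\<close>, or \<open>\<tau> = 0\<close>
  if \<open>\<lambda> \<in> E\<close>. If \<open>v\<close> denotes the Laurent coefficients of \<open>\<phi>(1 / w) f(w)\<close>, then (b) says that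
  \<open>v\<^sub>n\<^sub>-\<^sub>1 - \<tau> v\<^sub>n\<close> is small compared with the tail of \<open>v\<close>, which forces \<open>\<tau> \<noteq> 0\<close> and
  \<open>v\<^sub>n\<^sub>-\<^sub>1 / v\<^sub>n \<longlonglongrightarrow> \<tau>\<close>.
\<close>

section \<open>Upper triangular kernels\<close>

text \<open>The system \<open>f = A y\<close> reads off the coefficient of \<open>w^n\<close> in the
  formal identity \<open>F(\<Psi>(w)) = \<Sum>m. F_m p_m(\<Psi>(w))\<close>, where
  \<open>p_m(\<Psi>(w)) = c_m w^m g_m(1/w)\<close>. The obstacle is that \<open>F_m\<close> is an
  integral over \<open>E\<close>: neither convergence of this series off \<open>E\<close> nor its
  sum is known beforehand. Hence \<open>y\<close> is manufactured from \<open>f\<close> by the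
  inverse system and only afterwards recognised as \<open>c_m F_m\<close>. Kernel bounds are uniform
  only from some row on, so all identities hold for large indices. Estimates play a growth rate
  \<open>r\<close> of the kernels against a decay rate \<open>R\<close> of the data,
  \<open>1 < r < R\<close>; such an \<open>R\<close> exists because \<open>F\<close> is holomorphic
  past \<open>E\<close>, and the same decay forces \<open>|\<tau>| > 1\<close>. Zero-freeness of
  \<open>S\<close> acts twice: it makes the limiting system invertible, and it keeps the factor
  \<open>S(\<Psi>(\<tau>))\<close> between the two sequences nonzero, so that they share their ratio
  limit. In (b) the small factor multiplies \<open>y\<close> termwise, between the inverse system
  and \<open>A\<close>. Both mix all later indices, so the error in the recurrence for
  \<open>v\<close> is comparable only with a whole tail and not with \<open>v (n + 1)\<close>
  alone.\<close>

definition upper_sum :: "(nat \<Rightarrow> nat \<Rightarrow> complex) \<Rightarrow> (nat \<Rightarrow> complex) \<Rightarrow> nat \<Rightarrow> complex" where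
  "upper_sum K y n = (\<Sum>j. K n j * y (n + j))"

text \<open>Equivalent to convergence of the power series with coefficients \<open>k\<close> in the
  whole unit disk.\<close>

definition subexponential :: "(nat \<Rightarrow> complex) \<Rightarrow> bool" where
  "subexponential k \<longleftrightarrow> (\<forall>r>1. \<exists>C\<ge>0. \<forall>j. norm (k j) \<le> C * r ^ j)"

text \<open>Rows are indexed by the offset from the diagonal, so a limit of rows is a single
  sequence, that is, a Toeplitz matrix. For rows of Taylor coefficients this is locally uniform
  convergence in the unit disk; the weight \<open>r^j\<close> is what Cauchy's estimate on
  \<open>|u| = 1/r\<close> produces.\<close>

definition kernel_limit :: "(nat \<Rightarrow> nat \<Rightarrow> complex) \<Rightarrow> (nat \<Rightarrow> complex) \<Rightarrow> bool" where
  "kernel_limit K k \<longleftrightarrow> (\<forall>r>1. \<forall>e>0. \<exists>M. \<forall>n\<ge>M. \<forall>j. norm (K n j - k j) \<le> e * r ^ j)"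

lemma kernel_limit_bound:
  assumes "kernel_limit K k" "subexponential k" "(r::real) > 1"
  obtains C N where "C \<ge> 0" "\<And>n j. n \<ge> N \<Longrightarrow> norm (K n j) \<le> C * r ^ j"
proof -
  obtain C where C: "C \<ge> 0" "\<And>j. norm (k j) \<le> C * r ^ j"
    using assms(2,3) unfolding subexponential_def by blast
  obtain N where N: "\<And>n j. n \<ge> N \<Longrightarrow> norm (K n j - k j) \<le> 1 * r ^ j"
    using assms(1,3) unfolding kernel_limit_def by (meson zero_less_one)
  have "norm (K n j) \<le> (C + 1) * r ^ j" if "n \<ge> N" for n j
  proof -
    have "norm (K n j) \<le> norm (k j) + norm (K n j - k j)"
      by (metis add.commute diff_add_cancel norm_triangle_ineq)
    then show ?thesis using C(2)[of j] N[OF that, of j] by (simp add: algebra_simps)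
  qed
  then show thesis using that[of "C + 1" N] C(1) by auto
qed

lemma kernel_limit_pointwise:
  assumes "kernel_limit K k"
  shows "(\<lambda>n. K n j) \<longlonglongrightarrow> k j"
proof (rule LIMSEQ_I)
  fix e :: real assume "e > 0"
  then have "e / 2 / 2 ^ j > 0" by simp
  then obtain M where M: "\<And>n. n \<ge> M \<Longrightarrow> norm (K n j - k j) \<le> e / 2 / 2 ^ j * 2 ^ j"
    using assms unfolding kernel_limit_def by (meson one_less_numeral_iff semiring_norm(76))
  have "norm (K n j - k j) < e" if "n \<ge> M" for n
    using M[OF that] \<open>e > 0\<close> by simp
  then show "\<exists>no. \<forall>n\<ge>no. norm (K n j - k j) < e" by blast
qed

lemma upper_sum_bound:
  fixes r R C W :: real
  assumes "\<And>j. norm (K n j) \<le> C * r ^ j" "\<And>j. norm (y (n + j)) \<le> W / R ^ j"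
    and "0 < r" "r < R" "C \<ge> 0"
  shows "summable (\<lambda>j. norm (K n j * y (n + j)))"
    and "norm (upper_sum K y n) \<le> C * W / (1 - r / R)"
proof -
  have term_le: "norm (K n j * y (n + j)) \<le> C * W * (r / R) ^ j" for j
  proof -
    have "norm (K n j * y (n + j)) \<le> (C * r ^ j) * (W / R ^ j)"
      unfolding norm_mult using assms by (intro mult_mono assms(1,2)) auto
    then show ?thesis by (simp add: field_simps)
  qed
  have q: "norm (r / R) < 1" using assms(3,4) by simp
  have gs: "(\<lambda>j. C * W * (r / R) ^ j) sums (C * W * (1 / (1 - r / R)))"
    by (intro sums_mult geometric_sums q)
  show sm: "summable (\<lambda>j. norm (K n j * y (n + j)))"
    by (rule summable_comparison_test'[where N = 0, OF sums_summable[OF gs]]) (use term_le in auto)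
  have "norm (upper_sum K y n) \<le> (\<Sum>j. norm (K n j * y (n + j)))"
    unfolding upper_sum_def by (rule summable_norm[OF sm])
  also have "\<dots> \<le> C * W * (1 / (1 - r / R))"
    using suminf_le[OF term_le sm sums_summable[OF gs]] sums_unique[OF gs] by simp
  finally show "norm (upper_sum K y n) \<le> C * W / (1 - r / R)" by simp
qed

text \<open>A weighted bound on a tail survives with the same rate \<open>R\<close>; only the
  constant grows, by the factor \<open>C / (1 - r / R)\<close>. Such bounds can therefore be chained
  through several kernels.\<close>

lemma upper_sum_tail_bound:
  fixes r R C W :: real
  assumes "\<And>m j. m \<ge> n \<Longrightarrow> norm (K m j) \<le> C * r ^ j" "\<And>j. norm (y (n + j)) \<le> W / R ^ j"
    and "0 < r" "r < R" "C \<ge> 0"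
  shows "norm (upper_sum K y (n + i)) \<le> (C * W / (1 - r / R)) / R ^ i"
proof -
  have "norm (upper_sum K y (n + i)) \<le> C * (W / R ^ i) / (1 - r / R)"
  proof (rule upper_sum_bound)
    show "norm (y (n + i + j)) \<le> W / R ^ i / R ^ j" for j
      using assms(2)[of "i + j"] by (simp add: power_add add.assoc)
  qed (use assms in auto)
  then show ?thesis by (simp add: field_simps)
qed

text \<open>In offset indexing, entry \<open>l\<close> of row \<open>n\<close> of the product
  \<open>A B\<close> is the convolution in \<open>inv\<close>. Replacing \<open>A (B y)\<close> by
  \<open>(A B) y\<close> exchanges summations, which is justified because \<open>r < R\<close> makes
  the double series absolutely convergent.\<close>

lemma upper_sum_inverse:
  fixes r R C D W :: real
  assumes A: "\<And>m j. m \<ge> n \<Longrightarrow> norm (A m j) \<le> C * r ^ j"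
    and B: "\<And>m j. m \<ge> n \<Longrightarrow> norm (B m j) \<le> D * r ^ j"
    and inv: "\<And>l. (\<Sum>j\<le>l. A n j * B (n + j) (l - j)) = (if l = 0 then 1 else 0)"
    and y: "\<And>j. norm (y (n + j)) \<le> W / R ^ j"
    and r: "0 < r" "r < R" "C \<ge> 0" "D \<ge> 0"
  shows "upper_sum A (upper_sum B y) n = y n"
proof -
  define F where "F = (\<lambda>(j, i). A n j * (B (n + j) i * y (n + j + i)))"
  define x where "x = upper_sum B y"
  have W: "W \<ge> 0" using y[of 0] by (metis add_0_right div_by_1 norm_ge_zero order_trans power_0)
  have q: "norm (r / R) < 1" using r by simp
  have R: "R > 0" using r by simp
  have yj: "norm (y (n + j + i)) \<le> W / R ^ j / R ^ i" for i j
    using y[of "j + i"] by (simp add: power_add add.assoc)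
  have inner: "summable (\<lambda>i. norm (B (n + j) i * y (n + j + i)))" for j
    by (rule upper_sum_bound(1)[where K = B, OF B yj]) (use r in auto)
  have inner_has: "((\<lambda>i. F (j, i)) has_sum A n j * x (n + j)) UNIV" for j
    unfolding F_def x_def upper_sum_def prod.case
    by (intro has_sum_cmult_right norm_summable_imp_has_sum inner summable_sums
        summable_norm_cancel[OF inner])
  have geo: "((\<lambda>j. c * (r / R) ^ j) has_sum c * (1 / (1 - r / R))) UNIV" for c :: real
    by (intro has_sum_cmult_right norm_summable_imp_has_sum geometric_sums q)
       (use r in \<open>auto simp: power_abs[symmetric]\<close>)
  have abs: "(\<lambda>p. norm (F p)) summable_on UNIV \<times> UNIV"
  proof (rule summable_on_comparison_test)
    show "(\<lambda>(j, i). C * D * W * (r / R) ^ j * (r / R) ^ i) summable_on UNIV \<times> UNIV"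
    proof (rule summable_on_SigmaI)
      show "((\<lambda>i. case (j, i) of (j, i) \<Rightarrow> C * D * W * (r / R) ^ j * (r / R) ^ i) has_sum
          C * D * W * (r / R) ^ j * (1 / (1 - r / R))) UNIV" for j
        using geo[of "C * D * W * (r / R) ^ j"] by simp
      show "(\<lambda>j. C * D * W * (r / R) ^ j * (1 / (1 - r / R))) summable_on UNIV"
        by (intro summable_on_cmult_left has_sum_imp_summable[OF geo])
    qed (use r W in auto)
    show "norm (F p) \<le> (case p of (j, i) \<Rightarrow> C * D * W * (r / R) ^ j * (r / R) ^ i)" for p
    proof (cases p)
      case (Pair j i)
      have "norm (F (j, i)) \<le> (C * r ^ j) * ((D * r ^ i) * (W / R ^ j / R ^ i))"
        unfolding F_def prod.case norm_mult using r W R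
        by (intro mult_mono A B yj mult_nonneg_nonneg) auto
      then show ?thesis using Pair by (simp add: field_simps)
    qed
  qed auto
  have "F summable_on UNIV \<times> UNIV" using abs by (rule abs_summable_summable)
  then obtain S where S: "(F has_sum S) (UNIV \<times> UNIV)" by (auto simp: summable_on_def)
  have S1: "((\<lambda>j. A n j * x (n + j)) has_sum S) UNIV"
    by (rule has_sum_SigmaD[OF S]) (use inner_has in auto)
  \<comment> \<open>Regrouping by the total offset \<open>l = j + i\<close>: on each finite block
    the factor \<open>y (n + l)\<close> is constant.\<close>
  have S2: "((\<lambda>(l, j). F (j, l - j)) has_sum S) (SIGMA l:UNIV. {..l})"
    using S by (subst has_sum_reindex_bij_witness[where j = "\<lambda>(l, j). (j, l - j)"
          and i = "\<lambda>(j, i). (j + i, j)" and T = "UNIV \<times> UNIV" and h = F and s' = S]) auto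
  have S3: "((\<lambda>l. \<Sum>j\<le>l. F (j, l - j)) has_sum S) UNIV"
    by (rule has_sum_SigmaD[OF S2]) (auto intro!: has_sum_finiteI)
  have "(\<Sum>j\<le>l. F (j, l - j)) = (if l = 0 then y n else 0)" for l
  proof -
    have "(\<Sum>j\<le>l. F (j, l - j)) = (\<Sum>j\<le>l. A n j * B (n + j) (l - j) * y (n + l))"
      unfolding F_def by (intro sum.cong) auto
    also have "\<dots> = (\<Sum>j\<le>l. A n j * B (n + j) (l - j)) * y (n + l)"
      by (simp add: sum_distrib_right)
    finally show ?thesis by (simp add: inv)
  qed
  then have "((\<lambda>l::nat. if l = 0 then y n else 0) has_sum S) UNIV" using S3 by simp
  moreover have "((\<lambda>l::nat. if l = 0 then y n else 0) has_sum y n) UNIV"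
    by (rule has_sum_finite_neutralI[of "{0}"]) auto
  ultimately have "S = y n" by (rule has_sum_unique)
  then show ?thesis
    using has_sum_imp_sums[OF S1] unfolding x_def upper_sum_def[of A] by (simp add: sums_iff)
qed

text \<open>Back substitution: the equation \<open>A B = I\<close> at offset \<open>l\<close>,
  solved for the term \<open>A n 0 * B n l\<close>. The entries used have smaller offset but lie in
  later rows.\<close>

fun right_inverse :: "(nat \<Rightarrow> nat \<Rightarrow> complex) \<Rightarrow> nat \<Rightarrow> nat \<Rightarrow> complex" where
  "right_inverse A n l = ((if l = 0 then 1 else 0) -
     (\<Sum>i<l. A n (l - i) * right_inverse A (n + (l - i)) i)) / A n 0"

declare right_inverse.simps [simp del]

lemma right_inverse_conv:
  assumes "A n 0 \<noteq> 0"
  shows "(\<Sum>j\<le>l. A n j * right_inverse A (n + j) (l - j)) = (if l = 0 then 1 else 0)"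
proof -
  have "(\<Sum>j\<le>l. A n j * right_inverse A (n + j) (l - j)) =
        (\<Sum>i\<le>l. A n (l - i) * right_inverse A (n + (l - i)) i)"
    by (rule sum.reindex_bij_witness[where i = "\<lambda>i. l - i" and j = "\<lambda>i. l - i"]) auto
  also have "\<dots> = (\<Sum>i<l. A n (l - i) * right_inverse A (n + (l - i)) i) + A n 0 * right_inverse A n l"
    by (simp add: lessThan_Suc_atMost[symmetric])
  also have "A n 0 * right_inverse A n l = (if l = 0 then 1 else 0) -
     (\<Sum>i<l. A n (l - i) * right_inverse A (n + (l - i)) i)"
    using assms by (subst right_inverse.simps) simp
  finally show ?thesis by simp
qed

lemma triangle_sum:
  fixes f :: "nat \<Rightarrow> nat \<Rightarrow> 'a::comm_monoid_add"
  shows "(\<Sum>i\<le>l. \<Sum>j\<le>l - i. f i (i + j)) = (\<Sum>t\<le>l. \<Sum>i\<le>t. f i t)"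
  unfolding sum.Sigma[OF finite_atMost ballI[OF finite_atMost]] sum.Sigma[OF finite_atMost ballI[OF finite_atMost]]
  by (rule sum.reindex_bij_witness[where i = "\<lambda>(t, i). (i, t - i)" and j = "\<lambda>(i, j). (i + j, i)"]) auto

text \<open>Multiplying \<open>A B = I\<close> by the limiting inverse \<open>h\<close> gives \<open>B = h + e B\<close> with a small kernel \<open>e\<close>;
  the naive recursion for \<open>B\<close> would only give an exponential bound with a bad rate.\<close>

lemma kernel_limit_right_inverse:
  assumes A: "kernel_limit A a" and h: "subexponential h"
    and A0: "\<And>n. A n 0 \<noteq> 0"
    and inv: "\<And>l. (\<Sum>i\<le>l. h i * a (l - i)) = (if l = 0 then 1 else 0)"
  shows "kernel_limit (right_inverse A) h"
  unfolding kernel_limit_def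
proof (intro allI impI)
  fix r e0 :: real
  assume r: "r > 1" and e0: "e0 > 0"
  define B where "B = right_inverse A"
  \<comment> \<open>Three rates are kept apart: \<open>r2\<close> for the growth of
    \<open>h\<close>, \<open>r1\<close> for the error of \<open>A\<close>, \<open>r\<close> for the
    conclusion. The gaps make the geometric sums \<open>Q\<close> and \<open>Q'\<close>
    finite.\<close>
  define r1 where "r1 = (1 + r) / 2"
  define r2 where "r2 = (1 + r1) / 2"
  have rr: "1 < r2" "r2 < r1" "r1 < r" using r by (auto simp: r1_def r2_def)
  obtain C where C: "C \<ge> 0" "\<And>l. norm (h l) \<le> C * r2 ^ l"
    using h rr unfolding subexponential_def by blast
  define Q where "Q = 1 / (1 - r1 / r)"
  define Q' where "Q' = 1 / (1 - r2 / r1)"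
  have Q: "Q > 0" "Q' > 0" using rr by (auto simp: Q_def Q'_def)
  \<comment> \<open>\<open>2 * (d * Q) \<le> 1\<close> reproduces the constant \<open>2 * C\<close>
    in the induction for \<open>B\<close>; the other bound brings the final error
    \<open>2 * C * d * Q\<close> below \<open>e0\<close>.\<close>
  define d where "d = min (1 / (2 * Q)) (e0 / (2 * (C + 1) * Q))"
  have d: "d > 0" "2 * (d * Q) \<le> 1" "2 * (C + 1) * d * Q \<le> e0"
  proof -
    show "d > 0" using Q C e0 by (simp add: d_def)
    have "d \<le> 1 / (2 * Q)" "d \<le> e0 / (2 * (C + 1) * Q)" by (auto simp: d_def)
    moreover have "2 * (C + 1) * Q > 0" using Q C by simp
    ultimately show "2 * (d * Q) \<le> 1" "2 * (C + 1) * d * Q \<le> e0"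
      using Q by (simp_all only: pos_le_divide_eq) (simp_all add: mult_ac)
  qed
  define e where "e = d / ((C + 1) * Q')"
  have e: "e > 0" "C * e * Q' \<le> d"
  proof -
    show "e > 0" using d C Q by (simp add: e_def)
    have "C * e * Q' = (C / (C + 1)) * d" using Q by (simp add: e_def)
    also have "\<dots> \<le> 1 * d" using C d by (intro mult_right_mono) auto
    finally show "C * e * Q' \<le> d" by simp
  qed
  obtain M where M: "\<And>n j. n \<ge> M \<Longrightarrow> norm (A n j - a j) \<le> e * r1 ^ j"
    using A rr e(1) unfolding kernel_limit_def by (meson order.strict_trans)
  have M': "norm (a j - A n j) \<le> e * r1 ^ j" if "n \<ge> M" for n j
    using M[OF that] by (metis norm_minus_commute)
  \<comment> \<open>Since \<open>h a = I\<close>, this is the kernel \<open>I - h A\<close>; with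
    \<open>A B = I\<close> it gives \<open>B = h (A B) + (I - h A) B = h + E B\<close>.\<close>
  define E where "E n t = (\<Sum>i\<le>t. h i * (a (t - i) - A (n + i) (t - i)))" for n t
  have E_le: "norm (E n t) \<le> d * r1 ^ t" if n: "n \<ge> M" for n t
  proof -
    have "norm (E n t) \<le> (\<Sum>i\<le>t. norm (h i * (a (t - i) - A (n + i) (t - i))))"
      unfolding E_def by (rule norm_sum)
    also have "\<dots> \<le> (\<Sum>i\<le>t. (C * r2 ^ i) * (e * r1 ^ (t - i)))"
      unfolding norm_mult using n C rr
      by (intro sum_mono mult_mono C(2) M') auto
    also have "\<dots> = (\<Sum>i\<le>t. (C * e * r1 ^ t) * (r2 / r1) ^ i)"
      using rr by (intro sum.cong) (auto simp: power_diff field_simps)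
    also have "\<dots> = (C * e * r1 ^ t) * (\<Sum>i\<le>t. (r2 / r1) ^ i)"
      by (simp add: sum_distrib_left)
    also have "\<dots> \<le> (C * e * r1 ^ t) * Q'"
    proof (rule mult_left_mono)
      have "(\<Sum>i\<le>t. (r2 / r1) ^ i) \<le> (\<Sum>i. (r2 / r1) ^ i)"
        using rr by (intro sum_le_suminf summable_geometric) auto
      also have "\<dots> = Q'" using rr by (simp add: suminf_geometric Q'_def)
      finally show "(\<Sum>i\<le>t. (r2 / r1) ^ i) \<le> Q'" .
    qed (use C e rr in auto)
    also have "\<dots> = (C * e * Q') * r1 ^ t" by simp
    also have "\<dots> \<le> d * r1 ^ t" using e rr by (intro mult_right_mono) auto
    finally show ?thesis .
  qed
  have B_eq: "B n l = h l + (\<Sum>t\<le>l. E n t * B (n + t) (l - t))" for n l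
  proof -
    have "h l = (\<Sum>i\<le>l. if i = l then h i else 0)" by simp
    also have "\<dots> = (\<Sum>i\<le>l. h i * (if l - i = 0 then 1 else 0))"
      by (intro sum.cong) auto
    also have "\<dots> = (\<Sum>i\<le>l. h i * (\<Sum>j\<le>l - i. A (n + i) j * B (n + i + j) (l - i - j)))"
      unfolding B_def by (simp only: right_inverse_conv[of A, OF A0])
    also have "\<dots> = (\<Sum>i\<le>l. \<Sum>j\<le>l - i. h i * A (n + i) ((i + j) - i) * B (n + (i + j)) (l - (i + j)))"
      by (simp add: sum_distrib_left mult.assoc add.assoc)
    also have "\<dots> = (\<Sum>t\<le>l. \<Sum>i\<le>t. h i * A (n + i) (t - i) * B (n + t) (l - t))"
      by (rule triangle_sum)
    finally have hl: "h l = (\<Sum>t\<le>l. \<Sum>i\<le>t. h i * A (n + i) (t - i) * B (n + t) (l - t))" .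
    have "B n l = (\<Sum>t\<le>l. if t = 0 then B (n + t) (l - t) else 0)" by simp
    also have "\<dots> = (\<Sum>t\<le>l. (if t = 0 then 1 else 0) * B (n + t) (l - t))"
      by (intro sum.cong) auto
    also have "\<dots> = (\<Sum>t\<le>l. \<Sum>i\<le>t. h i * a (t - i) * B (n + t) (l - t))"
      by (simp only: inv[symmetric] sum_distrib_right)
    finally have "B n l - h l = (\<Sum>t\<le>l. \<Sum>i\<le>t. h i * (a (t - i) - A (n + i) (t - i)) * B (n + t) (l - t))"
      by (subst hl) (simp only: sum_subtractf[symmetric] left_diff_distrib right_diff_distrib)
    then have "B n l - h l = (\<Sum>t\<le>l. E n t * B (n + t) (l - t))"
      by (simp add: E_def sum_distrib_right)
    then show ?thesis by (simp add: algebra_simps)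
  qed
  have geo: "(\<Sum>t\<le>l. (r1 / r) ^ t) \<le> Q" for l
  proof -
    have "(\<Sum>i\<le>l. (r1 / r) ^ i) \<le> (\<Sum>i. (r1 / r) ^ i)"
      using rr by (intro sum_le_suminf summable_geometric) auto
    also have "\<dots> = Q" using rr by (simp add: suminf_geometric Q_def)
    finally show ?thesis .
  qed
  have tail: "norm (\<Sum>t\<in>T. E n t * B (n + t) (l - t)) \<le> c * d * r ^ l * (\<Sum>t\<in>T. (r1 / r) ^ t)"
    if n: "n \<ge> M" and T: "T \<subseteq> {..l}" and c: "c \<ge> 0"
      and IH: "\<And>t. t \<in> T \<Longrightarrow> norm (B (n + t) (l - t)) \<le> c * r ^ (l - t)" for n l T c
  proof -
    have "norm (\<Sum>t\<in>T. E n t * B (n + t) (l - t)) \<le> (\<Sum>t\<in>T. norm (E n t * B (n + t) (l - t)))"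
      by (rule norm_sum)
    also have "\<dots> \<le> (\<Sum>t\<in>T. (d * r1 ^ t) * (c * r ^ (l - t)))"
      unfolding norm_mult using n rr d
      by (intro sum_mono mult_mono E_le IH) auto
    also have "\<dots> = (\<Sum>t\<in>T. c * d * r ^ l * (r1 / r) ^ t)"
      using rr T by (intro sum.cong) (auto simp: power_diff field_simps subset_eq)
    finally show ?thesis by (simp add: sum_distrib_left)
  qed
  have B_le: "norm (B n l) \<le> 2 * C * r ^ l" if "n \<ge> M" for n l
    using that
  proof (induction l arbitrary: n rule: less_induct)
    case (less l)
    define X where "X = norm (B n l)"
    have split: "{..l} = insert 0 {1..l}" by auto
    \<comment> \<open>The term \<open>t = 0\<close> contains \<open>B n l\<close> itself and is
      absorbed on the left at the cost of a factor \<open>1 - d > 0\<close>; the other terms have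
      smaller offset. Their geometric sum is only \<open>Q - 1\<close>, which produces the same
      factor \<open>1 - d\<close> on the right.\<close>
    have "B n l = h l + E n 0 * B n l + (\<Sum>t\<in>{1..l}. E n t * B (n + t) (l - t))"
      by (subst B_eq, subst split, subst sum.insert) auto
    then have "X \<le> norm (h l) + norm (E n 0 * B n l) + norm (\<Sum>t\<in>{1..l}. E n t * B (n + t) (l - t))"
      unfolding X_def using norm_triangle_ineq[of "h l + E n 0 * B n l"] norm_triangle_ineq[of "h l" "E n 0 * B n l"]
      by (smt (verit, best))
    also have "norm (\<Sum>t\<in>{1..l}. E n t * B (n + t) (l - t)) \<le> 2 * C * d * r ^ l * (\<Sum>t\<in>{1..l}. (r1 / r) ^ t)"
      by (rule tail) (use less C in auto)
    also have "(\<Sum>t\<in>{1..l}. (r1 / r) ^ t) \<le> Q - 1"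
      using geo[of l] by (simp add: split)
    also have "norm (E n 0 * B n l) \<le> d * X"
      using E_le[OF less.prems, of 0] by (simp add: norm_mult X_def mult_right_mono)
    also have "norm (h l) \<le> C * r ^ l"
      using C rr by (intro order.trans[OF C(2)] mult_left_mono power_mono) auto
    finally have "X \<le> C * r ^ l + d * X + 2 * C * d * r ^ l * (Q - 1)"
      using C d r by (simp add: mult_left_mono)
    also have "\<dots> = C * r ^ l + d * X + C * r ^ l * (2 * (d * Q)) - 2 * C * r ^ l * d"
      by (simp add: algebra_simps)
    also have "\<dots> \<le> C * r ^ l + d * X + C * r ^ l * 1 - 2 * C * r ^ l * d"
      using C d r by (intro diff_right_mono add_left_mono mult_left_mono) auto
    finally have "X * (1 - d) \<le> 2 * C * r ^ l * (1 - d)" by (simp add: algebra_simps)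
    moreover have "d < 1"
    proof -
      have "Q > 1" using rr by (simp add: Q_def)
      then have "d * 1 < d * Q" using d by (intro mult_strict_left_mono) auto
      then show ?thesis using d by linarith
    qed
    ultimately show ?case by (simp add: X_def)
  qed
  have "norm (B n l - h l) \<le> e0 * r ^ l" if n: "n \<ge> M" for n l
  proof -
    have "norm (B n l - h l) \<le> 2 * C * d * r ^ l * (\<Sum>t\<le>l. (r1 / r) ^ t)"
    proof -
      have "B n l - h l = (\<Sum>t\<le>l. E n t * B (n + t) (l - t))" by (subst B_eq) simp
      then show ?thesis using tail[OF n order_refl, of "2 * C" l] B_le n C(1) by simp
    qed
    also have "\<dots> \<le> 2 * (C + 1) * d * r ^ l * Q"
      using C d r rr by (intro mult_mono geo sum_nonneg) auto
    also have "\<dots> = (2 * (C + 1) * d * Q) * r ^ l" by simp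
    also have "\<dots> \<le> e0 * r ^ l" using d r by (intro mult_right_mono) auto
    finally show ?thesis .
  qed
  then show "\<exists>M. \<forall>n\<ge>M. \<forall>j. norm (right_inverse A n j - h j) \<le> e0 * r ^ j"
    unfolding B_def by blast
qed

section \<open>Ratio limits\<close>

lemma ratio_growth:
  fixes g :: "nat \<Rightarrow> complex"
  assumes "\<And>n. n \<ge> N \<Longrightarrow> norm (g n) \<ge> R * norm (g (Suc n))" "R > 0" "n \<ge> N"
  shows "norm (g (n + j)) \<le> norm (g n) / R ^ j"
proof (induction j)
  case (Suc j)
  have "R * norm (g (Suc (n + j))) \<le> norm (g (n + j))" by (rule assms(1)) (use assms(3) in simp)
  then have "norm (g (Suc (n + j))) \<le> norm (g (n + j)) / R"
    using assms(2) by (simp add: field_simps)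
  also have "\<dots> \<le> norm (g n) / R ^ j / R"
    using Suc assms(2) by (intro divide_right_mono) auto
  finally show ?case by (simp add: field_simps)
qed simp

lemma ratio_tendsto_growth:
  assumes "ratio_tendsto g (\<lambda>n. g (Suc n)) \<tau>" "0 < R" "R < norm \<tau>"
  obtains N where "\<And>n. n \<ge> N \<Longrightarrow> g n \<noteq> 0"
    "\<And>n j. n \<ge> N \<Longrightarrow> norm (g (n + j)) \<le> norm (g n) / R ^ j"
proof -
  have nz: "\<forall>\<^sub>F n in sequentially. g (Suc n) \<noteq> 0"
    and lim: "(\<lambda>n. g n / g (Suc n)) \<longlonglongrightarrow> \<tau>"
    using assms(1) by (auto simp: ratio_tendsto_def)
  have "\<forall>\<^sub>F n in sequentially. norm (g n / g (Suc n)) > R"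
    using tendsto_norm[OF lim] assms(3) by (rule order_tendstoD)
  from eventually_conj[OF nz this]
  obtain N where N: "\<And>n. n \<ge> N \<Longrightarrow> g (Suc n) \<noteq> 0 \<and> norm (g n / g (Suc n)) > R"
    unfolding eventually_sequentially by blast
  show thesis
  proof
    show "g n \<noteq> 0" if "n \<ge> N" for n using N[OF that] assms(2) by auto
    show "norm (g (n + j)) \<le> norm (g n) / R ^ j" if "n \<ge> N" for n j
    proof (rule ratio_growth[where N = N])
      show "R * norm (g (Suc m)) \<le> norm (g m)" if "m \<ge> N" for m
        using N[OF that] by (auto simp: norm_divide pos_less_divide_eq)
    qed (use assms(2) that in auto)
  qed
qed

lemma ratio_tendsto_nonzero:
  assumes "ratio_tendsto g (\<lambda>n. g (Suc n)) \<tau>"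
  shows "\<forall>\<^sub>F n in sequentially. g n \<noteq> 0"
  using assms eventually_sequentially_Suc[of "\<lambda>n. g n \<noteq> 0"] by (simp add: ratio_tendsto_def)

lemma ratio_tendsto_shift:
  assumes "ratio_tendsto g (\<lambda>n. g (Suc n)) \<tau>" "\<tau> \<noteq> 0"
  shows "(\<lambda>n. g (n + j) / g n) \<longlonglongrightarrow> (1 / \<tau>) ^ j"
proof (induction j)
  case 0
  have "\<forall>\<^sub>F n in sequentially. g n \<noteq> 0" by (rule ratio_tendsto_nonzero[OF assms(1)])
  then have "\<forall>\<^sub>F n in sequentially. g (n + 0) / g n = 1" by eventually_elim simp
  then show ?case using tendsto_eventually by fastforce
next
  case (Suc j)
  have lim: "(\<lambda>n. g n / g (Suc n)) \<longlonglongrightarrow> \<tau>" using assms(1) by (simp add: ratio_tendsto_def)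
  have nz': "\<forall>\<^sub>F n in sequentially. g (n + j) \<noteq> 0"
    using ratio_tendsto_nonzero[OF assms(1)] unfolding eventually_sequentially
    by (meson trans_le_add1)
  have "(\<lambda>n. inverse (g (n + j) / g (Suc (n + j)))) \<longlonglongrightarrow> inverse \<tau>"
    by (intro tendsto_inverse assms(2)) (use LIMSEQ_ignore_initial_segment[OF lim, of j] in simp)
  from tendsto_mult[OF this Suc]
  have "(\<lambda>n. inverse (g (n + j) / g (Suc (n + j))) * (g (n + j) / g n)) \<longlonglongrightarrow> (1 / \<tau>) ^ Suc j"
    by (simp add: divide_inverse)
  then show ?case
  proof (rule Lim_transform_eventually)
    show "\<forall>\<^sub>F n in sequentially. inverse (g (n + j) / g (Suc (n + j))) * (g (n + j) / g n) = g (n + Suc j) / g n"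
      using nz' by eventually_elim simp
  qed
qed

text \<open>Term by term the limit is \<open>k j * \<alpha> * (1 / \<tau>)^j\<close>, and rates
  \<open>r < R < |\<tau>|\<close> dominate the series; the result is \<alpha> times the generating
  function of \<open>k\<close> at \<open>1 / \<tau>\<close>. The reference sequence \<open>g\<close>
  is separate from \<open>y\<close> so that a negligible \<open>y\<close>, with
  \<open>\<alpha> = 0\<close>, is covered too.\<close>

lemma upper_sum_ratio:
  assumes K: "kernel_limit K k" "subexponential k"
    and g: "ratio_tendsto g (\<lambda>n. g (Suc n)) \<tau>" and \<tau>: "norm \<tau> > 1"
    and y: "(\<lambda>n. y n / g n) \<longlonglongrightarrow> \<alpha>"
  shows "(\<lambda>n. upper_sum K y n / g n) \<longlonglongrightarrow> \<alpha> * (\<Sum>j. k j * (1 / \<tau>) ^ j)"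
proof -
  define R where "R = (1 + norm \<tau>) / 2"
  define r where "r = (1 + R) / 2"
  have r: "1 < r" "r < R" "R < norm \<tau>" using \<tau> by (auto simp: R_def r_def)
  have R: "R > 0" using r by simp
  obtain C N1 where C: "C \<ge> 0" "\<And>n j. n \<ge> N1 \<Longrightarrow> norm (K n j) \<le> C * r ^ j"
    using kernel_limit_bound[OF K r(1)] by blast
  obtain N2 where nz: "\<And>n. n \<ge> N2 \<Longrightarrow> g n \<noteq> 0"
    and gb: "\<And>n j. n \<ge> N2 \<Longrightarrow> norm (g (n + j)) \<le> norm (g n) / R ^ j"
    by (rule ratio_tendsto_growth[OF g R r(3)]) (rule that, assumption+)
  obtain D where D: "D > 0" "\<And>n. norm (y n / g n) \<le> D"
    using convergent_imp_Bseq[OF convergentI[OF y]] by (auto simp: Bseq_def)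
  define a where "a j n = K n j * (y (n + j) / g n)" for j n
  define N where "N = max N1 N2"
  have bound: "norm (a j n) \<le> C * D * (r / R) ^ j" if n: "n \<ge> N" for j n
  proof -
    have "g (n + j) \<noteq> 0" "g n \<noteq> 0" using nz n by (auto simp: N_def)
    then have "norm (y (n + j) / g n) = norm (y (n + j) / g (n + j)) * (norm (g (n + j)) / norm (g n))"
      by (simp add: norm_divide)
    also have "\<dots> \<le> D * (1 / R ^ j)"
    proof (intro mult_mono D(2))
      show "norm (g (n + j)) / norm (g n) \<le> 1 / R ^ j"
        using gb[of n j] n \<open>g n \<noteq> 0\<close> by (simp add: N_def field_simps)
    qed (use D in auto)
    finally have "norm (a j n) \<le> (C * r ^ j) * (D * (1 / R ^ j))"
      unfolding a_def norm_mult using C D n r by (intro mult_mono C(2)) (auto simp: N_def)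
    then show ?thesis by (simp add: field_simps)
  qed
  have a_lim: "(\<lambda>n. a j n) \<longlonglongrightarrow> k j * (\<alpha> * (1 / \<tau>) ^ j)" for j
  proof -
    have "(\<lambda>n. (y (n + j) / g (n + j)) * (g (n + j) / g n)) \<longlonglongrightarrow> \<alpha> * (1 / \<tau>) ^ j"
      using \<tau> by (intro tendsto_mult LIMSEQ_ignore_initial_segment[OF y] ratio_tendsto_shift[OF g]) auto
    moreover have "\<forall>\<^sub>F n in sequentially. (y (n + j) / g (n + j)) * (g (n + j) / g n) = y (n + j) / g n"
      using nz unfolding eventually_sequentially by (intro exI[of _ N2]) auto
    ultimately have "(\<lambda>n. y (n + j) / g n) \<longlonglongrightarrow> \<alpha> * (1 / \<tau>) ^ j"
      by (rule Lim_transform_eventually)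
    then show ?thesis unfolding a_def
      by (intro tendsto_mult kernel_limit_pointwise[OF K(1)])
  qed
  have sm: "summable (\<lambda>j. C * D * (r / R) ^ j)" using r by (intro summable_mult summable_geometric) auto
  have bnd: "eventually (\<lambda>(j, n). norm (a j n) \<le> C * D * (r / R) ^ j) (at_top \<times>\<^sub>F sequentially)"
    unfolding eventually_prod_filter
    by (intro exI[of _ "\<lambda>_. True"] exI[of _ "\<lambda>n. n \<ge> N"]) (use bound in auto)
  have T: "(\<lambda>n. suminf (\<lambda>j. a j n)) \<longlonglongrightarrow> (\<Sum>j. k j * (\<alpha> * (1 / \<tau>) ^ j))"
    using tannerys_theorem[OF a_lim bnd sm sequentially_bot] by blast
  have "summable (\<lambda>j. norm (k j * (1 / \<tau>) ^ j))"
  proof -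
    obtain C' where C': "\<And>j. norm (k j) \<le> C' * r ^ j"
      using K(2) r(1) unfolding subexponential_def by blast
    have le: "norm (norm (k j * (1 / \<tau>) ^ j)) \<le> C' * (r / norm \<tau>) ^ j" for j
    proof -
      have "norm (k j) * norm ((1 / \<tau>) ^ j) \<le> (C' * r ^ j) * norm ((1 / \<tau>) ^ j)"
        by (intro mult_right_mono C') auto
      then show ?thesis by (simp add: norm_mult norm_power norm_divide power_divide)
    qed
    have "summable (\<lambda>j. C' * (r / norm \<tau>) ^ j)"
    proof (intro summable_mult summable_geometric)
      have "norm \<tau> > 0" using r by linarith
      then have "r / norm \<tau> < 1" using r by (simp only: pos_divide_less_eq)
      then show "norm (r / norm \<tau>) < 1" using r by simp
    qed
    then show ?thesis by (rule summable_comparison_test'[where N = 0]) (rule le)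
  qed
  then have "(\<Sum>j. \<alpha> * (k j * (1 / \<tau>) ^ j)) = \<alpha> * (\<Sum>j. k j * (1 / \<tau>) ^ j)"
    by (rule suminf_mult[OF summable_norm_cancel])
  moreover have "(\<Sum>j. \<alpha> * (k j * (1 / \<tau>) ^ j)) = (\<Sum>j. k j * (\<alpha> * (1 / \<tau>) ^ j))"
    by (simp add: mult.left_commute)
  moreover have "upper_sum K y n / g n = suminf (\<lambda>j. a j n)" if "n \<ge> N" for n
  proof -
    have sma: "summable (\<lambda>j. a j n)"
      by (rule summable_comparison_test'[OF sm, where N = 0]) (rule bound[OF that])
    have "g n \<noteq> 0" using nz that by (simp add: N_def)
    have "upper_sum K y n = (\<Sum>j. a j n * g n)"
      unfolding upper_sum_def a_def using \<open>g n \<noteq> 0\<close> by simp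
    also have "\<dots> = (\<Sum>j. a j n) * g n" by (rule suminf_mult2[symmetric, OF sma])
    finally show ?thesis using \<open>g n \<noteq> 0\<close> by simp
  qed
  then have "\<forall>\<^sub>F n in sequentially. suminf (\<lambda>j. a j n) = upper_sum K y n / g n"
    unfolding eventually_sequentially by metis
  ultimately show ?thesis using Lim_transform_eventually[OF T] by simp
qed

section \<open>Decay of sequences and perturbed recurrences\<close>

lemma ratio_limit_ge_decay:
  assumes g: "ratio_tendsto g (\<lambda>n. g (Suc n)) \<tau>" and R: "R > 0"
    and b: "\<And>n. n \<ge> N \<Longrightarrow> norm (g n) \<le> C / R ^ n"
  shows "norm \<tau> \<ge> R"
proof (rule ccontr)
  assume "\<not> norm \<tau> \<ge> R"
  \<comment> \<open>If \<open>|\<tau>| < r < R\<close>, then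
    \<open>norm (g (n + 1)) \<ge> norm (g n) / r\<close> eventually, and the lower bound of order
    \<open>r^(-j)\<close> contradicts decay of order \<open>R^(-j)\<close>. The midpoint is positive
    even for \<open>\<tau> = 0\<close>.\<close>
  define r where "r = (norm \<tau> + R) / 2"
  have r: "norm \<tau> < r" "r < R" "0 < r"
    using \<open>\<not> norm \<tau> \<ge> R\<close> R unfolding r_def by (auto intro: add_nonneg_pos)
  have nz: "\<forall>\<^sub>F n in sequentially. g (Suc n) \<noteq> 0"
    and lim: "(\<lambda>n. g n / g (Suc n)) \<longlonglongrightarrow> \<tau>"
    using g by (auto simp: ratio_tendsto_def)
  have "\<forall>\<^sub>F n in sequentially. norm (g n / g (Suc n)) < r"
    using tendsto_norm[OF lim] r(1) by (rule order_tendstoD)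
  from eventually_conj[OF nz this]
  obtain N0 where N0: "\<And>n. n \<ge> N0 \<Longrightarrow> g (Suc n) \<noteq> 0 \<and> norm (g n / g (Suc n)) < r"
    unfolding eventually_sequentially by blast
  define M where "M = Suc (max N N0)"
  have gM: "norm (g M) > 0" using N0[of "max N N0"] by (simp add: M_def)
  have low: "norm (g (M + j)) \<ge> norm (g M) / r ^ j" for j
  proof (induction j)
    case (Suc j)
    have "g (Suc (M + j)) \<noteq> 0" "norm (g (M + j) / g (Suc (M + j))) < r"
      using N0[of "M + j"] by (auto simp: M_def)
    then have "norm (g (M + j)) / r \<le> norm (g (Suc (M + j)))"
      using r by (simp add: norm_divide field_simps)
    moreover have "norm (g M) / r ^ j / r \<le> norm (g (M + j)) / r"
      using Suc r by (intro divide_right_mono) auto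
    ultimately show ?case by (simp add: field_simps)
  qed simp
  have "(R / r) ^ j \<le> C / R ^ M / norm (g M)" for j
  proof -
    have "norm (g M) / r ^ j \<le> C / R ^ (M + j)"
      by (rule order.trans[OF low b]) (simp add: M_def)
    then show ?thesis using gM r R by (simp add: field_simps power_add)
  qed
  moreover obtain j where "(R / r) ^ j > C / R ^ M / norm (g M)"
    using real_arch_pow[of "R / r"] r by auto
  ultimately show False by (meson not_le)
qed

text \<open>Only finitely many terms can reach \<open>a n\<close>, so the supremum over the tail is
  a maximum.\<close>

lemma tendsto_0_max_attained:
  fixes a :: "nat \<Rightarrow> real"
  assumes "a \<longlonglongrightarrow> 0" "a n > 0" "n \<ge> N"
  obtains m where "m \<ge> N" "a m > 0" "\<And>k. k \<ge> N \<Longrightarrow> a k \<le> a m"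
proof -
  have "\<forall>\<^sub>F k in sequentially. a k < a n" using assms(1,2) by (rule order_tendstoD)
  then obtain K where K: "\<And>k. k \<ge> K \<Longrightarrow> a k < a n" by (auto simp: eventually_sequentially)
  define X where "X = {N..max n K}"
  have X: "finite (a ` X)" "n \<in> X" using assms(3) by (auto simp: X_def)
  then have "Max (a ` X) \<in> a ` X" by (intro Max_in) auto
  then obtain m where m: "m \<in> X" "a m = Max (a ` X)" by auto
  have le: "a k \<le> a m" if "k \<in> X" for k using m(2) X that by simp
  show thesis
  proof
    show "m \<ge> N" using m by (simp add: X_def)
    show "a m > 0" using le[OF X(2)] assms(2) by simp
    show "a k \<le> a m" if "k \<ge> N" for k
    proof (cases "k \<in> X")
      case False
      then have "k \<ge> K" using that by (simp add: X_def)
      then show ?thesis using K le[OF X(2)] by (meson less_imp_le order_trans)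
    qed (rule le)
  qed
qed

text \<open>The recurrence \<open>v n = \<tau> v (n+1) + small\<close>, where the perturbation is small compared with the
  weighted supremum of the tail. An index where the weighted supremum is attained transmits this
  property to its predecessor, and the decay of \<open>v\<close> yields arbitrarily large such indices.\<close>

lemma perturbed_recurrence:
  fixes v :: "nat \<Rightarrow> complex"
  assumes decay: "(\<lambda>n. norm (v n) * R ^ n) \<longlonglongrightarrow> 0" and R: "R > 0"
    and \<tau>: "\<tau> = 0 \<or> norm \<tau> > R"
    and inf: "\<And>N. \<exists>n\<ge>N. v n \<noteq> 0"
    and rec: "\<And>e. e > 0 \<Longrightarrow> \<exists>M. \<forall>n\<ge>M. \<forall>W. (\<forall>j. norm (v (Suc n + j)) \<le> W / R ^ j) \<longrightarrow>
                 norm (v n - \<tau> * v (Suc n)) \<le> e * W"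
  shows "\<tau> \<noteq> 0" and "ratio_tendsto v (\<lambda>n. v (Suc n)) \<tau>"
proof -
  define a where "a n = norm (v n) * R ^ n" for n
  \<comment> \<open>The weighted supremum of the tail from \<open>n\<close> is attained at
    \<open>n\<close>; then \<open>W = norm (v n)\<close> is admissible in \<open>rec\<close> for the
    preceding index.\<close>
  define good where "good n \<longleftrightarrow> (\<forall>j. norm (v (n + j)) \<le> norm (v n) / R ^ j)" for n
  have good_iff: "good n \<longleftrightarrow> (\<forall>k\<ge>n. a k \<le> a n)" for n
  proof -
    have "norm (v (n + j)) \<le> norm (v n) / R ^ j \<longleftrightarrow> a (n + j) \<le> a n" for j
      using R by (simp add: a_def power_add field_simps)
    then show ?thesis unfolding good_def by (metis le_Suc_ex le_add1)
  qed
  have ex_good: "\<exists>m\<ge>N. good m \<and> v m \<noteq> 0" for N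
  proof -
    obtain n where n: "n \<ge> N" "v n \<noteq> 0" using inf by blast
    then have "a n > 0" using R by (simp add: a_def)
    then obtain m where m: "m \<ge> N" "a m > 0" "\<And>k. k \<ge> N \<Longrightarrow> a k \<le> a m"
      using tendsto_0_max_attained[of a n N] decay n(1) unfolding a_def by blast
    have "good m" using m by (simp add: good_iff)
    moreover have "v m \<noteq> 0" using m(2) by (auto simp: a_def)
    ultimately show ?thesis using m(1) by blast
  qed
  show "\<tau> \<noteq> 0"
  proof
    assume [simp]: "\<tau> = 0"
    have "R / 2 > 0" using R by simp
    then obtain M where M: "\<And>n W. n \<ge> M \<Longrightarrow> (\<forall>j. norm (v (Suc n + j)) \<le> W / R ^ j) \<Longrightarrow>
                 norm (v n - \<tau> * v (Suc n)) \<le> R / 2 * W"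
      using rec[of "R / 2"] by blast
    obtain m where m: "m \<ge> M" "good m" "v m \<noteq> 0" using ex_good by blast
    \<comment> \<open>Starting the tail one index later gains a factor \<open>1 / R\<close>; with
      tolerance \<open>R / 2\<close> the recurrence gives
      \<open>norm (v m) \<le> norm (v m) / 2\<close>.\<close>
    have "norm (v (Suc m + j)) \<le> (norm (v m) / R) / R ^ j" for j
      using m(2)[unfolded good_def, rule_format, of "Suc j"] by simp
    then have "norm (v m) \<le> R / 2 * (norm (v m) / R)" using M[OF m(1), of "norm (v m) / R"] by simp
    then show False using R m(3) by simp
  qed
  then have \<tau>R: "norm \<tau> > R" using \<tau> by simp
  have step: "\<exists>M. \<forall>n\<ge>M. good (Suc n) \<longrightarrow> norm (v n - \<tau> * v (Suc n)) \<le> e * norm (v (Suc n))"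
    if "e > 0" for e
    using rec[OF that] unfolding good_def by blast
  \<comment> \<open>The tolerance \<open>|\<tau>| - R\<close> still leaves
    \<open>norm (v n) \<ge> R * norm (v (Suc n))\<close>, so \<open>a (Suc n) \<le> a n\<close> and
    goodness passes from \<open>Suc n\<close> to \<open>n\<close>.\<close>
  obtain M where M: "\<And>n. n \<ge> M \<Longrightarrow> good (Suc n) \<Longrightarrow>
      norm (v n - \<tau> * v (Suc n)) \<le> (norm \<tau> - R) * norm (v (Suc n))"
    using step[of "norm \<tau> - R"] \<tau>R by auto
  have down: "good n \<and> R * norm (v (Suc n)) \<le> norm (v n)" if n: "n \<ge> M" "good (Suc n)" for n
  proof -
    have "norm (\<tau> * v (Suc n)) \<le> norm (v n) + norm (v n - \<tau> * v (Suc n))"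
      using norm_triangle_ineq4[of "v n" "v n - \<tau> * v (Suc n)"] by simp
    then have *: "R * norm (v (Suc n)) \<le> norm (v n)"
      using M[OF n] by (simp add: norm_mult algebra_simps)
    have le: "a (Suc n) \<le> a n"
      using mult_right_mono[OF *, of "R ^ n"] R by (simp add: a_def mult_ac)
    have "a k \<le> a n" if "k \<ge> n" for k
    proof (cases "k = n")
      case False
      then have "a k \<le> a (Suc n)" using n(2) that unfolding good_iff by simp
      then show ?thesis using le by simp
    qed simp
    then have "good n" unfolding good_iff by blast
    then show ?thesis using * by simp
  qed
  have all_good: "good n" if "n \<ge> M" for n
  proof -
    obtain m where m: "m \<ge> n" "good m" using ex_good by blast
    show ?thesis using m(1) m(2)
    proof (induction rule: inc_induct)
      case (step k)
      then show ?case using down[of k] that by auto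
    qed
  qed
  have nz: "v n \<noteq> 0" if n: "n \<ge> M" for n
  proof
    assume 0: "v n = 0"
    obtain m where m: "m \<ge> n" "v m \<noteq> 0" using inf by blast
    then have "norm (v (n + (m - n))) \<le> 0" using all_good[OF n] 0 unfolding good_def by (metis div_0 norm_zero)
    then show False using m by simp
  qed
  have "(\<lambda>n. v n / v (Suc n)) \<longlonglongrightarrow> \<tau>"
  proof (rule LIMSEQ_I)
    fix e :: real assume "e > 0"
    then obtain M' where M': "\<And>n. n \<ge> M' \<Longrightarrow> good (Suc n) \<Longrightarrow>
        norm (v n - \<tau> * v (Suc n)) \<le> e / 2 * norm (v (Suc n))"
      using step[of "e / 2"] by auto
    have "norm (v n / v (Suc n) - \<tau>) < e" if n: "n \<ge> max M M'" for n
    proof -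
      have 0: "v (Suc n) \<noteq> 0" using nz n by simp
      then have "v n / v (Suc n) - \<tau> = (v n - \<tau> * v (Suc n)) / v (Suc n)" by (simp add: field_simps)
      then have "norm (v n / v (Suc n) - \<tau>) \<le> e / 2"
        using M'[of n] all_good[of "Suc n"] n 0 by (simp add: norm_divide field_simps)
      then show ?thesis using \<open>e > 0\<close> by simp
    qed
    then show "\<exists>no. \<forall>n\<ge>no. norm (v n / v (Suc n) - \<tau>) < e" by blast
  qed
  moreover have "\<forall>\<^sub>F n in sequentially. v (Suc n) \<noteq> 0"
    unfolding eventually_sequentially by (intro exI[of _ M]) (use nz in auto)
  ultimately show "ratio_tendsto v (\<lambda>n. v (Suc n)) \<tau>" by (simp add: ratio_tendsto_def)
qed

section \<open>Taylor and Laurent coefficients\<close>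

definition taylor_coeff :: "(complex \<Rightarrow> complex) \<Rightarrow> nat \<Rightarrow> complex" where
  "taylor_coeff \<phi> j = (deriv ^^ j) \<phi> 0 / fact j"

lemma taylor_coeff_sums:
  assumes "\<phi> holomorphic_on ball 0 1" "norm u < 1"
  shows "(\<lambda>j. taylor_coeff \<phi> j * u ^ j) sums \<phi> u"
  using holomorphic_power_series[OF assms(1), of u] assms(2) by (simp add: taylor_coeff_def)

lemma taylor_coeff_0: "taylor_coeff \<phi> 0 = \<phi> 0"
  by (simp add: taylor_coeff_def)

lemma taylor_coeff_bound:
  assumes "\<phi> holomorphic_on ball 0 1" "(r::real) > 1"
    and "\<And>u. norm u = 1 / r \<Longrightarrow> norm (\<phi> u) \<le> B"
  shows "norm (taylor_coeff \<phi> j) \<le> B * r ^ j"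
proof -
  have "1 / r < 1" using assms(2) by simp
  then have "cball (0::complex) (1 / r) \<subseteq> ball 0 1" by (auto intro: le_less_trans)
  then have "continuous_on (cball 0 (1 / r)) \<phi>" "\<phi> holomorphic_on ball 0 (1 / r)"
    using assms(1,2) by (auto intro!: holomorphic_on_imp_continuous_on intro: holomorphic_on_subset[OF _ order.trans[OF ball_subset_cball]])
  then have "norm ((deriv ^^ j) \<phi> 0) \<le> fact j * B / (1 / r) ^ j"
    using assms(2,3) by (intro Cauchy_inequality) auto
  then show ?thesis
    using assms(2) by (simp add: taylor_coeff_def norm_divide field_simps)
qed

lemma taylor_coeff_subexponential:
  assumes "\<phi> holomorphic_on ball 0 1"
  shows "subexponential (taylor_coeff \<phi>)"
  unfolding subexponential_def
proof (intro allI impI)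
  fix r :: real assume r: "r > 1"
  have sub: "sphere (0::complex) (1 / r) \<subseteq> ball 0 1" using r by auto
  have "compact (\<phi> ` sphere 0 (1 / r))"
    by (intro compact_continuous_image holomorphic_on_imp_continuous_on holomorphic_on_subset[OF assms sub]) auto
  then obtain B where B: "B > 0" "\<And>u. u \<in> sphere 0 (1 / r) \<Longrightarrow> norm (\<phi> u) \<le> B"
    using bounded_pos[of "\<phi> ` sphere 0 (1 / r)"] by (auto simp: compact_imp_bounded)
  have "norm (taylor_coeff \<phi> j) \<le> B * r ^ j" for j
    by (rule taylor_coeff_bound[OF assms r]) (use B in auto)
  then show "\<exists>C\<ge>0. \<forall>j. norm (taylor_coeff \<phi> j) \<le> C * r ^ j" using B by (intro exI[of _ B]) auto
qed

text \<open>Converts uniform convergence on the circle \<open>|u| = 1/r\<close> into the weighted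
  convergence of \<open>kernel_limit\<close>.\<close>

lemma taylor_coeff_diff_bound:
  assumes "\<phi> holomorphic_on ball 0 1" "\<psi> holomorphic_on ball 0 1" "(r::real) > 1"
    and "\<And>u. norm u = 1 / r \<Longrightarrow> norm (\<phi> u - \<psi> u) \<le> B"
  shows "norm (taylor_coeff \<phi> j - taylor_coeff \<psi> j) \<le> B * r ^ j"
proof -
  have "taylor_coeff (\<lambda>u. \<phi> u - \<psi> u) j = taylor_coeff \<phi> j - taylor_coeff \<psi> j"
    unfolding taylor_coeff_def
    by (subst higher_deriv_diff[OF assms(1,2)]) (auto simp: diff_divide_distrib)
  then show ?thesis
    using taylor_coeff_bound[of "\<lambda>u. \<phi> u - \<psi> u" r B j] assms by (auto intro: holomorphic_on_diff)
qed

lemma taylor_coeff_inverse: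
  assumes hol: "\<phi> holomorphic_on ball 0 1" and nz: "\<And>u. norm u < 1 \<Longrightarrow> \<phi> u \<noteq> 0"
  shows "(\<lambda>u. inverse (\<phi> u)) holomorphic_on ball 0 1"
    and "(\<Sum>i\<le>l. taylor_coeff (\<lambda>u. inverse (\<phi> u)) i * taylor_coeff \<phi> (l - i)) = (if l = 0 then 1 else 0)"
proof -
  show hol': "(\<lambda>u. inverse (\<phi> u)) holomorphic_on ball 0 1"
    using hol nz by (intro holomorphic_on_inverse) auto
  define P where "P = fps_expansion (\<lambda>u. inverse (\<phi> u)) 0"
  define Q where "Q = fps_expansion \<phi> 0"
  have "(\<lambda>u. inverse (\<phi> u)) has_fps_expansion P" "\<phi> has_fps_expansion Q"
    unfolding P_def Q_def
    by (intro has_fps_expansion_fps_expansion[of "ball 0 1"] hol hol'; simp)+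
  then have 1: "(\<lambda>u. inverse (\<phi> u) * \<phi> u) has_fps_expansion P * Q"
    by (rule has_fps_expansion_mult)
  have 2: "\<forall>\<^sub>F u in nhds 0. inverse (\<phi> u) * \<phi> u = 1"
    by (rule eventually_mono[OF eventually_nhds_in_open[of "ball 0 1"]]) (use nz in auto)
  have "(\<lambda>u. 1) has_fps_expansion P * Q"
    by (rule has_fps_expansion_cong[OF 2 refl, THEN iffD1, OF 1])
  then have "P * Q = 1" using fps_expansion_unique_complex has_fps_expansion_1 by blast
  then have "fps_nth (P * Q) l = (if l = 0 then 1 else 0)" by simp
  then show "(\<Sum>i\<le>l. taylor_coeff (\<lambda>u. inverse (\<phi> u)) i * taylor_coeff \<phi> (l - i)) = (if l = 0 then 1 else 0)"
    by (simp add: fps_mult_nth P_def Q_def fps_expansion_def taylor_coeff_def atMost_atLeast0)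
qed

lemma kernel_limit_const: "kernel_limit (\<lambda>_. k) k"
  unfolding kernel_limit_def by (auto intro!: exI[of _ 0] mult_nonneg_nonneg)

lemma taylor_coeff_abs_has_sum:
  assumes "\<phi> holomorphic_on ball 0 1" "norm u < 1"
  shows "((\<lambda>j. taylor_coeff \<phi> j * u ^ j) has_sum \<phi> u) UNIV"
proof (rule norm_summable_imp_has_sum[OF _ taylor_coeff_sums[OF assms]])
  \<comment> \<open>Any \<open>r > 1\<close> with \<open>norm u * r < 1\<close> will do; the
    midpoint of \<open>1\<close> and \<open>1 / norm u\<close> serves, and \<open>u = 0\<close>
    imposes nothing.\<close>
  define r where "r = (if u = 0 then 2 else (1 + 1 / norm u) / 2)"
  have r: "r > 1" "norm u * r < 1"
    using assms(2) by (auto simp: r_def field_simps)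
  obtain C where C: "\<And>j. norm (taylor_coeff \<phi> j) \<le> C * r ^ j"
    using taylor_coeff_subexponential[OF assms(1)] r(1) unfolding subexponential_def by blast
  have le: "norm (norm (taylor_coeff \<phi> j * u ^ j)) \<le> C * (norm u * r) ^ j" for j
  proof -
    have "norm (taylor_coeff \<phi> j) * norm (u ^ j) \<le> (C * r ^ j) * norm (u ^ j)"
      by (intro mult_right_mono C) auto
    then show ?thesis by (simp add: norm_mult norm_power power_mult_distrib mult_ac)
  qed
  have "summable (\<lambda>j. C * (norm u * r) ^ j)"
    using r by (intro summable_mult summable_geometric) auto
  then show "summable (\<lambda>j. norm (taylor_coeff \<phi> j * u ^ j))"
    by (rule summable_comparison_test'[where N = 0]) (rule le)
qed

section \<open>Products of unordered sums and of Laurent expansions\<close>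

lemma has_sum_times_complex:
  fixes f :: "'a \<Rightarrow> complex" and g :: "'b \<Rightarrow> complex"
  assumes f: "(f has_sum S) A" and g: "(g has_sum T) B"
  shows "((\<lambda>(x, y). f x * g y) has_sum S * T) (A \<times> B)"
proof (rule has_sum_SigmaI)
  show "((\<lambda>y. case (x, y) of (x, y) \<Rightarrow> f x * g y) has_sum f x * T) B" for x
    using has_sum_cmult_right[OF g] by simp
  show "((\<lambda>x. f x * T) has_sum S * T) A" by (rule has_sum_cmult_left[OF f])
  have fa: "(\<lambda>x. norm (f x)) summable_on A" and ga: "(\<lambda>x. norm (g x)) summable_on B"
    using f g has_sum_imp_summable summable_on_iff_abs_summable_on_complex by blast+
  have "(\<lambda>p. norm (case p of (x, y) \<Rightarrow> f x * g y)) summable_on Sigma A (\<lambda>_. B)"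
  proof (rule iffD2[OF Infinite_Sum.abs_summable_on_Sigma_iff], intro conjI ballI)
    show "(\<lambda>y. norm (case (x, y) of (x, y) \<Rightarrow> f x * g y)) summable_on B" for x
      using summable_on_cmult_right[OF ga, of "norm (f x)"] by (simp add: norm_mult)
    show "(\<lambda>x. norm (infsum (\<lambda>y. norm (case (x, y) of (x, y) \<Rightarrow> f x * g y)) B)) summable_on A"
      using summable_on_cmult_left[OF fa, of "infsum (\<lambda>y. norm (g y)) B"]
      by (simp add: norm_mult infsum_cmult_right' infsum_nonneg abs_mult)
  qed
  then show "(\<lambda>(x, y). f x * g y) summable_on A \<times> B" by (rule abs_summable_summable)
qed

text \<open>Absolute convergence at the real point \<open>w = R\<close> bounds each term
  \<open>norm (a n) * R^n\<close> by the whole sum.\<close>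

lemma laurent_coeffs_decay:
  assumes "laurent_coeffs_outside_disk f a"
  obtains \<rho> where "\<rho> > 1"
    "\<And>R. 1 < R \<Longrightarrow> R < \<rho> \<Longrightarrow> \<exists>C. \<forall>n::nat. norm (a (int n)) \<le> C / R ^ n"
    "\<And>w. 1 < norm w \<Longrightarrow> norm w < \<rho> \<Longrightarrow> ((\<lambda>k. a k * w powi k) has_sum f w) UNIV"
proof -
  obtain \<rho> where \<rho>: "\<rho> > 1"
    and hs: "\<And>w. 1 < norm w \<Longrightarrow> norm w < \<rho> \<Longrightarrow> ((\<lambda>k. a k * w powi k) has_sum f w) UNIV"
    using assms unfolding laurent_coeffs_outside_disk_def by blast
  have "\<exists>C. \<forall>n::nat. norm (a (int n)) \<le> C / R ^ n" if R: "1 < R" "R < \<rho>" for R :: real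
  proof -
    have "(\<lambda>k. a k * of_real R powi k) summable_on UNIV"
      using hs[of "of_real R"] R by (intro has_sum_imp_summable) auto
    then have abs: "(\<lambda>k. norm (a k * of_real R powi k)) summable_on UNIV"
      by (simp only: summable_on_iff_abs_summable_on_complex)
    define C where "C = infsum (\<lambda>k. norm (a k * of_real R powi k)) UNIV"
    have "norm (a (int n)) * R ^ n \<le> C" for n
    proof -
      have "(\<Sum>k\<in>{int n}. norm (a k * of_real R powi k)) \<le> C"
        unfolding C_def by (rule finite_sum_le_infsum[OF abs]) auto
      then show ?thesis using R by (simp add: norm_mult norm_power)
    qed
    then show ?thesis using R by (intro exI[of _ C]) (simp add: pos_le_divide_eq)
  qed
  then show thesis using that \<rho> hs by blast
qed

text \<open>Only powers \<open>w^(-j)\<close> occur in \<open>\<phi>(1 / w)\<close>, so the new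
  coefficient at \<open>n\<close> involves the old ones from \<open>n\<close> onward: on the
  nonnegative coefficients, multiplication is a Toeplitz upper sum. Absolute convergence permits
  regrouping by \<open>n = k - j\<close>.\<close>

lemma laurent_coeffs_times_taylor:
  assumes f: "laurent_coeffs_outside_disk f a" and \<phi>: "\<phi> holomorphic_on ball 0 1"
  shows "laurent_coeffs_outside_disk (\<lambda>w. \<phi> (1 / w) * f w)
           (\<lambda>n. \<Sum>j. taylor_coeff \<phi> j * a (n + int j))"
proof -
  obtain \<rho> where \<rho>: "\<rho> > 1"
    and hs: "\<And>w. 1 < norm w \<Longrightarrow> norm w < \<rho> \<Longrightarrow> ((\<lambda>k. a k * w powi k) has_sum f w) UNIV"
    using f unfolding laurent_coeffs_outside_disk_def by blast
  have "((\<lambda>n. (\<Sum>j. taylor_coeff \<phi> j * a (n + int j)) * w powi n) has_sum \<phi> (1 / w) * f w) UNIV"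
    if w: "1 < norm w" "norm w < \<rho>" for w
  proof -
    have w0: "w \<noteq> 0" using w by auto
    define F where "F = (\<lambda>(n, j). taylor_coeff \<phi> j * a (n + int j) * w powi n)"
    have "((\<lambda>j. taylor_coeff \<phi> j * (1 / w) ^ j) has_sum \<phi> (1 / w)) UNIV"
      by (rule taylor_coeff_abs_has_sum[OF \<phi>]) (use w in \<open>simp add: norm_divide divide_less_eq\<close>)
    from has_sum_times_complex[OF hs[OF w] this]
    have 1: "((\<lambda>(k, j). a k * w powi k * (taylor_coeff \<phi> j * (1 / w) ^ j)) has_sum f w * \<phi> (1 / w)) (UNIV \<times> UNIV)" .
    have 2: "(F has_sum f w * \<phi> (1 / w)) (UNIV \<times> UNIV)"
    proof (subst has_sum_reindex_bij_witness[where j = "\<lambda>(n, j). (n + int j, j)" and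
          i = "\<lambda>(k, j). (k - int j, j)" and T = "UNIV \<times> UNIV" and
          h = "\<lambda>(k, j). a k * w powi k * (taylor_coeff \<phi> j * (1 / w) ^ j)"])
      show "(case case p of (n, j) \<Rightarrow> (n + int j, j) of
              (k, j) \<Rightarrow> a k * w powi k * (taylor_coeff \<phi> j * (1 / w) ^ j)) = F p" for p
        using w0 by (cases p) (simp add: F_def power_int_add power_divide)
    qed (use 1 in auto)
    have inner: "((\<lambda>j. F (n, j)) has_sum (\<Sum>j. taylor_coeff \<phi> j * a (n + int j)) * w powi n) UNIV" for n
    proof -
      have "(\<lambda>j. F (n, j)) summable_on UNIV"
        using summable_on_SigmaD1[of "\<lambda>n j. F (n, j)" UNIV "\<lambda>_. UNIV" n] has_sum_imp_summable[OF 2] by simp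
      then obtain X where X: "((\<lambda>j. F (n, j)) has_sum X) UNIV" by (auto simp: summable_on_def)
      have "((\<lambda>j. F (n, j) * inverse (w powi n)) has_sum X * inverse (w powi n)) UNIV"
        by (rule has_sum_cmult_left[OF X])
      then have "((\<lambda>j. taylor_coeff \<phi> j * a (n + int j)) has_sum X * inverse (w powi n)) UNIV"
        using w0 by (simp add: F_def mult.assoc)
      then have "(\<Sum>j. taylor_coeff \<phi> j * a (n + int j)) = X * inverse (w powi n)"
        using has_sum_imp_sums sums_unique by metis
      then show ?thesis using X w0 by (simp add: mult.assoc)
    qed
    show ?thesis
      using has_sum_SigmaD[OF 2] inner by (simp add: mult.commute)
  qed
  then show ?thesis unfolding laurent_coeffs_outside_disk_def using \<rho> by blast
qed

lemma laurent_coeffs_times_linear: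
  assumes "laurent_coeffs_outside_disk f a"
  shows "laurent_coeffs_outside_disk (\<lambda>w. (w - \<tau>) * f w) (\<lambda>n. a (n - 1) - \<tau> * a n)"
proof -
  obtain \<rho> where \<rho>: "\<rho> > 1"
    and hs: "\<And>w. 1 < norm w \<Longrightarrow> norm w < \<rho> \<Longrightarrow> ((\<lambda>k. a k * w powi k) has_sum f w) UNIV"
    using assms unfolding laurent_coeffs_outside_disk_def by blast
  have "((\<lambda>n. (a (n - 1) - \<tau> * a n) * w powi n) has_sum (w - \<tau>) * f w) UNIV"
    if w: "1 < norm w" "norm w < \<rho>" for w
  proof -
    have w0: "w \<noteq> 0" using w by auto
    have "((\<lambda>n. w * (a n * w powi n)) has_sum w * f w) UNIV"
      by (rule has_sum_cmult_right[OF hs[OF w]])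
    then have 1: "((\<lambda>n. a (n - 1) * w powi n) has_sum w * f w) UNIV"
    proof (subst has_sum_reindex_bij_witness[where j = "\<lambda>n. n - 1" and i = "\<lambda>n. n + 1" and T = UNIV
          and h = "\<lambda>n. w * (a n * w powi n)"])
      show "w * (a (n - 1) * w powi (n - 1)) = a (n - 1) * w powi n" for n
        using w0 by (simp add: power_int_diff)
    qed auto
    have 2: "((\<lambda>n. (- \<tau>) * (a n * w powi n)) has_sum (- \<tau>) * f w) UNIV"
      by (rule has_sum_cmult_right[OF hs[OF w]])
    show ?thesis using has_sum_add[OF 1 2] by (simp add: algebra_simps)
  qed
  then show ?thesis unfolding laurent_coeffs_outside_disk_def using \<rho> by blast
qed

section \<open>Geometry of the exterior map\<close>

locale exterior_domain =
  fixes E :: "complex set" and \<Phi> :: "complex \<Rightarrow> complex"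
  assumes compact_E: "compact E" and ext: "exterior_map E \<Phi>"
begin

abbreviation \<Psi> :: "complex \<Rightarrow> complex" where
  "\<Psi> \<equiv> exterior_inverse E \<Phi>"

lemma open_compl: "open (- E)"
  using compact_E by (simp add: compact_imp_closed open_Compl)

lemma Phi_holo: "\<Phi> holomorphic_on - E"
  and Phi_bij: "bij_betw \<Phi> (- E) {w. 1 < norm w}"
  using ext by (auto simp: exterior_map_def)

lemma Phi_gt_1: "z \<notin> E \<Longrightarrow> norm (\<Phi> z) > 1"
  using Phi_bij by (auto simp: bij_betw_def)

lemma Psi_Phi [simp]: "z \<notin> E \<Longrightarrow> \<Psi> (\<Phi> z) = z"
  using Phi_bij by (auto simp: exterior_inverse_def bij_betw_def)

lemma Phi_Psi [simp]: "norm w > 1 \<Longrightarrow> \<Phi> (\<Psi> w) = w"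
  using Phi_bij by (auto simp: exterior_inverse_def bij_betw_def f_inv_into_f)

lemma Psi_notin: "norm w > 1 \<Longrightarrow> \<Psi> w \<notin> E"
  using Phi_bij inv_into_into[of w \<Phi> "- E"] by (auto simp: exterior_inverse_def bij_betw_def)

text \<open>The nonvanishing derivative, from \<open>deriv \<Phi> * deriv g = 1\<close> for the
  inverse \<open>g\<close>, will make the zero of \<open>\<Psi> - l\<close> simple when a linear
  factor is split off.\<close>

lemma
  shows Psi_holo: "\<Psi> holomorphic_on {w. 1 < norm w}"
    and deriv_Psi_nonzero: "norm w > 1 \<Longrightarrow> deriv \<Psi> w \<noteq> 0"
proof -
  have im: "\<Phi> ` (- E) = {w. 1 < norm w}" and inj: "inj_on \<Phi> (- E)"
    using Phi_bij by (auto simp: bij_betw_def)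
  obtain g where g: "g holomorphic_on (\<Phi> ` (- E))"
      "\<And>z. z \<in> - E \<Longrightarrow> deriv \<Phi> z * deriv g (\<Phi> z) = 1" "\<And>z. z \<in> - E \<Longrightarrow> g (\<Phi> z) = z"
    using holomorphic_has_inverse[OF Phi_holo open_compl inj] by blast
  have eq: "g w = \<Psi> w" if "norm w > 1" for w
    using g(3)[of "\<Psi> w"] Psi_notin[OF that] that by simp
  show "\<Psi> holomorphic_on {w. 1 < norm w}"
    by (rule holomorphic_transform[OF g(1)[unfolded im]]) (simp add: eq)
  have opn: "open {w::complex. 1 < norm w}" by (intro open_Collect_less continuous_intros)
  show "deriv \<Psi> w \<noteq> 0" if w: "norm w > 1"
  proof -
    have "\<forall>\<^sub>F x in nhds w. g x = \<Psi> x"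
      using eventually_nhds_in_open[OF opn, of w] w by (auto elim!: eventually_mono simp: eq)
    then have "deriv g w = deriv \<Psi> w" by (rule deriv_cong_ev) simp
    then show ?thesis using g(2)[of "\<Psi> w"] Psi_notin[OF w] w by auto
  qed
qed

lemma Phi_at_infinity: "filterlim \<Phi> at_infinity at_infinity"
proof -
  obtain c :: real where c: "c > 0" "((\<lambda>z. \<Phi> z / z) \<longlongrightarrow> complex_of_real c) at_infinity"
    using ext by (auto simp: exterior_map_def)
  have "filterlim (\<lambda>z. \<Phi> z / z * z) at_infinity at_infinity"
    by (rule tendsto_mult_filterlim_at_infinity[OF c(2)]) (use c(1) in \<open>auto simp: filterlim_ident\<close>)
  moreover have "\<forall>\<^sub>F z in at_infinity. \<Phi> z / z * z = \<Phi> (z::complex)"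
    unfolding eventually_at_infinity by (intro exI[of _ 1]) auto
  ultimately show ?thesis by (rule filterlim_mono_eventually[OF _ order_refl order_refl])
qed

lemma Phi_large:
  obtains B where "\<And>z. norm z \<ge> B \<Longrightarrow> norm (\<Phi> z) > r"
  using Phi_at_infinity filterlim_at_infinity_imp_norm_at_top[OF Phi_at_infinity]
  by (auto simp: filterlim_at_top_dense eventually_at_infinity)

text \<open>\<open>1 / \<Phi> (1 / u)\<close> is injective and holomorphic near 0, hence open, so \<open>\<Phi>\<close> takes a
  neighbourhood of infinity onto a neighbourhood of infinity.\<close>

lemma Psi_at_infinity: "filterlim \<Psi> at_infinity at_infinity"
  unfolding filterlim_at_infinity[OF order_refl]
proof (intro allI impI)
  fix B :: real assume "B > 0"
  obtain R where R: "R > 0" "\<And>z. z \<in> E \<Longrightarrow> norm z \<le> R"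
    using compact_E compact_imp_bounded bounded_pos by metis
  \<comment> \<open>For \<open>0 < |u| < e\<close> the point \<open>1 / u\<close> lies outside
    \<open>E\<close> and beyond the radius \<open>B\<close>.\<close>
  define e where "e = min (1 / R) (1 / B)"
  have e: "e > 0" using R \<open>B > 0\<close> by (simp add: e_def)
  define \<zeta> where "\<zeta> u = (if u = 0 then 0 else 1 / \<Phi> (1 / u))" for u
  have notE: "1 / u \<notin> E" "norm (1 / u) > B" if "norm u < e" "u \<noteq> 0" for u
  proof -
    have n: "norm u > 0" using that by simp
    have "norm u < 1 / R" "norm u < 1 / B" using that by (auto simp: e_def)
    then have "norm (1 / u) > R" "norm (1 / u) > B"
      using n R \<open>B > 0\<close> by (auto simp: norm_divide field_simps)
    then show "1 / u \<notin> E" "norm (1 / u) > B" using R(2) by force+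
  qed
  have lim0: "(\<zeta> \<longlongrightarrow> 0) (at 0)"
  proof -
    have "filterlim (\<lambda>u::complex. 1 / u) at_infinity (at 0)"
      using filterlim_inverse_at_infinity[where 'a = complex] by (simp add: divide_inverse)
    then have "filterlim (\<lambda>u. \<Phi> (1 / u)) at_infinity (at 0)"
      by (rule filterlim_compose[OF Phi_at_infinity])
    then have "((\<lambda>u. inverse (\<Phi> (1 / u))) \<longlongrightarrow> 0) (at 0)"
      by (rule filterlim_compose[OF tendsto_inverse_0])
    moreover have "\<forall>\<^sub>F u in at 0. inverse (\<Phi> (1 / u)) = \<zeta> u"
      by (auto simp: \<zeta>_def eventually_at_filter inverse_eq_divide)
    ultimately show ?thesis by (rule Lim_transform_eventually)
  qed
  have "\<zeta> holomorphic_on ball 0 e"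
  proof (rule no_isolated_singularity'[where K = "{0}"])
    have "(\<lambda>u. 1 / \<Phi> (1 / u)) holomorphic_on ball 0 e - {0}"
    proof (intro holomorphic_intros)
      show "(\<lambda>u. \<Phi> (1 / u)) holomorphic_on ball 0 e - {0}"
        by (rule holomorphic_on_compose_gen[OF _ Phi_holo, unfolded o_def])
           (auto intro!: holomorphic_intros simp: notE)
      show "\<Phi> (1 / u) \<noteq> 0" if "u \<in> ball 0 e - {0}" for u
        using Phi_gt_1[of "1 / u"] notE(1)[of u] that by auto
    qed
    then show "\<zeta> holomorphic_on ball 0 e - {0}"
      by (rule holomorphic_transform) (auto simp: \<zeta>_def)
    show "(\<zeta> \<longlongrightarrow> \<zeta> z) (at z within ball 0 e)" if "z \<in> {0}" for z
      using that lim0 e by (simp add: at_within_open[of _ "ball 0 e"] \<zeta>_def)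
  qed auto
  moreover have "inj_on \<zeta> (ball 0 e)"
  proof (rule inj_onI)
    fix u v assume uv: "u \<in> ball 0 e" "v \<in> ball 0 e" "\<zeta> u = \<zeta> v"
    have nz: "\<zeta> x \<noteq> 0" if "x \<noteq> 0" "x \<in> ball 0 e" for x
      using Phi_gt_1[of "1 / x"] notE(1)[of x] that by (auto simp: \<zeta>_def)
    show "u = v"
    proof (cases "u = 0 \<or> v = 0")
      case True
      then show ?thesis using uv nz by (metis \<zeta>_def)
    next
      case False
      then have "\<Phi> (1 / u) = \<Phi> (1 / v)" using uv by (simp add: \<zeta>_def)
      then have "\<Psi> (\<Phi> (1 / u)) = \<Psi> (\<Phi> (1 / v))" by simp
      then show ?thesis using False uv notE(1)[of u] notE(1)[of v] by simp
    qed
  qed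
  ultimately have "open (\<zeta> ` ball 0 e)" by (intro open_mapping_thm3) auto
  moreover have "0 \<in> \<zeta> ` ball 0 e" using e by (auto simp: \<zeta>_def intro!: image_eqI[of _ _ 0])
  ultimately obtain d where d: "d > 0" "ball 0 d \<subseteq> \<zeta> ` ball 0 e"
    by (meson open_contains_ball)
  have "norm (\<Psi> w) \<ge> B" if w: "norm w \<ge> max 2 (2 / d)" for w
  proof -
    have n: "norm w \<ge> 2" "norm w \<ge> 2 / d" using w by auto
    then have "norm w > 1 / d" using d by (smt (verit) divide_strict_right_mono)
    moreover have "norm w > 0" using n by linarith
    ultimately have "norm (1 / w) < d" using d by (simp add: norm_divide field_simps)
    then obtain u where u: "norm u < e" "\<zeta> u = 1 / w" using d by auto
    have "w \<noteq> 0" using n by auto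
    then have "u \<noteq> 0" using u by (auto simp: \<zeta>_def)
    then have "\<Phi> (1 / u) = w" using u by (simp add: \<zeta>_def)
    then have "\<Psi> w = 1 / u" using notE(1)[OF u(1) \<open>u \<noteq> 0\<close>] by auto
    then show ?thesis using notE(2)[OF u(1) \<open>u \<noteq> 0\<close>] by simp
  qed
  then show "\<forall>\<^sub>F w in at_infinity. B \<le> norm (\<Psi> w)"
    unfolding eventually_at_infinity by blast
qed

text \<open>\<open>\<Psi>\<close> has a simple pole at infinity: inserting
  \<open>z = \<Psi> (1 / u)\<close> into the limit \<open>c\<close> of \<open>\<Phi> z / z\<close>
  shows that the singularity of \<open>u * \<Psi> (1 / u)\<close> at 0 is removable with value
  \<open>1 / c\<close>.\<close>

lemma Psi_over_w:
  obtains k where "k holomorphic_on ball 0 1" "k 0 \<noteq> 0"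
    "\<And>u. u \<noteq> 0 \<Longrightarrow> norm u < 1 \<Longrightarrow> k u = u * \<Psi> (1 / u)"
proof -
  obtain c :: real where c: "c > 0" "((\<lambda>z. \<Phi> z / z) \<longlongrightarrow> complex_of_real c) at_infinity"
    using ext by (auto simp: exterior_map_def)
  define k where "k u = (if u = 0 then inverse (of_real c) else u * \<Psi> (1 / u))" for u
  have lim0: "(k \<longlongrightarrow> inverse (of_real c)) (at 0)"
  proof -
    have inf: "filterlim (\<lambda>u::complex. 1 / u) at_infinity (at 0)"
      using filterlim_inverse_at_infinity[where 'a = complex] by (simp add: divide_inverse)
    have "((\<lambda>u. \<Phi> (\<Psi> (1 / u)) / \<Psi> (1 / u)) \<longlongrightarrow> complex_of_real c) (at 0)"
      by (rule filterlim_compose[OF c(2) filterlim_compose[OF Psi_at_infinity inf]])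
    then have "((\<lambda>u. inverse (\<Phi> (\<Psi> (1 / u)) / \<Psi> (1 / u))) \<longlongrightarrow> inverse (complex_of_real c)) (at 0)"
      by (intro tendsto_inverse) (use c in auto)
    moreover have "\<forall>\<^sub>F u in at 0. inverse (\<Phi> (\<Psi> (1 / u)) / \<Psi> (1 / u)) = k u"
    proof -
      have "\<forall>\<^sub>F u in at (0::complex). u \<in> ball 0 1 - {0}"
        by (intro eventually_at_in_open) auto
      then show ?thesis
      proof eventually_elim
        case (elim u)
        then have "norm (1 / u) > 1" by (simp add: norm_divide field_simps)
        then show ?case using elim by (simp add: k_def)
      qed
    qed
    ultimately show ?thesis by (rule Lim_transform_eventually)
  qed
  have "k holomorphic_on ball 0 1"
  proof (rule no_isolated_singularity'[where K = "{0}"])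
    have "(\<lambda>u. u * \<Psi> (1 / u)) holomorphic_on ball 0 1 - {0}"
    proof (intro holomorphic_intros)
      show "(\<lambda>u. \<Psi> (1 / u)) holomorphic_on ball 0 1 - {0}"
        by (rule holomorphic_on_compose_gen[OF _ Psi_holo, unfolded o_def])
           (auto intro!: holomorphic_intros simp: norm_divide field_simps)
    qed
    then show "k holomorphic_on ball 0 1 - {0}"
      by (rule holomorphic_transform) (auto simp: k_def)
    show "(k \<longlongrightarrow> k z) (at z within ball 0 1)" if "z \<in> {0}" for z
      using that lim0 by (simp add: at_within_open[of _ "ball 0 1"] k_def)
  qed auto
  then show thesis using that[of k] c by (simp add: k_def)
qed

text \<open>Let \<open>\<kappa> u = u * (\<Psi> (1 / u) - l)\<close>, filled in at 0. Its only
  possible zero is \<open>1 / \<Phi> l\<close>. For \<open>l \<in> E\<close> there is none and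
  \<open>\<phi> = \<kappa>\<close>, the linear factor being \<open>w\<close>; otherwise the zero is
  simple and \<open>\<phi> = \<kappa> / (1 - \<tau> u)\<close> with
  \<open>\<tau> = \<Phi> l\<close>.\<close>

lemma Psi_linear_factor:
  obtains \<phi> where "\<phi> holomorphic_on ball 0 1" "\<And>u. norm u < 1 \<Longrightarrow> \<phi> u \<noteq> 0"
    "\<And>w. norm w > 1 \<Longrightarrow> \<Psi> w - l = (w - (if l \<in> E then 0 else \<Phi> l)) * \<phi> (1 / w)"
proof -
  obtain k where k: "k holomorphic_on ball 0 1" "k 0 \<noteq> 0"
    "\<And>u. u \<noteq> 0 \<Longrightarrow> norm u < 1 \<Longrightarrow> k u = u * \<Psi> (1 / u)"
    using Psi_over_w by blast
  define \<kappa> where "\<kappa> u = k u - l * u" for u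
  have \<kappa>_holo: "\<kappa> holomorphic_on ball 0 1" unfolding \<kappa>_def by (intro holomorphic_intros k(1))
  have \<kappa>_eq: "\<kappa> u = u * (\<Psi> (1 / u) - l)" if "u \<noteq> 0" "norm u < 1" for u
    using k(3)[OF that] by (simp add: \<kappa>_def algebra_simps)
  have big: "norm (1 / u) > 1" if "u \<noteq> 0" "norm u < 1" for u :: complex
    using that by (simp add: norm_divide field_simps)
  have small: "norm (1 / w) < 1" "w \<noteq> 0" if "norm w > 1" for w :: complex
    using that by (auto simp: norm_divide divide_less_eq)
  have \<kappa>_zero: "l \<notin> E \<and> u * \<Phi> l = 1" if "norm u < 1" "\<kappa> u = 0" for u
  proof -
    have "u \<noteq> 0" using that k(2) by (auto simp: \<kappa>_def)
    then have "\<Psi> (1 / u) = l" using \<kappa>_eq that by simp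
    moreover have "norm (1 / u) > 1" using big \<open>u \<noteq> 0\<close> that by blast
    ultimately show ?thesis using Psi_notin[of "1 / u"] Phi_Psi[of "1 / u"] \<open>u \<noteq> 0\<close> by auto
  qed
  show thesis
  proof (cases "l \<in> E")
    case True
    show thesis
    proof (rule that[OF \<kappa>_holo])
      show "\<kappa> u \<noteq> 0" if "norm u < 1" for u using \<kappa>_zero[OF that] True by blast
      show "\<Psi> w - l = (w - (if l \<in> E then 0 else \<Phi> l)) * \<kappa> (1 / w)" if "norm w > 1" for w
        using \<kappa>_eq[of "1 / w"] small[OF that] True by simp
    qed
  next
    case False
    define \<tau> where "\<tau> = \<Phi> l"
    have \<tau>: "norm \<tau> > 1" using Phi_gt_1[OF False] by (simp add: \<tau>_def)
    define a where "a = 1 / \<tau>"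
    have a: "norm a < 1" "a \<noteq> 0" "\<tau> \<noteq> 0" using small[OF \<tau>] by (auto simp: a_def)
    have \<kappa>a: "\<kappa> a = 0" using \<kappa>_eq[OF a(2,1)] False by (simp add: a_def \<tau>_def)
    \<comment> \<open>The factor \<open>- a\<close> comes from
      \<open>1 - \<tau> u = (u - a) / (- a)\<close>. At \<open>u = a\<close> the quotient is
      completed by the derivative, which has to be shown nonzero.\<close>
    define \<phi> where "\<phi> u = (if u = a then deriv \<kappa> a else (\<kappa> u - \<kappa> a) / (u - a)) * (- a)" for u
    have "(\<lambda>u. if u = a then deriv \<kappa> a else (\<kappa> u - \<kappa> a) / (u - a)) holomorphic_on ball 0 1"
      by (rule pole_lemma[OF \<kappa>_holo]) (use a in simp)
    then have \<phi>_holo: "\<phi> holomorphic_on ball 0 1"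
      unfolding \<phi>_def by (rule holomorphic_on_mult) (rule holomorphic_on_const)
    have \<phi>_eq: "\<kappa> u = (1 - \<tau> * u) * \<phi> u" for u
    proof (cases "u = a")
      case True
      then show ?thesis using \<kappa>a a by (simp add: a_def)
    next
      case False
      have eq: "(1 - \<tau> * u) * (- a) = u - a" using a(3) by (simp add: a_def algebra_simps)
      have "\<phi> u = (- a) * (\<kappa> u / (u - a))" using False \<kappa>a by (simp add: \<phi>_def)
      then have "(1 - \<tau> * u) * \<phi> u = (u - a) * (\<kappa> u / (u - a))"
        by (simp only: mult.assoc[symmetric] eq)
      then show ?thesis using False by simp
    qed
    have der: "deriv \<kappa> a \<noteq> 0"
    proof -
      have "(\<Psi> has_field_derivative deriv \<Psi> (1 / a)) (at (1 / a))"
        by (rule holomorphic_derivI[OF Psi_holo]) (use big[OF a(2,1)] in \<open>auto intro!: open_Collect_less continuous_intros\<close>)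
      then have "((\<lambda>u. u * (\<Psi> (1 / u) - l)) has_field_derivative
          (\<Psi> (1 / a) - l) + a * (deriv \<Psi> (1 / a) * (- 1 / a\<^sup>2))) (at a)"
        using a(2) by (auto intro!: derivative_eq_intros DERIV_chain2[of \<Psi>] simp: power2_eq_square)
      \<comment> \<open>Since \<open>\<Psi> (1 / a) = l\<close>, only the summand with the
        derivative of \<open>\<Psi>\<close> survives.\<close>
      then have "((\<lambda>u. u * (\<Psi> (1 / u) - l)) has_field_derivative - deriv \<Psi> (1 / a) / a) (at a)"
        using a False by (simp add: a_def \<tau>_def power2_eq_square field_simps)
      moreover have "\<forall>\<^sub>F u in nhds a. \<kappa> u = u * (\<Psi> (1 / u) - l)"
        by (rule eventually_mono[OF eventually_nhds_in_open[of "ball 0 1 - {0}"]]) (use a \<kappa>_eq in auto)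
      ultimately have "(\<kappa> has_field_derivative - deriv \<Psi> (1 / a) / a) (at a)"
        by (metis DERIV_cong_ev)
      then have "deriv \<kappa> a = - deriv \<Psi> (1 / a) / a" by (rule DERIV_imp_deriv)
      then show ?thesis using deriv_Psi_nonzero[OF big[OF a(2,1)]] a by simp
    qed
    show thesis
    proof (rule that[OF \<phi>_holo])
      show "\<phi> u \<noteq> 0" if u: "norm u < 1" for u
      proof (cases "u = a")
        case False
        then show ?thesis
          using \<kappa>_zero[OF u] \<phi>_eq[of u] a(3) by (auto simp: a_def \<tau>_def field_simps)
      qed (use der a in \<open>simp add: \<phi>_def\<close>)
      show "\<Psi> w - l = (w - (if l \<in> E then 0 else \<Phi> l)) * \<phi> (1 / w)" if w: "norm w > 1" for w
      proof -
        have "\<Psi> w - l = w * \<kappa> (1 / w)" using \<kappa>_eq[of "1 / w"] small[OF w] by simp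
        also have "\<dots> = (w * (1 - \<tau> * (1 / w))) * \<phi> (1 / w)" by (simp only: \<phi>_eq mult.assoc)
        also have "w * (1 - \<tau> * (1 / w)) = w - \<tau>" using small[OF w] by (simp add: field_simps)
        finally show ?thesis using False by (simp add: \<tau>_def)
      qed
    qed
  qed
qed

section \<open>Sublevel regions of the exterior map\<close>

definition region :: "real \<Rightarrow> complex set" where
  "region r = - (\<Psi> ` {w. r \<le> norm w})"

text \<open>The region is encoded through an image under \<open>\<Psi>\<close> because
  \<open>\<Phi>\<close> carries no information on \<open>E\<close>; here it becomes the sublevel set
  of \<open>|\<Phi>|\<close>, filled in by \<open>E\<close>.\<close>

lemma region_iff:
  assumes "r > 1"
  shows "z \<in> region r \<longleftrightarrow> z \<in> E \<or> norm (\<Phi> z) < r"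
proof (cases "z \<in> E")
  case True
  then show ?thesis using Psi_notin assms by (force simp: region_def)
next
  case False
  then have "z \<in> \<Psi> ` {w. r \<le> norm w} \<longleftrightarrow> r \<le> norm (\<Phi> z)"
    using assms by (auto intro!: image_eqI[of _ _ "\<Phi> z"])
  then show ?thesis using False by (auto simp: region_def)
qed

lemma E_subset_region: "r > 1 \<Longrightarrow> E \<subseteq> region r"
  using region_iff by blast

lemma Psi_in_region_iff: "r > 1 \<Longrightarrow> norm w > 1 \<Longrightarrow> \<Psi> w \<in> region r \<longleftrightarrow> norm w < r"
  using region_iff Psi_notin by simp

lemma Psi_image_compact:
  assumes "compact K" "\<And>w. w \<in> K \<Longrightarrow> norm w > 1"
  shows "compact (\<Psi> ` K)"
  using assms by (intro compact_continuous_image holomorphic_on_imp_continuous_on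
      holomorphic_on_subset[OF Psi_holo]) auto

text \<open>The complement is the image of an unbounded closed set. It is closed because
  \<open>\<Psi>\<close> tends to infinity: near a given point only parameters in a compact annulus
  matter.\<close>

lemma open_region:
  assumes r: "r > 1"
  shows "open (region r)"
proof -
  define T where "T = \<Psi> ` {w. r \<le> norm w}"
  have "closure T \<subseteq> T"
  proof
    fix z assume z: "z \<in> closure T"
    have "\<forall>\<^sub>F w in at_infinity. norm z + 1 \<le> norm (\<Psi> w)"
    proof -
      have "norm z + 1 > 0" by (simp add: add_nonneg_pos)
      then show ?thesis using Psi_at_infinity unfolding filterlim_at_infinity[OF order_refl] by blast
    qed
    then obtain M where M: "\<And>w. norm w \<ge> M \<Longrightarrow> norm z + 1 \<le> norm (\<Psi> w)"
      unfolding eventually_at_infinity by blast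
    define T' where "T' = \<Psi> ` ({w. r \<le> norm w} \<inter> cball 0 M)"
    have "closed T'"
      unfolding T'_def using r
      by (intro compact_imp_closed Psi_image_compact closed_Int_compact closed_Collect_le continuous_intros) auto
    have "T \<inter> ball z 1 \<subseteq> T'"
    proof
      fix x assume x: "x \<in> T \<inter> ball z 1"
      then obtain w where w: "x = \<Psi> w" "r \<le> norm w" by (auto simp: T_def)
      have "norm x < norm z + 1"
        using x norm_triangle_ineq4[of z "z - x"] by (auto simp: dist_norm)
      then have "norm w \<le> M" using M[of w] w by force
      then show "x \<in> T'" using w by (auto simp: T'_def)
    qed
    then have "closure (ball z 1 \<inter> T) \<subseteq> T'"
      using \<open>closed T'\<close> by (intro closure_minimal) auto
    moreover have "z \<in> closure (ball z 1 \<inter> T)"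
      using open_Int_closure_subset[of "ball z 1" T] z by auto
    ultimately show "z \<in> T" by (auto simp: T_def T'_def)
  qed
  then have "closed T" using closure_subset_eq by blast
  then show ?thesis by (simp add: region_def T_def open_Compl)
qed

lemma bounded_region:
  assumes "r > 1"
  shows "bounded (region r)"
proof -
  obtain B where B: "\<And>z. norm z \<ge> B \<Longrightarrow> norm (\<Phi> z) > r" using Phi_large by blast
  have "region r \<subseteq> E \<union> cball 0 B"
  proof
    fix z assume "z \<in> region r"
    then have "z \<in> E \<or> norm z < B"
      using B[of z] region_iff[OF assms, of z] by linarith
    then show "z \<in> E \<union> cball 0 B" by auto
  qed
  then show ?thesis
    using compact_E compact_imp_bounded bounded_cball bounded_subset bounded_Un by metis
qed

lemma frontier_region:
  assumes r: "r > 1"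
  shows "frontier (region r) \<subseteq> \<Psi> ` {w. norm w = r}"
proof
  fix z assume z: "z \<in> frontier (region r)"
  then have "z \<notin> region r" using open_region[OF r] by (simp add: frontier_def interior_open)
  then obtain w where w: "z = \<Psi> w" "r \<le> norm w" by (auto simp: region_def)
  have "norm w = r"
  proof (rule ccontr)
    assume "norm w \<noteq> r"
    define V where "V = - E \<inter> \<Phi> -` {v. r < norm v}"
    have "open V"
      unfolding V_def
      by (rule continuous_open_preimage[OF holomorphic_on_imp_continuous_on[OF Phi_holo] open_compl])
         (intro open_Collect_less continuous_intros)
    moreover have "z \<in> V" using w \<open>norm w \<noteq> r\<close> r Psi_notin[of w] by (auto simp: V_def)
    moreover have "V \<inter> region r = {}" using region_iff[OF r] by (auto simp: V_def)
    ultimately have "z \<notin> closure (region r)"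
      using open_Int_closure_eq_empty by blast
    then show False using z by (simp add: frontier_def)
  qed
  then show "z \<in> \<Psi> ` {w. norm w = r}" using w by blast
qed

lemma region_max_modulus:
  assumes "q holomorphic_on UNIV" "r > 1" "z \<in> region r"
    and "\<And>w. norm w = r \<Longrightarrow> norm (q (\<Psi> w)) \<le> B"
  shows "norm (q z) \<le> B"
proof (rule maximum_modulus_frontier[of q "region r"])
  show "q holomorphic_on interior (region r)" "continuous_on (closure (region r)) q"
    using assms(1) holomorphic_on_subset holomorphic_on_imp_continuous_on by blast+
  show "norm (q x) \<le> B" if "x \<in> frontier (region r)" for x
    using frontier_region[OF assms(2)] that assms(4) by blast
qed (use assms bounded_region in auto)

text \<open>Off \<open>U\<close>, \<open>|\<Phi>|\<close> attains a minimum above 1 inside a large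
  ball and exceeds 2 outside it; levels below both bounds stay within \<open>U\<close>.\<close>

lemma holo_near_region:
  assumes "F \<in> holo_near E"
  obtains \<rho> where "\<rho> > 1" "F holomorphic_on region \<rho>"
proof -
  obtain U where U: "open U" "E \<subseteq> U" "F holomorphic_on U"
    using assms by (auto simp: holo_near_def)
  obtain B where B: "\<And>z. norm z \<ge> B \<Longrightarrow> norm (\<Phi> z) > 2" using Phi_large by blast
  define K where "K = - U \<inter> cball 0 B"
  have K: "compact K" "K \<subseteq> - E" using U by (auto simp: K_def intro!: closed_Int_compact closed_Compl)
  obtain m where m: "m > 1" "\<And>z. z \<in> K \<Longrightarrow> m \<le> norm (\<Phi> z)"
  proof (cases "K = {}")
    case False
    have "continuous_on K (\<lambda>z. norm (\<Phi> z))"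
      using K(2) Phi_holo holomorphic_on_imp_continuous_on continuous_on_subset continuous_on_norm by metis
    then obtain x where x: "x \<in> K" "\<And>y. y \<in> K \<Longrightarrow> norm (\<Phi> x) \<le> norm (\<Phi> y)"
      using continuous_attains_inf[OF K(1) False] by blast
    then show thesis using that[of "norm (\<Phi> x)"] Phi_gt_1[of x] K(2) by blast
  qed (use that[of 2] in auto)
  define \<rho> where "\<rho> = min 2 m"
  have \<rho>: "\<rho> > 1" using m by (simp add: \<rho>_def)
  have "region \<rho> \<subseteq> U"
  proof
    fix z assume z: "z \<in> region \<rho>"
    show "z \<in> U"
    proof (rule ccontr)
      assume zU: "z \<notin> U"
      then have lt: "norm (\<Phi> z) < \<rho>" using z region_iff[OF \<rho>] U(2) by blast
      then have "norm z < B" using B[of z] by (force simp: \<rho>_def)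
      then have "z \<in> K" using zU by (simp add: K_def)
      then show False using m(2)[of z] lt by (simp add: \<rho>_def)
    qed
  qed
  then show thesis using that[OF \<rho>] U(3) holomorphic_on_subset by blast
qed

text \<open>Homogenising \<open>q\<close> in the pair \<open>k u = u * \<Psi> (1 / u)\<close> and
  \<open>u\<close> removes the singularity; at \<open>u = 0\<close> only the leading term
  survives.\<close>

lemma poly_Psi_holo:
  obtains g where "g holomorphic_on ball 0 1"
    "\<And>u. u \<noteq> 0 \<Longrightarrow> norm u < 1 \<Longrightarrow> g u = u ^ degree q * poly q (\<Psi> (1 / u))"
    "q \<noteq> 0 \<Longrightarrow> g 0 \<noteq> 0"
proof -
  obtain k where k: "k holomorphic_on ball 0 1" "k 0 \<noteq> 0"
    "\<And>u. u \<noteq> 0 \<Longrightarrow> norm u < 1 \<Longrightarrow> k u = u * \<Psi> (1 / u)"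
    using Psi_over_w by blast
  define g where "g u = (\<Sum>i\<le>degree q. coeff q i * (k u ^ i * u ^ (degree q - i)))" for u
  show thesis
  proof
    show "g holomorphic_on ball 0 1" unfolding g_def by (intro holomorphic_intros k(1))
    show "g u = u ^ degree q * poly q (\<Psi> (1 / u))" if u: "u \<noteq> 0" "norm u < 1" for u
    proof -
      have "k u ^ i * u ^ (degree q - i) = u ^ degree q * \<Psi> (1 / u) ^ i" if "i \<le> degree q" for i
      proof -
        have "k u ^ i * u ^ (degree q - i) = (u ^ i * u ^ (degree q - i)) * \<Psi> (1 / u) ^ i"
          using k(3)[OF u] by (simp add: power_mult_distrib)
        then show ?thesis using that by (simp flip: power_add)
      qed
      then show ?thesis unfolding g_def poly_altdef sum_distrib_left
        by (intro sum.cong) auto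
    qed
    show "g 0 \<noteq> 0" if "q \<noteq> 0"
    proof -
      have "g 0 = (\<Sum>i\<in>{degree q}. coeff q i * (k 0 ^ i * 0 ^ (degree q - i)))"
        unfolding g_def by (rule sum.mono_neutral_right) auto
      then show ?thesis using that k(2) by simp
    qed
  qed
qed

end

section \<open>Fourier coefficients and polynomial remainders\<close>

lemma closed_msupport: "closed (msupport \<mu>)"
proof -
  have "- msupport \<mu> = \<Union>{U. open U \<and> \<not> emeasure \<mu> U > 0}"
    unfolding msupport_def by auto
  then show ?thesis unfolding closed_def by auto
qed

lemma
  assumes \<mu>: "\<mu> \<in> measures_on E" and "compact E"
    and g: "continuous_on E g" and h: "continuous_on E h"
  shows L2_inner_integrable: "set_integrable \<mu> (msupport \<mu>) (\<lambda>z. g z * cnj (h z))"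
    and L2_inner_bound: "\<lbrakk>\<And>z. z \<in> E \<Longrightarrow> norm (g z) \<le> B; \<And>z. z \<in> E \<Longrightarrow> norm (h z) \<le> D\<rbrakk>
          \<Longrightarrow> norm (L2_inner \<mu> g h) \<le> B * D * measure \<mu> (space \<mu>)"
proof -
  interpret finite_measure \<mu> using \<mu> by (simp add: measures_on_def)
  have sets: "sets \<mu> = sets borel" and sub: "msupport \<mu> \<subseteq> E" and ne: "msupport \<mu> \<noteq> {}"
    using \<mu> by (auto simp: measures_on_def)
  have cont: "continuous_on (msupport \<mu>) (\<lambda>z. g z * cnj (h z))"
    using g h sub by (intro continuous_intros) (auto intro: continuous_on_subset)
  have meas: "(\<lambda>z. indicator (msupport \<mu>) z *\<^sub>R (g z * cnj (h z))) \<in> borel_measurable \<mu>"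
    using borel_measurable_continuous_on_indicator[OF _ cont] closed_msupport[of \<mu>]
    by (simp add: measurable_cong_sets[OF sets refl])
  have int: "integrable \<mu> (\<lambda>z. indicator (msupport \<mu>) z *\<^sub>R (g z * cnj (h z)))"
      and bd: "norm (LINT z|\<mu>. indicator (msupport \<mu>) z *\<^sub>R (g z * cnj (h z))) \<le> C * measure \<mu> (space \<mu>)"
    if C: "\<And>z. z \<in> E \<Longrightarrow> norm (g z * cnj (h z)) \<le> C" for C
  proof -
    \<comment> \<open>The support is infinite, hence nonempty, so some norm lies below
      \<open>C\<close>.\<close>
    have C0: "C \<ge> 0" using C ne sub by (meson ex_in_conv norm_ge_zero order_trans subsetD)
    have le: "norm (indicator (msupport \<mu>) z *\<^sub>R (g z * cnj (h z))) \<le> C" for z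
      using C[of z] C0 sub by (auto simp: indicator_def)
    show i: "integrable \<mu> (\<lambda>z. indicator (msupport \<mu>) z *\<^sub>R (g z * cnj (h z)))"
      by (rule integrable_const_bound[of _ C]) (use le meas in auto)
    have "norm (LINT z|\<mu>. indicator (msupport \<mu>) z *\<^sub>R (g z * cnj (h z))) \<le> (LINT z|\<mu>. C)"
      by (rule Bochner_Integration.integral_norm_bound_integral[OF i]) (use le in auto)
    then show "norm (LINT z|\<mu>. indicator (msupport \<mu>) z *\<^sub>R (g z * cnj (h z))) \<le> C * measure \<mu> (space \<mu>)"
      by (simp add: mult.commute)
  qed
  have "continuous_on E (\<lambda>z. g z * cnj (h z))" using g h by (intro continuous_intros)
  then have "bounded ((\<lambda>z. g z * cnj (h z)) ` E)"
    using \<open>compact E\<close> compact_continuous_image compact_imp_bounded by blast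
  then obtain C where "\<And>z. z \<in> E \<Longrightarrow> norm (g z * cnj (h z)) \<le> C"
    by (auto simp: bounded_iff)
  then show "set_integrable \<mu> (msupport \<mu>) (\<lambda>z. g z * cnj (h z))"
    unfolding set_integrable_def using int by blast
  show "norm (L2_inner \<mu> g h) \<le> B * D * measure \<mu> (space \<mu>)"
    if "\<And>z. z \<in> E \<Longrightarrow> norm (g z) \<le> B" "\<And>z. z \<in> E \<Longrightarrow> norm (h z) \<le> D"
    unfolding L2_inner_def set_lebesgue_integral_def
  proof (rule bd)
    show "norm (g z * cnj (h z)) \<le> B * D" if z: "z \<in> E" for z
      unfolding norm_mult using \<open>\<And>z. z \<in> E \<Longrightarrow> norm (g z) \<le> B\<close>[OF z] \<open>\<And>z. z \<in> E \<Longrightarrow> norm (h z) \<le> D\<close>[OF z]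
      by (intro mult_mono) (auto intro: order_trans[OF norm_ge_zero])
  qed
qed

lemma L2_inner_cong:
  assumes "\<mu> \<in> measures_on E" "\<And>z. z \<in> E \<Longrightarrow> g z = g' z"
  shows "L2_inner \<mu> g h = L2_inner \<mu> g' h"
  unfolding L2_inner_def set_lebesgue_integral_def
  by (intro Bochner_Integration.integral_cong)
     (use assms in \<open>auto simp: measures_on_def indicator_def\<close>)

lemma
  assumes "\<mu> \<in> measures_on E" "compact E"
    and "continuous_on E g" "continuous_on E g'" "continuous_on E h"
  shows L2_inner_add: "L2_inner \<mu> (\<lambda>z. g z + g' z) h = L2_inner \<mu> g h + L2_inner \<mu> g' h"
    and L2_inner_diff: "L2_inner \<mu> (\<lambda>z. g z - g' z) h = L2_inner \<mu> g h - L2_inner \<mu> g' h"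
  unfolding L2_inner_def
  using set_integral_add(2)[OF L2_inner_integrable[OF assms(1,2,3,5)] L2_inner_integrable[OF assms(1,2,4,5)]]
        set_integral_diff(2)[OF L2_inner_integrable[OF assms(1,2,3,5)] L2_inner_integrable[OF assms(1,2,4,5)]]
  by (simp_all add: distrib_right left_diff_distrib)

lemma L2_inner_cmult: "L2_inner \<mu> (\<lambda>z. a * g z) h = a * L2_inner \<mu> g h"
  unfolding L2_inner_def by (simp add: mult.assoc)

lemma L2_inner_sum:
  assumes "\<mu> \<in> measures_on E" "compact E" "finite I"
    and "\<And>i. i \<in> I \<Longrightarrow> continuous_on E (g i)" "continuous_on E h"
  shows "L2_inner \<mu> (\<lambda>z. \<Sum>i\<in>I. g i z) h = (\<Sum>i\<in>I. L2_inner \<mu> (g i) h)"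
  using assms(3,4)
proof (induction I rule: finite_induct)
  case empty
  show ?case by (simp add: L2_inner_def set_lebesgue_integral_def)
next
  case (insert x I)
  then have "L2_inner \<mu> (\<lambda>z. g x z + (\<Sum>i\<in>I. g i z)) h = L2_inner \<mu> (g x) h + L2_inner \<mu> (\<lambda>z. \<Sum>i\<in>I. g i z) h"
    by (intro L2_inner_add[OF assms(1,2)] continuous_on_sum assms(5)) auto
  then show ?case using insert by simp
qed

text \<open>Cancelling the leading term with a multiple of \<open>p d\<close>, \<open>d < n\<close>,
  lowers the degree and does not change the inner product. The zero polynomial is listed apart
  because its degree 0 is not below \<open>n = 0\<close>.\<close>

lemma orthonormal_lower_degree:
  assumes \<mu>: "\<mu> \<in> measures_on E" "compact E" and p: "orthonormal_polys \<mu> p"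
  shows "q = 0 \<or> degree q < n \<Longrightarrow> L2_inner \<mu> (poly q) (poly (p n)) = 0"
proof (induction "degree q" arbitrary: q rule: less_induct)
  case less
  have deg: "degree (p m) = m" for m using p unfolding orthonormal_polys_def by blast
  have nz: "p m \<noteq> 0" for m
  proof -
    obtain \<kappa> :: real where "\<kappa> > 0" "lead_coeff (p m) = complex_of_real \<kappa>"
      using p unfolding orthonormal_polys_def by blast
    then show ?thesis by auto
  qed
  show ?case
  proof (cases "q = 0")
    case True
    then show ?thesis by (simp add: L2_inner_def set_lebesgue_integral_def)
  next
    case False
    then have dn: "degree q < n" using less.prems by simp
    define d where "d = degree q"
    define a where "a = lead_coeff q / lead_coeff (p d)"
    define q' where "q' = q - smult a (p d)"
    have lc: "coeff (p d) d \<noteq> 0" using nz[of d] deg[of d] leading_coeff_0_iff[of "p d"] by simp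
    have "degree (smult a (p d)) = d" using deg lc False by (simp add: a_def)
    then have le: "degree q' \<le> d" unfolding q'_def by (intro degree_diff_le) (simp_all add: d_def)
    have "coeff q' d = 0" using lc by (simp add: q'_def a_def d_def[symmetric] deg)
    then have q': "q' = 0 \<or> degree q' < d" using le by (metis le_neq_implies_less leading_coeff_0_iff)
    have 0: "L2_inner \<mu> (poly q') (poly (p n)) = 0"
    proof (cases "q' = 0")
      case True
      then show ?thesis by (simp add: L2_inner_def set_lebesgue_integral_def)
    next
      case False
      then show ?thesis using less.hyps[of q'] q' dn by (simp add: d_def)
    qed
    have "poly q = (\<lambda>z. poly q' z + a * poly (p d) z)" by (simp add: q'_def fun_eq_iff)
    then have "L2_inner \<mu> (poly q) (poly (p n)) = L2_inner \<mu> (poly q') (poly (p n)) + a * L2_inner \<mu> (poly (p d)) (poly (p n))"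
      by (simp add: L2_inner_add[OF \<mu>] L2_inner_cmult continuous_intros)
    also have "L2_inner \<mu> (poly (p d)) (poly (p n)) = 0"
      using p dn unfolding orthonormal_polys_def d_def by auto
    finally show ?thesis using 0 by simp
  qed
qed

text \<open>The subtracted expression is the double series of
  \<open>Y i * M i j * w^(i - j)\<close>. By hypothesis \<open>f\<close> its terms with
  \<open>i \<ge> j\<close> add up to the nonnegative powers in the expansion of \<open>V\<close>;
  these cancel and only negative powers remain. The rates \<open>r < |w| < R\<close> give absolute
  convergence.\<close>

lemma laurent_tail_difference:
  fixes Y :: "nat \<Rightarrow> complex" and M :: "nat \<Rightarrow> nat \<Rightarrow> complex" and f :: "int \<Rightarrow> complex"
  assumes Y: "\<And>i. norm (Y i) \<le> C / R ^ i" and M: "\<And>i j. norm (M i j) \<le> D * r ^ j"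
    and r: "0 < r" "r < norm w" "norm w < R"
    and V: "((\<lambda>k. f k * w powi k) has_sum V) UNIV"
    and f: "\<And>n. f (int n) = (\<Sum>j. M (n + j) j * Y (n + j))"
  shows "(\<lambda>l. (f (- 1 - int l) - (\<Sum>i. M i (Suc (i + l)) * Y i)) * (1 / w) ^ Suc l) sums
           (V - (\<Sum>i. Y i * w ^ i * (\<Sum>j. M i j * (1 / w) ^ j)))"
proof -
  have w0: "w \<noteq> 0" "norm w > 0" using r by auto
  have R: "R > 0" using r by simp
  have C: "C \<ge> 0" using Y[of 0] by (metis div_by_1 norm_ge_zero order_trans power_0)
  have D: "D \<ge> 0" using M[of 0 0] by (metis mult.right_neutral norm_ge_zero order_trans power_0)
  define s t where "s = norm w / R" and "t = r / norm w"
  have st: "0 \<le> s" "s < 1" "0 \<le> t" "t < 1" using r w0 R by (auto simp: s_def t_def)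
  define H where "H = (\<lambda>(i, j). M i j * Y i * (w ^ i * (1 / w) ^ j))"
  have geo: "((\<lambda>j. c * q ^ j) has_sum c * (1 / (1 - q))) UNIV" if "0 \<le> q" "q < 1" for c q :: real
    by (intro has_sum_cmult_right norm_summable_imp_has_sum geometric_sums)
       (use that in \<open>auto simp: power_abs[symmetric]\<close>)
  have H_le: "norm (H (i, j)) \<le> C * D * s ^ i * t ^ j" for i j
  proof -
    have "norm (H (i, j)) \<le> (D * r ^ j) * (C / R ^ i) * (norm w ^ i * (1 / norm w) ^ j)"
      unfolding H_def prod.case norm_mult norm_power norm_divide norm_one using C D R r
      by (intro mult_mono Y M mult_nonneg_nonneg) auto
    then show ?thesis by (simp add: s_def t_def field_simps)
  qed
  have "(\<lambda>p. norm (H p)) summable_on UNIV \<times> UNIV"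
  proof (rule summable_on_comparison_test)
    show "(\<lambda>(i, j). C * D * s ^ i * t ^ j) summable_on UNIV \<times> UNIV"
    proof (rule summable_on_SigmaI)
      show "((\<lambda>j. case (i, j) of (i, j) \<Rightarrow> C * D * s ^ i * t ^ j) has_sum
          C * D * s ^ i * (1 / (1 - t))) UNIV" for i
        using geo[OF st(3,4), of "C * D * s ^ i"] by simp
      show "(\<lambda>i. C * D * s ^ i * (1 / (1 - t))) summable_on UNIV"
        by (intro summable_on_cmult_left has_sum_imp_summable[OF geo[OF st(1,2)]])
    qed (use st C D in auto)
    show "norm (H p) \<le> (case p of (i, j) \<Rightarrow> C * D * s ^ i * t ^ j)" for p
      using H_le by (cases p) auto
  qed auto
  then have Hs: "H summable_on UNIV \<times> UNIV" by (rule abs_summable_summable)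
  \<comment> \<open>\<open>P\<close> carries the powers \<open>n = i - j \<ge> 0\<close>,
    \<open>Q\<close> the powers \<open>- (l + 1)\<close> with \<open>l = j - i - 1\<close>.\<close>
  define P where "P = {(i::nat, j::nat). j \<le> i}"
  define Q where "Q = {(i::nat, j::nat). i < j}"
  have PQ: "UNIV \<times> UNIV = P \<union> Q" "P \<inter> Q = {}" by (auto simp: P_def Q_def)
  obtain SP where SP: "(H has_sum SP) P"
    using summable_on_subset[OF Hs] by (metis PQ(1) Un_upper1 summable_on_def)
  obtain SQ where SQ: "(H has_sum SQ) Q"
    using summable_on_subset[OF Hs] by (metis PQ(1) Un_upper2 summable_on_def)
  have all: "(H has_sum (SP + SQ)) (UNIV \<times> UNIV)"
    unfolding PQ(1) by (rule has_sum_Un_disjoint[OF SP SQ PQ(2)])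
  have rows: "((\<lambda>i. Y i * w ^ i * (\<Sum>j. M i j * (1 / w) ^ j)) has_sum (SP + SQ)) UNIV"
  proof (rule has_sum_SigmaD[OF all])
    show "((\<lambda>j. H (i, j)) has_sum Y i * w ^ i * (\<Sum>j. M i j * (1 / w) ^ j)) UNIV" for i
    proof -
      have le: "norm (norm (M i j * (1 / w) ^ j)) \<le> D * t ^ j" for j
      proof -
        have "norm (M i j) * norm ((1 / w) ^ j) \<le> D * r ^ j * norm ((1 / w) ^ j)"
          by (intro mult_right_mono M) auto
        then show ?thesis by (simp add: norm_mult norm_power norm_divide t_def power_divide)
      qed
      have "summable (\<lambda>j. D * t ^ j)" using st by (intro summable_mult summable_geometric) auto
      then have sm: "summable (\<lambda>j. norm (M i j * (1 / w) ^ j))"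
        by (rule summable_comparison_test'[where N = 0]) (rule le)
      have "((\<lambda>j. M i j * (1 / w) ^ j) has_sum (\<Sum>j. M i j * (1 / w) ^ j)) UNIV"
        by (rule norm_summable_imp_has_sum[OF sm summable_sums[OF summable_norm_cancel[OF sm]]])
      then have "((\<lambda>j. Y i * w ^ i * (M i j * (1 / w) ^ j)) has_sum Y i * w ^ i * (\<Sum>j. M i j * (1 / w) ^ j)) UNIV"
        by (rule has_sum_cmult_right)
      then show ?thesis by (simp add: H_def mult_ac)
    qed
  qed
  have P': "((\<lambda>(n, j). H (n + j, j)) has_sum SP) (UNIV \<times> UNIV)"
    using SP by (subst has_sum_reindex_bij_witness[where j = "\<lambda>(n, j). (n + j, j)"
          and i = "\<lambda>(i, j). (i - j, j)" and T = P and h = H and s' = SP]) (auto simp: P_def)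
  have diag: "((\<lambda>n. f (int n) * w powi int n) has_sum SP) UNIV"
  proof (rule has_sum_SigmaD[OF P'])
    fix n :: nat
    have "(\<lambda>j. H (n + j, j)) summable_on UNIV"
      using summable_on_SigmaD1[of "\<lambda>n j. H (n + j, j)" UNIV "\<lambda>_. UNIV" n] has_sum_imp_summable[OF P'] by simp
    then obtain X where X: "((\<lambda>j. H (n + j, j)) has_sum X) UNIV" by (auto simp: summable_on_def)
    have Heq: "H (n + j, j) = M (n + j) j * Y (n + j) * w ^ n" for j
      using w0 by (simp add: H_def power_add power_divide)
    have "((\<lambda>j. H (n + j, j) * inverse (w ^ n)) has_sum X * inverse (w ^ n)) UNIV"
      by (rule has_sum_cmult_left[OF X])
    then have "((\<lambda>j. M (n + j) j * Y (n + j)) has_sum X * inverse (w ^ n)) UNIV"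
      using w0 by (simp add: Heq mult.assoc)
    then have "f (int n) = X * inverse (w ^ n)"
      unfolding f using has_sum_imp_sums sums_unique by metis
    then show "((\<lambda>j. case (n, j) of (n, j) \<Rightarrow> H (n + j, j)) has_sum f (int n) * w powi int n) UNIV"
      using X w0 by (simp add: mult.assoc)
  qed
  have Q': "((\<lambda>(l, i). H (i, Suc (i + l))) has_sum SQ) (UNIV \<times> UNIV)"
    using SQ by (subst has_sum_reindex_bij_witness[where j = "\<lambda>(l, i). (i, Suc (i + l))"
          and i = "\<lambda>(i, j). (j - Suc i, i)" and T = Q and h = H and s' = SQ]) (auto simp: Q_def)
  have low: "((\<lambda>l. (\<Sum>i. M i (Suc (i + l)) * Y i) * (1 / w) ^ Suc l) has_sum SQ) UNIV"
  proof (rule has_sum_SigmaD[OF Q'])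
    fix l :: nat
    have "(\<lambda>i. H (i, Suc (i + l))) summable_on UNIV"
      using summable_on_SigmaD1[of "\<lambda>l i. H (i, Suc (i + l))" UNIV "\<lambda>_. UNIV" l] has_sum_imp_summable[OF Q'] by simp
    then obtain X where X: "((\<lambda>i. H (i, Suc (i + l))) has_sum X) UNIV" by (auto simp: summable_on_def)
    have Heq: "H (i, Suc (i + l)) = M i (Suc (i + l)) * Y i * (1 / w) ^ Suc l" for i
      using w0 by (simp add: H_def power_add power_divide)
    have "((\<lambda>i. H (i, Suc (i + l)) * w ^ Suc l) has_sum X * w ^ Suc l) UNIV"
      by (rule has_sum_cmult_left[OF X])
    then have "((\<lambda>i. M i (Suc (i + l)) * Y i) has_sum X * w ^ Suc l) UNIV"
      using w0 by (simp add: Heq power_divide)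
    then have "(\<Sum>i. M i (Suc (i + l)) * Y i) = X * w ^ Suc l"
      using has_sum_imp_sums sums_unique by metis
    then show "((\<lambda>i. case (l, i) of (l, i) \<Rightarrow> H (i, Suc (i + l))) has_sum
        (\<Sum>i. M i (Suc (i + l)) * Y i) * (1 / w) ^ Suc l) UNIV"
      using X w0 by (simp add: power_divide)
  qed
  have nonneg: "((\<lambda>k. f k * w powi k) has_sum SP) {0..}"
    using diag by (subst has_sum_reindex_bij_witness[where j = nat and i = int and T = UNIV
        and h = "\<lambda>n. f (int n) * w powi int n" and s' = SP]) auto
  have "(\<lambda>k. f k * w powi k) summable_on {..<0}"
    by (rule summable_on_subset[OF has_sum_imp_summable[OF V]]) simp
  then obtain X where X: "((\<lambda>k. f k * w powi k) has_sum X) {..<0}" by (auto simp: summable_on_def)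
  have "((\<lambda>k. f k * w powi k) has_sum (SP + X)) ({0..} \<union> {..<0})"
    by (rule has_sum_Un_disjoint[OF nonneg X]) auto
  moreover have "{0..} \<union> {..<0} = (UNIV :: int set)" by auto
  ultimately have VX: "V = SP + X" using V has_sum_unique by metis
  have neg: "((\<lambda>l. f (- 1 - int l) * (1 / w) ^ Suc l) has_sum X) UNIV"
  proof (subst has_sum_reindex_bij_witness[where j = "\<lambda>l. - 1 - int l" and i = "\<lambda>k. nat (- 1 - k)"
        and T = "{..<0}" and h = "\<lambda>k. f k * w powi k" and s' = X])
    show "f (- 1 - int l) * w powi (- 1 - int l) = f (- 1 - int l) * (1 / w) ^ Suc l" for l
    proof -
      have "- 1 - int l = - int (Suc l)" by simp
      then have "w powi (- 1 - int l) = (1 / w) ^ Suc l"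
        by (simp only: power_int_minus power_int_of_nat power_divide power_one inverse_eq_divide)
      then show ?thesis by simp
    qed
  qed (use X in auto)
  have "((\<lambda>l. f (- 1 - int l) * (1 / w) ^ Suc l + - ((\<Sum>i. M i (Suc (i + l)) * Y i) * (1 / w) ^ Suc l))
      has_sum (X + - SQ)) UNIV"
    by (intro has_sum_add neg has_sum_uminusI low)
  then have "(\<lambda>l. f (- 1 - int l) * (1 / w) ^ Suc l + - ((\<Sum>i. M i (Suc (i + l)) * Y i) * (1 / w) ^ Suc l))
      sums (X + - SQ)"
    by (rule has_sum_imp_sums)
  moreover have "X + - SQ = V - (\<Sum>i. Y i * w ^ i * (\<Sum>j. M i j * (1 / w) ^ j))"
    by (simp add: VX sums_unique[OF has_sum_imp_sums[OF rows], symmetric])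
  ultimately show ?thesis
    by (simp only: diff_conv_add_uminus distrib_right mult_minus_left)
qed

context exterior_domain
begin

text \<open>A power series in \<open>1 / w\<close> converging on an annulus converges outside its
  inner circle, so \<open>\<Phi>^N * T (1 / \<Phi>)\<close> is defined on all of
  \<open>|\<Phi>| > r0\<close>. Gluing it to \<open>D\<close> over the overlap gives an entire
  function of growth \<open>|z|^N\<close>, to which Liouville's theorem applies.\<close>

lemma polynomial_of_exterior_expansion:
  assumes D: "D holomorphic_on region r" and r: "1 < r0" "r0 < r"
    and e: "\<And>w. r0 < norm w \<Longrightarrow> norm w < r \<Longrightarrow> (\<lambda>l. e l * (1 / w) ^ l) sums (D (\<Psi> w) / w ^ N)"
  obtains q where "degree q \<le> N" "\<And>z. z \<in> region r \<Longrightarrow> D z = poly q z"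
proof -
  have r1: "r > 1" using r by simp
  define T where "T u = (\<Sum>l. e l * u ^ l)" for u
  have T_sums: "(\<lambda>l. e l * u ^ l) sums T u" if u: "norm u < 1 / r0" for u
  proof -
    \<comment> \<open>The point \<open>1 / y\<close> has to lie in the annulus, that is
      \<open>1 / r < y < 1 / r0\<close>, and \<open>|u| < y\<close> is needed to pass from
      convergence at \<open>y\<close> to convergence at \<open>u\<close>.\<close>
    define x where "x = max (norm u) (1 / r)"
    define y where "y = (x + 1 / r0) / 2"
    have "1 / r < 1 / r0" using r by (simp add: frac_less2)
    then have "x < 1 / r0" using u by (simp add: x_def)
    then have y: "norm u < y" "1 / r < y" "y < 1 / r0" by (auto simp: y_def x_def)
    have y0: "y > 0" using y r by (smt (verit) divide_pos_pos)
    have "r0 < norm (1 / complex_of_real y)" "norm (1 / complex_of_real y) < r"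
      using y y0 r by (auto simp: norm_divide field_simps)
    from sums_summable[OF e[OF this]] have "summable (\<lambda>l. e l * complex_of_real y ^ l)" by simp
    then have "summable (\<lambda>l. e l * u ^ l)"
      by (rule powser_inside) (use y y0 in auto)
    then show ?thesis unfolding T_def by (rule summable_sums)
  qed
  have T_holo: "T holomorphic_on ball 0 (1 / r0)"
    by (rule power_series_holomorphic[of 0 _ e]) (use T_sums in \<open>auto\<close>)
  define V where "V = - E \<inter> \<Phi> -` {v. r0 < norm v}"
  have V: "open V"
    unfolding V_def
    by (rule continuous_open_preimage[OF holomorphic_on_imp_continuous_on[OF Phi_holo] open_compl])
       (intro open_Collect_less continuous_intros)
  have "z \<in> region r \<union> V" for z using region_iff[OF r1, of z] r by (auto simp: V_def)
  then have cover: "region r \<union> V = UNIV" by blast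
  define P where "P z = (if z \<in> region r then D z else \<Phi> z ^ N * T (1 / \<Phi> z))" for z
  have P_V: "P z = \<Phi> z ^ N * T (1 / \<Phi> z)" if z: "z \<in> V" for z
  proof (cases "z \<in> region r")
    case True
    have zE: "z \<notin> E" and lo: "r0 < norm (\<Phi> z)" using z by (auto simp: V_def)
    have hi: "norm (\<Phi> z) < r" using True region_iff[OF r1] zE by blast
    have "\<Phi> z \<noteq> 0" using lo r by auto
    have "norm (1 / \<Phi> z) < 1 / r0" using lo r by (simp add: norm_divide frac_less2)
    then have "T (1 / \<Phi> z) = D (\<Psi> (\<Phi> z)) / \<Phi> z ^ N"
      using sums_unique2[OF T_sums e[OF lo hi]] by simp
    then show ?thesis using True zE \<open>\<Phi> z \<noteq> 0\<close> by (simp add: P_def)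
  qed (simp add: P_def)
  have "(\<lambda>z. \<Phi> z ^ N * T (1 / \<Phi> z)) holomorphic_on V"
  proof (intro holomorphic_intros)
    have ph: "\<Phi> holomorphic_on V" using Phi_holo by (rule holomorphic_on_subset) (auto simp: V_def)
    show "\<Phi> holomorphic_on V" by (rule ph)
    have "(\<lambda>z. 1 / \<Phi> z) holomorphic_on V"
      using ph by (intro holomorphic_intros) (use r in \<open>auto simp: V_def\<close>)
    then show "(\<lambda>z. T (1 / \<Phi> z)) holomorphic_on V"
    proof (rule holomorphic_on_compose_gen[OF _ T_holo, unfolded o_def])
      show "(\<lambda>z. 1 / \<Phi> z) ` V \<subseteq> ball 0 (1 / r0)"
        using r by (auto simp: V_def norm_divide frac_less2)
    qed
  qed
  then have "P holomorphic_on V" by (rule holomorphic_transform) (simp add: P_V)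
  moreover have "P holomorphic_on region r"
    using D by (rule holomorphic_transform) (simp add: P_def)
  ultimately have P_holo: "P holomorphic_on UNIV"
    using holomorphic_on_Un[OF _ _ open_region[OF r1] V] cover by metis
  obtain c :: real where c: "c > 0" "((\<lambda>z. \<Phi> z / z) \<longlongrightarrow> complex_of_real c) at_infinity"
    using ext by (auto simp: exterior_map_def)
  have "\<forall>\<^sub>F z in at_infinity. norm (\<Phi> z / z) < c + 1"
    using tendsto_norm[OF c(2)] by (rule order_tendstoD) (use c in auto)
  then obtain A1 where A1: "\<And>z. norm z \<ge> A1 \<Longrightarrow> norm (\<Phi> z / z) < c + 1"
    unfolding eventually_at_infinity by blast
  obtain A2 where A2: "\<And>z. norm z \<ge> A2 \<Longrightarrow> norm (\<Phi> z) > r" using Phi_large by blast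
  have sub: "cball (0::complex) (1 / r) \<subseteq> ball 0 (1 / r0)"
  proof -
    have "1 / r < 1 / r0" using r by (simp add: frac_less2)
    then show ?thesis by (auto intro: le_less_trans)
  qed
  have "compact (T ` cball 0 (1 / r))"
    by (intro compact_continuous_image holomorphic_on_imp_continuous_on holomorphic_on_subset[OF T_holo sub]) auto
  then obtain B where B: "B > 0" "\<And>u. u \<in> cball 0 (1 / r) \<Longrightarrow> norm (T u) \<le> B"
    using bounded_pos[of "T ` cball 0 (1 / r)"] by (auto simp: compact_imp_bounded)
  obtain A3 where A3: "\<And>z. z \<in> region r \<Longrightarrow> norm z \<le> A3"
    using bounded_region[OF r1] by (auto simp: bounded_iff)
  \<comment> \<open>Beyond \<open>A\<close> the point is outside \<open>region r\<close>,
    \<open>|\<Phi>| > r\<close> keeps \<open>1 / \<Phi>\<close> where \<open>T\<close> is bounded by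
    \<open>B\<close>, and \<open>|\<Phi> z| \<le> (c + 1) |z|\<close>.\<close>
  define A where "A = max (max A1 A2) (max 1 (A3 + 1))"
  have growth: "norm (P z) \<le> ((c + 1) ^ N * B) * norm z ^ N" if z: "A \<le> norm z" for z
  proof -
    have zs: "norm z \<ge> A1" "norm z \<ge> A2" "norm z \<ge> 1" "norm z > A3" using z by (auto simp: A_def)
    then have "z \<notin> region r" using A3 by force
    then have "P z = \<Phi> z ^ N * T (1 / \<Phi> z)" by (simp add: P_def)
    moreover have "norm (T (1 / \<Phi> z)) \<le> B"
      using A2[OF zs(2)] r by (intro B(2)) (simp add: norm_divide frac_le)
    moreover have "norm (\<Phi> z) \<le> (c + 1) * norm z"
      using A1[OF zs(1)] zs(3) by (auto simp: norm_divide divide_less_eq split: if_splits)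
    then have "norm (\<Phi> z ^ N) \<le> ((c + 1) * norm z) ^ N"
      unfolding norm_power by (intro power_mono) auto
    ultimately have "norm (P z) \<le> ((c + 1) * norm z) ^ N * B"
      unfolding norm_mult using c by (auto intro!: mult_mono simp: norm_mult)
    then show ?thesis by (simp add: power_mult_distrib mult_ac)
  qed
  define q where "q = (\<Sum>k\<le>N. monom ((deriv ^^ k) P 0 / fact k) k)"
  show thesis
  proof
    show "degree q \<le> N" unfolding q_def
      by (intro degree_sum_le) (auto intro: order.trans[OF degree_monom_le])
    show "D z = poly q z" if "z \<in> region r" for z
    proof -
      have "P z = poly q z"
        unfolding q_def poly_sum poly_monom by (rule Liouville_polynomial[OF P_holo growth])
      then show ?thesis using that by (simp add: P_def)
    qed
  qed
qed

end

section \<open>Expansion of Fourier coefficients in Laurent coefficients\<close>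

locale strong_asymptotics = exterior_domain +
  fixes \<mu> :: "complex measure" and p :: "nat \<Rightarrow> complex poly" and c :: "nat \<Rightarrow> real"
    and S :: "complex \<Rightarrow> complex"
  assumes mu: "\<mu> \<in> measures_on E" and orth: "orthonormal_polys \<mu> p"
    and c_pos: "\<And>n. c n > 0"
    and S_holo: "S holomorphic_on - E" and S_nz: "\<And>z. z \<notin> E \<Longrightarrow> S z \<noteq> 0"
    and S_lim: "\<exists>L. L \<noteq> 0 \<and> (S \<longlongrightarrow> L) at_infinity"
    and asymp: "\<And>K. closed K \<Longrightarrow> K \<subseteq> - E \<Longrightarrow>
       uniform_limit K (\<lambda>n z. poly (p n) z / (complex_of_real (c n) * \<Phi> z ^ n)) S sequentially"
    and c_ratio: "(\<lambda>n. c n / c (Suc n)) \<longlonglongrightarrow> 1"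
begin

lemma degree_p: "degree (p n) = n"
  and p_nonzero: "p n \<noteq> 0"
proof -
  show "degree (p n) = n" using orth unfolding orthonormal_polys_def by blast
  obtain \<kappa> :: real where "\<kappa> > 0" "lead_coeff (p n) = complex_of_real \<kappa>"
    using orth unfolding orthonormal_polys_def by blast
  then show "p n \<noteq> 0" by auto
qed

lemma S_disc:
  obtains g where "g holomorphic_on ball 0 1" "\<And>u. norm u < 1 \<Longrightarrow> g u \<noteq> 0"
    "\<And>u. u \<noteq> 0 \<Longrightarrow> norm u < 1 \<Longrightarrow> g u = S (\<Psi> (1 / u))"
proof -
  obtain L where L: "L \<noteq> 0" "(S \<longlongrightarrow> L) at_infinity" using S_lim by blast
  have big: "norm (1 / u) > 1" if "u \<noteq> 0" "norm u < 1" for u :: complex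
    using that by (simp add: norm_divide field_simps)
  define g where "g u = (if u = 0 then L else S (\<Psi> (1 / u)))" for u
  have lim0: "(g \<longlongrightarrow> L) (at 0)"
  proof -
    have inf: "filterlim (\<lambda>u::complex. 1 / u) at_infinity (at 0)"
      using filterlim_inverse_at_infinity[where 'a = complex] by (simp add: divide_inverse)
    have "((\<lambda>u. S (\<Psi> (1 / u))) \<longlongrightarrow> L) (at 0)"
      by (rule filterlim_compose[OF L(2) filterlim_compose[OF Psi_at_infinity inf]])
    moreover have "\<forall>\<^sub>F u in at 0. S (\<Psi> (1 / u)) = g u"
      by (auto simp: g_def eventually_at_filter)
    ultimately show ?thesis by (rule Lim_transform_eventually)
  qed
  have "g holomorphic_on ball 0 1"
  proof (rule no_isolated_singularity'[where K = "{0}"])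
    have "(\<lambda>u. \<Psi> (1 / u)) holomorphic_on ball 0 1 - {0}"
      by (rule holomorphic_on_compose_gen[OF _ Psi_holo, unfolded o_def])
         (use big in \<open>auto intro!: holomorphic_intros\<close>)
    then have "(\<lambda>u. S (\<Psi> (1 / u))) holomorphic_on ball 0 1 - {0}"
      by (rule holomorphic_on_compose_gen[OF _ S_holo, unfolded o_def]) (use big Psi_notin in auto)
    then show "g holomorphic_on ball 0 1 - {0}"
      by (rule holomorphic_transform) (auto simp: g_def)
    show "(g \<longlongrightarrow> g z) (at z within ball 0 1)" if "z \<in> {0}" for z
      using that lim0 by (simp add: at_within_open[of _ "ball 0 1"] g_def)
  qed auto
  moreover have "g u \<noteq> 0" if "norm u < 1" for u
    using S_nz[OF Psi_notin[OF big[OF _ that]]] L(1) by (auto simp: g_def)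
  ultimately show thesis using that[of g] by (simp add: g_def)
qed

lemma p_disc:
  "\<exists>g. g holomorphic_on ball 0 1 \<and> g 0 \<noteq> 0 \<and>
    (\<forall>u. u \<noteq> 0 \<longrightarrow> norm u < 1 \<longrightarrow> g u = u ^ m * poly (p m) (\<Psi> (1 / u)) / of_real (c m))"
proof -
  obtain g where g: "g holomorphic_on ball 0 1"
    "\<And>u. u \<noteq> 0 \<Longrightarrow> norm u < 1 \<Longrightarrow> g u = u ^ degree (p m) * poly (p m) (\<Psi> (1 / u))"
    "p m \<noteq> 0 \<Longrightarrow> g 0 \<noteq> 0"
    using poly_Psi_holo by blast
  have "(\<lambda>u. g u / of_real (c m)) holomorphic_on ball 0 1"
    using c_pos[of m] by (intro holomorphic_intros g(1)) auto
  then show ?thesis using g p_nonzero degree_p c_pos[of m]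
    by (intro exI[of _ "\<lambda>u. g u / of_real (c m)"]) auto
qed

section \<open>Taylor kernels of the normalised orthonormal polynomials\<close>

definition S_disc_fun :: "complex \<Rightarrow> complex" where
  "S_disc_fun = (SOME g. g holomorphic_on ball 0 1 \<and> (\<forall>u. norm u < 1 \<longrightarrow> g u \<noteq> 0) \<and>
    (\<forall>u. u \<noteq> 0 \<longrightarrow> norm u < 1 \<longrightarrow> g u = S (\<Psi> (1 / u))))"

definition p_disc_fun :: "nat \<Rightarrow> complex \<Rightarrow> complex" where
  "p_disc_fun m = (SOME g. g holomorphic_on ball 0 1 \<and> g 0 \<noteq> 0 \<and>
    (\<forall>u. u \<noteq> 0 \<longrightarrow> norm u < 1 \<longrightarrow> g u = u ^ m * poly (p m) (\<Psi> (1 / u)) / of_real (c m)))"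

lemma S_disc_fun:
  shows S_disc_holo: "S_disc_fun holomorphic_on ball 0 1"
    and S_disc_nonzero: "norm u < 1 \<Longrightarrow> S_disc_fun u \<noteq> 0"
    and S_disc_eq: "u \<noteq> 0 \<Longrightarrow> norm u < 1 \<Longrightarrow> S_disc_fun u = S (\<Psi> (1 / u))"
proof -
  have "\<exists>g. g holomorphic_on ball 0 1 \<and> (\<forall>u. norm u < 1 \<longrightarrow> g u \<noteq> 0) \<and>
    (\<forall>u. u \<noteq> 0 \<longrightarrow> norm u < 1 \<longrightarrow> g u = S (\<Psi> (1 / u)))"
    by (rule S_disc) blast
  from someI_ex[OF this]
  show "S_disc_fun holomorphic_on ball 0 1" "norm u < 1 \<Longrightarrow> S_disc_fun u \<noteq> 0"
    "u \<noteq> 0 \<Longrightarrow> norm u < 1 \<Longrightarrow> S_disc_fun u = S (\<Psi> (1 / u))"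
    unfolding S_disc_fun_def by blast+
qed

lemma p_disc_fun:
  shows p_disc_holo: "p_disc_fun m holomorphic_on ball 0 1"
    and p_disc_0: "p_disc_fun m 0 \<noteq> 0"
    and p_disc_eq: "u \<noteq> 0 \<Longrightarrow> norm u < 1 \<Longrightarrow>
      p_disc_fun m u = u ^ m * poly (p m) (\<Psi> (1 / u)) / of_real (c m)"
  using someI_ex[OF p_disc[of m]] unfolding p_disc_fun_def by blast+

definition s_coeff :: "nat \<Rightarrow> complex" where
  "s_coeff = taylor_coeff S_disc_fun"

definition s_inv_coeff :: "nat \<Rightarrow> complex" where
  "s_inv_coeff = taylor_coeff (\<lambda>u. inverse (S_disc_fun u))"

definition p_coeff :: "nat \<Rightarrow> nat \<Rightarrow> complex" where
  "p_coeff m = taylor_coeff (p_disc_fun m)"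

text \<open>\<open>p_m(\<Psi>(w)) / c_m\<close> is the sum of
  \<open>p_coeff m j * w^(m - j)\<close>; the power \<open>w^n\<close> arises for
  \<open>m = n + j\<close>, hence the diagonal shift.\<close>

definition p_kernel :: "nat \<Rightarrow> nat \<Rightarrow> complex" where
  "p_kernel n j = p_coeff (n + j) j"

definition inv_kernel :: "nat \<Rightarrow> nat \<Rightarrow> complex" where
  "inv_kernel = right_inverse p_kernel"

text \<open>\<open>\<Psi>\<close> maps \<open>|w| = r\<close> to a compact set off \<open>E\<close>,
  where the asymptotics are uniform, and Cauchy's estimate bounds all coefficients with one
  threshold \<open>M\<close>. Its independence of \<open>j\<close> lets the limit survive the
  diagonal shift in \<open>p_kernel\<close>.\<close>

lemma p_coeff_limit: "kernel_limit p_coeff s_coeff"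
  unfolding kernel_limit_def
proof (intro allI impI)
  fix r e :: real assume r: "r > 1" and e: "e > 0"
  have cpt: "compact (\<Psi> ` sphere 0 r)" by (rule Psi_image_compact) (use r in auto)
  have "uniform_limit (\<Psi> ` sphere 0 r) (\<lambda>n z. poly (p n) z / (complex_of_real (c n) * \<Phi> z ^ n)) S sequentially"
    by (rule asymp[OF compact_imp_closed[OF cpt]]) (use r Psi_notin in auto)
  then have "\<forall>\<^sub>F n in sequentially. \<forall>z\<in>\<Psi> ` sphere 0 r.
      dist (poly (p n) z / (complex_of_real (c n) * \<Phi> z ^ n)) (S z) < e"
    using e unfolding uniform_limit_iff by blast
  then obtain M where M: "\<And>n z. n \<ge> M \<Longrightarrow> z \<in> \<Psi> ` sphere 0 r \<Longrightarrow>
      dist (poly (p n) z / (complex_of_real (c n) * \<Phi> z ^ n)) (S z) < e"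
    unfolding eventually_sequentially by blast
  have "norm (p_coeff n j - s_coeff j) \<le> e * r ^ j" if n: "n \<ge> M" for n j
    unfolding p_coeff_def s_coeff_def
  proof (rule taylor_coeff_diff_bound[OF p_disc_holo S_disc_holo r])
    fix u :: complex assume u: "norm u = 1 / r"
    have u1: "norm u < 1" "u \<noteq> 0" using u r by auto
    define w where "w = 1 / u"
    have w: "norm w = r" "norm w > 1" using u r by (auto simp: w_def norm_divide)
    have "p_disc_fun n u = poly (p n) (\<Psi> w) / (complex_of_real (c n) * w ^ n)"
      using p_disc_eq[OF u1(2,1), of n] u1 by (simp add: w_def power_divide)
    moreover have "S_disc_fun u = S (\<Psi> w)" using S_disc_eq[OF u1(2,1)] by (simp add: w_def)
    moreover have "dist (poly (p n) (\<Psi> w) / (complex_of_real (c n) * \<Phi> (\<Psi> w) ^ n)) (S (\<Psi> w)) < e"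
      by (rule M[OF n]) (use w in auto)
    ultimately show "norm (p_disc_fun n u - S_disc_fun u) \<le> e"
      using w by (simp add: dist_norm)
  qed
  then show "\<exists>M. \<forall>n\<ge>M. \<forall>j. norm (p_coeff n j - s_coeff j) \<le> e * r ^ j" by blast
qed

lemma p_kernel_limit: "kernel_limit p_kernel s_coeff"
  unfolding kernel_limit_def
proof (intro allI impI)
  fix r e :: real assume "r > 1" "e > 0"
  then obtain M where M: "\<And>n j. n \<ge> M \<Longrightarrow> norm (p_coeff n j - s_coeff j) \<le> e * r ^ j"
    using p_coeff_limit unfolding kernel_limit_def by blast
  have "norm (p_kernel n j - s_coeff j) \<le> e * r ^ j" if "n \<ge> M" for n j
    unfolding p_kernel_def by (rule M) (use that in simp)
  then show "\<exists>M. \<forall>n\<ge>M. \<forall>j. norm (p_kernel n j - s_coeff j) \<le> e * r ^ j" by blast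
qed

lemma s_coeff_subexp: "subexponential s_coeff"
  unfolding s_coeff_def by (rule taylor_coeff_subexponential[OF S_disc_holo])

lemma s_inv_coeff_subexp: "subexponential s_inv_coeff"
  unfolding s_inv_coeff_def
  by (rule taylor_coeff_subexponential[OF taylor_coeff_inverse(1)[OF S_disc_holo S_disc_nonzero]])

lemma p_kernel_0: "p_kernel n 0 \<noteq> 0"
  using p_disc_0 by (simp add: p_kernel_def p_coeff_def taylor_coeff_0)

lemma inv_kernel_limit: "kernel_limit inv_kernel s_inv_coeff"
  unfolding inv_kernel_def
  by (rule kernel_limit_right_inverse[OF p_kernel_limit s_inv_coeff_subexp p_kernel_0])
     (simp only: s_inv_coeff_def s_coeff_def taylor_coeff_inverse(2)[OF S_disc_holo S_disc_nonzero])

definition scaled_coeff :: "(complex \<Rightarrow> complex) \<Rightarrow> nat \<Rightarrow> complex" where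
  "scaled_coeff F n = of_real (c n) * L2_inner \<mu> F (poly (p n))"

text \<open>The candidate \<open>G = \<Sum> y\<^sub>m p\<^sub>m / c\<^sub>m\<close> is built from the Laurent coefficients of \<open>F \<circ> \<Psi>\<close> alone, so
  that \<open>F - G\<close> has only finitely many nonnegative powers at infinity; it then extends to an entire
  function of polynomial growth, and a polynomial of low degree does not affect the Fourier
  coefficients.\<close>

lemma scaled_coeff_expansion:
  assumes F: "F \<in> holo_near E" and f: "laurent_coeffs_outside_disk (\<lambda>w. F (\<Psi> w)) f"
  obtains N where
    "\<And>n. n \<ge> N \<Longrightarrow> scaled_coeff F n = upper_sum inv_kernel (\<lambda>n. f (int n)) n"
    "\<And>n. n \<ge> N \<Longrightarrow> f (int n) = upper_sum p_kernel (scaled_coeff F) n"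
proof -
  obtain \<rho>1 where \<rho>1: "\<rho>1 > 1"
    and dec: "\<And>R. 1 < R \<Longrightarrow> R < \<rho>1 \<Longrightarrow> \<exists>C. \<forall>n::nat. norm (f (int n)) \<le> C / R ^ n"
    and hs: "\<And>w. 1 < norm w \<Longrightarrow> norm w < \<rho>1 \<Longrightarrow> ((\<lambda>k. f k * w powi k) has_sum F (\<Psi> w)) UNIV"
    using laurent_coeffs_decay[OF f] by metis
  obtain \<rho>2 where \<rho>2: "\<rho>2 > 1" "F holomorphic_on region \<rho>2"
    using holo_near_region[OF F] by blast
  \<comment> \<open>Equally spaced radii \<open>1 < r0 < r < R < min \<rho>1 \<rho>2\<close>: the
    kernels grow at most like \<open>r0^j\<close>, \<open>G\<close> converges on
    \<open>region r\<close>, and \<open>f\<close> decays like \<open>R^(-n)\<close>.\<close>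
  define d where "d = (min \<rho>1 \<rho>2 - 1) / 4"
  define r0 r R where "r0 = 1 + d" and "r = 1 + 2 * d" and "R = 1 + 3 * d"
  have d: "d > 0" "1 + 4 * d \<le> \<rho>1" "1 + 4 * d \<le> \<rho>2" using \<rho>1 \<rho>2 by (auto simp: d_def min_def field_simps)
  have rr: "1 < r0" "r0 < r" "r < R" "R < \<rho>1" "R < \<rho>2" using d by (auto simp: r0_def r_def R_def)
  have r1: "r > 1" using rr by simp
  obtain Cf where Cf: "\<And>n. norm (f (int n)) \<le> Cf / R ^ n" using dec[of R] rr by auto
  obtain CA NA where CA: "CA \<ge> 0" "\<And>n j. n \<ge> NA \<Longrightarrow> norm (p_coeff n j) \<le> CA * r0 ^ j"
    using kernel_limit_bound[OF p_coeff_limit s_coeff_subexp rr(1)] by metis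
  obtain CB NB where CB: "CB \<ge> 0" "\<And>n j. n \<ge> NB \<Longrightarrow> norm (inv_kernel n j) \<le> CB * r0 ^ j"
    using kernel_limit_bound[OF inv_kernel_limit s_inv_coeff_subexp rr(1)] by metis
  \<comment> \<open>\<open>Suc\<close> makes \<open>N\<close> positive, so a remainder of degree at
    most \<open>N - 1\<close> is orthogonal to \<open>p n\<close> for every
    \<open>n \<ge> N\<close>.\<close>
  define N where "N = Suc (max NA NB)"
  have CA': "norm (p_kernel n j) \<le> CA * r0 ^ j" if "n \<ge> N" for n j
    unfolding p_kernel_def by (rule CA(2)) (use that in \<open>simp add: N_def\<close>)
  have CB': "norm (inv_kernel n j) \<le> CB * r0 ^ j" if "n \<ge> N" for n j
    by (rule CB(2)) (use that in \<open>simp add: N_def\<close>)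
  have f_tail: "norm (f (int (n + j))) \<le> (Cf / R ^ n) / R ^ j" for n j
    using Cf[of "n + j"] by (simp add: power_add)
  define y where "y = upper_sum inv_kernel (\<lambda>n. f (int n))"
  define Cy where "Cy = CB * Cf / (1 - r0 / R)"
  have y_le: "norm (y n) \<le> Cy / R ^ n" if "n \<ge> N" for n
  proof -
    have "norm (y n) \<le> CB * (Cf / R ^ n) / (1 - r0 / R)"
      unfolding y_def by (rule upper_sum_bound(2)[where K = inv_kernel and n = n and y = "\<lambda>n. f (int n)", OF CB'[OF that] f_tail[of n]]) (use rr CB in auto)
    then show ?thesis by (simp add: Cy_def mult.commute divide_divide_eq_left)
  qed
  have Cy0: "Cy \<ge> 0"
    using y_le[OF order_refl] rr by (smt (verit) norm_ge_zero divide_neg_pos zero_less_power)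
  have f_eq: "f (int n) = upper_sum p_kernel y n" if n: "n \<ge> N" for n
  proof -
    have "upper_sum p_kernel (upper_sum inv_kernel (\<lambda>n. f (int n))) n = f (int n)"
    proof (rule upper_sum_inverse[of n p_kernel CA r0 inv_kernel CB "\<lambda>n. f (int n)" "Cf / R ^ n" R])
      show "(\<Sum>j\<le>l. p_kernel n j * inv_kernel (n + j) (l - j)) = (if l = 0 then 1 else 0)" for l
        unfolding inv_kernel_def by (rule right_inverse_conv[where A = p_kernel, OF p_kernel_0])
    qed (use n CA' CB' f_tail rr CA CB in auto)
    then show ?thesis by (simp add: y_def)
  qed
  define Cp where "Cp = CA / (1 - r0 / r)"
  have p_sums: "(\<lambda>j. p_coeff m j * (1 / w) ^ j) sums (poly (p m) (\<Psi> w) / of_real (c m) / w ^ m)"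
    if w: "norm w > 1" for m w
  proof -
    have w': "w \<noteq> 0" "1 / w \<noteq> 0" "norm (1 / w) < 1" using w by (auto simp: norm_divide divide_less_eq)
    have "p_disc_fun m (1 / w) = poly (p m) (\<Psi> w) / of_real (c m) / w ^ m"
      using p_disc_eq[OF w'(2,3), of m] w'(1) by (simp add: power_divide)
    then show ?thesis
      using taylor_coeff_sums[OF p_disc_holo w'(3), of m] by (simp add: p_coeff_def)
  qed
  \<comment> \<open>On the curve \<open>|\<Phi>| = r\<close> the expansion in \<open>1 / w\<close>
    yields the bound \<open>Cp * r^m\<close>; the maximum principle carries it inward, in particular
    to \<open>E\<close>, where the asymptotics say nothing.\<close>
  have p_le: "norm (poly (p m) z / of_real (c m)) \<le> Cp * r ^ m" if m: "m \<ge> N" and z: "z \<in> region r" for m z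
  proof (rule region_max_modulus[OF _ r1 z])
    show "(\<lambda>z. poly (p m) z / of_real (c m)) holomorphic_on UNIV"
      using c_pos[of m] by (intro holomorphic_intros) auto
    fix w :: complex assume w: "norm w = r"
    have "norm (\<Sum>j. p_coeff m j * (1 / w) ^ j) \<le> Cp"
    proof -
      \<comment> \<open>The series in \<open>1 / w\<close> is read as row \<open>m\<close> of an
        upper sum: a kernel of growth \<open>r0\<close> applied to the sequence
        \<open>w^(-(k - m))\<close> of decay \<open>r\<close>.\<close>
      define yy where "yy k = (1 / w) ^ (k - m)" for k
      have b: "norm (yy (m + j)) \<le> 1 / r ^ j" for j
        by (simp add: yy_def norm_power norm_divide w power_divide)
      have a: "norm (p_coeff m j) \<le> CA * r0 ^ j" for j
        by (rule CA(2)) (use m in \<open>simp add: N_def\<close>)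
      from upper_sum_bound(2)[where K = p_coeff and n = m and y = yy, OF a b] rr CA(1)
      show ?thesis by (simp add: upper_sum_def yy_def Cp_def)
    qed
    then have "norm (poly (p m) (\<Psi> w) / of_real (c m) / w ^ m) \<le> Cp"
      using sums_unique[OF p_sums[of w m]] w r1 by simp
    then have "norm (poly (p m) (\<Psi> w) / of_real (c m)) / r ^ m \<le> Cp"
      by (simp only: norm_divide[of _ "w ^ m"] norm_power w)
    moreover have "r ^ m > 0" using r1 by simp
    ultimately show "norm (poly (p m) (\<Psi> w) / of_real (c m)) \<le> Cp * r ^ m"
      by (simp only: pos_divide_le_eq)
  qed
  have Cp0: "Cp \<ge> 0" using CA rr by (simp add: Cp_def)
  define G where "G z = (\<Sum>i. y (N + i) * (poly (p (N + i)) z / of_real (c (N + i))))" for z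
  have term_le: "norm (y (N + i) * (poly (p (N + i)) z / of_real (c (N + i)))) \<le> Cy * Cp * (r / R) ^ (N + i)"
    if "z \<in> region r" for i z
  proof -
    have "norm (y (N + i) * (poly (p (N + i)) z / of_real (c (N + i)))) \<le> (Cy / R ^ (N + i)) * (Cp * r ^ (N + i))"
      unfolding norm_mult[of "y (N + i)"] using that Cy0 rr by (intro mult_mono y_le p_le) auto
    then show ?thesis by (simp add: power_divide)
  qed
  have sm_geo: "summable (\<lambda>i. Cy * Cp * (r / R) ^ (N + i))"
    unfolding power_add using rr by (intro summable_mult summable_geometric) auto
  have G_lim: "uniform_limit (region r) (\<lambda>n z. \<Sum>i<n. y (N + i) * (poly (p (N + i)) z / of_real (c (N + i)))) G sequentially"
    unfolding G_def by (rule Weierstrass_m_test[OF term_le sm_geo])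
  have G_holo: "G holomorphic_on region r"
  proof (rule holomorphic_uniform_sequence[OF open_region[OF r1]])
    show "(\<lambda>z. \<Sum>i<n. y (N + i) * (poly (p (N + i)) z / of_real (c (N + i)))) holomorphic_on region r" for n
      using c_pos by (intro holomorphic_intros) (auto simp: less_imp_neq[symmetric])
    show "\<exists>d>0. cball x d \<subseteq> region r \<and> uniform_limit (cball x d)
        (\<lambda>n z. \<Sum>i<n. y (N + i) * (poly (p (N + i)) z / of_real (c (N + i)))) G sequentially"
      if "x \<in> region r" for x
    proof -
      have "\<exists>d>0. cball x d \<subseteq> region r"
        using open_region[OF r1] that by (simp add: open_contains_cball)
      then show ?thesis using uniform_limit_on_subset[OF G_lim] by (elim exE conjE) auto
    qed
  qed
  have "region r \<subseteq> region \<rho>2"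
  proof
    fix z assume "z \<in> region r"
    then show "z \<in> region \<rho>2" using region_iff[OF r1, of z] region_iff[OF \<rho>2(1), of z] rr by linarith
  qed
  then have F_holo: "F holomorphic_on region r" using \<rho>2(2) holomorphic_on_subset by blast
  \<comment> \<open>The coefficient of \<open>w^(N - 1 - l)\<close> in
    \<open>F \<circ> \<Psi> - G \<circ> \<Psi>\<close>: the polynomial with index
    \<open>N + i\<close> contributes to this power with offset \<open>j = i + l + 1\<close>.\<close>
  define e where "e l = f (int N - 1 - int l) - (\<Sum>i. p_coeff (N + i) (Suc (i + l)) * y (N + i))" for l
  have e_sums: "(\<lambda>l. e l * (1 / w) ^ l) sums ((F (\<Psi> w) - G (\<Psi> w)) / w ^ (N - 1))"
    if w: "r0 < norm w" "norm w < r" for w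
  proof -
    have w1: "norm w > 1" and w0: "w \<noteq> 0" using w rr by auto
    \<comment> \<open>Dividing by \<open>w^N\<close> turns row \<open>N\<close> into row 0, so the
      rows where the system holds become exactly the nonnegative indices.\<close>
    define f' where "f' k = f (int N + k)" for k
    have V: "((\<lambda>k. f' k * w powi k) has_sum F (\<Psi> w) / w ^ N) UNIV"
    proof -
      have "((\<lambda>k. f k * w powi k * inverse (w ^ N)) has_sum F (\<Psi> w) * inverse (w ^ N)) UNIV"
        by (rule has_sum_cmult_left[OF hs]) (use w rr in auto)
      then show ?thesis
      proof (subst has_sum_reindex_bij_witness[where j = "\<lambda>k. int N + k" and i = "\<lambda>k. k - int N"
          and T = UNIV and h = "\<lambda>k. f k * w powi k * inverse (w ^ N)"])
        show "f (int N + k) * w powi (int N + k) * inverse (w ^ N) = f' k * w powi k" for k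
          using w0 by (simp add: f'_def power_int_add)
      qed (auto simp: divide_inverse)
    qed
    have "(\<lambda>l. (f' (- 1 - int l) - (\<Sum>i. p_coeff (N + i) (Suc (i + l)) * y (N + i))) * (1 / w) ^ Suc l) sums
           (F (\<Psi> w) / w ^ N - (\<Sum>i. y (N + i) * w ^ i * (\<Sum>j. p_coeff (N + i) j * (1 / w) ^ j)))"
    proof (rule laurent_tail_difference[where R = R and r = r0 and C = "Cy / R ^ N" and D = CA])
      show "norm (y (N + i)) \<le> Cy / R ^ N / R ^ i" for i
        using y_le[of "N + i"] by (simp add: power_add)
      show "norm (p_coeff (N + i) j) \<le> CA * r0 ^ j" for i j
        by (rule CA(2)) (simp add: N_def)
      show "f' (int n) = (\<Sum>j. p_coeff (N + (n + j)) j * y (N + (n + j)))" for n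
        using f_eq[of "N + n"] by (simp add: f'_def upper_sum_def p_kernel_def add.assoc)
    qed (use V w rr in auto)
    moreover have "(\<Sum>i. y (N + i) * w ^ i * (\<Sum>j. p_coeff (N + i) j * (1 / w) ^ j)) = G (\<Psi> w) / w ^ N"
    proof -
      have eq: "y (N + i) * w ^ i * (\<Sum>j. p_coeff (N + i) j * (1 / w) ^ j) =
          y (N + i) * (poly (p (N + i)) (\<Psi> w) / of_real (c (N + i))) / w ^ N" for i
        using w0 by (simp add: sums_unique[OF p_sums[OF w1, of "N + i"], symmetric] power_add)
      have "\<Psi> w \<in> region r" using w w1 r1 Psi_in_region_iff by blast
      then have "summable (\<lambda>i. y (N + i) * (poly (p (N + i)) (\<Psi> w) / of_real (c (N + i))))"
        by (intro summable_comparison_test'[OF sm_geo, where N = 0] term_le)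
      then show ?thesis unfolding eq G_def by (rule suminf_divide)
    qed
    ultimately have "(\<lambda>l. e l * (1 / w) ^ Suc l) sums ((F (\<Psi> w) - G (\<Psi> w)) / w ^ N)"
      by (simp add: e_def f'_def diff_divide_distrib algebra_simps)
    \<comment> \<open>Multiplying by \<open>w\<close> trades \<open>(1 / w)^(l + 1)\<close> for
      \<open>(1 / w)^l\<close> and \<open>w^N\<close> for \<open>w^(N - 1)\<close>, since
      \<open>N > 0\<close>.\<close>
    from sums_mult[OF this, of w]
    have "(\<lambda>l. w * (e l * (1 / w) ^ Suc l)) sums (w * ((F (\<Psi> w) - G (\<Psi> w)) / w ^ N))" .
    moreover have "w * (e l * (1 / w) ^ Suc l) = e l * (1 / w) ^ l" for l using w0 by simp
    moreover have "w * ((F (\<Psi> w) - G (\<Psi> w)) / w ^ N) = (F (\<Psi> w) - G (\<Psi> w)) / w ^ (N - 1)"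
      using w0 by (simp add: N_def)
    ultimately show ?thesis by simp
  qed
  obtain q where q: "degree q \<le> N - 1" "\<And>z. z \<in> region r \<Longrightarrow> F z - G z = poly q z"
    using polynomial_of_exterior_expansion[OF holomorphic_on_diff[OF F_holo G_holo] rr(1,2) e_sums] by blast
  have E_sub: "E \<subseteq> region r" by (rule E_subset_region[OF r1])
  have G_cont: "continuous_on E G"
    using G_holo E_sub holomorphic_on_imp_continuous_on continuous_on_subset by blast
  have main: "scaled_coeff F n = y n" if n: "n \<ge> N" for n
  proof -
    define s where "s k = (\<lambda>z. \<Sum>i<k. y (N + i) * (poly (p (N + i)) z / of_real (c (N + i))))" for k
    have s_cont: "continuous_on E (s k)" for k
      unfolding s_def using c_pos by (intro continuous_intros) (auto simp: less_imp_neq[symmetric])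
    have pc: "continuous_on E (poly (p n))" by (intro continuous_intros)
    have s_val: "L2_inner \<mu> (s k) (poly (p n)) = y n / of_real (c n)" if k: "k > n - N" for k
    proof -
      have "L2_inner \<mu> (s k) (poly (p n)) =
          (\<Sum>i<k. L2_inner \<mu> (\<lambda>z. y (N + i) * (poly (p (N + i)) z / of_real (c (N + i)))) (poly (p n)))"
        unfolding s_def using c_pos
        by (intro L2_inner_sum[OF mu compact_E] continuous_intros) (auto simp: less_imp_neq[symmetric])
      also have "\<dots> = (\<Sum>i<k. if i = n - N then y n / of_real (c n) else 0)"
      proof (rule sum.cong[OF refl])
        fix i
        have "L2_inner \<mu> (\<lambda>z. y (N + i) * (poly (p (N + i)) z / of_real (c (N + i)))) (poly (p n)) =
            y (N + i) / of_real (c (N + i)) * L2_inner \<mu> (poly (p (N + i))) (poly (p n))"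
          by (subst L2_inner_cmult[symmetric]) simp
        also have "L2_inner \<mu> (poly (p (N + i))) (poly (p n)) = (if N + i = n then 1 else 0)"
          using orth unfolding orthonormal_polys_def by blast
        finally show "L2_inner \<mu> (\<lambda>z. y (N + i) * (poly (p (N + i)) z / of_real (c (N + i)))) (poly (p n)) =
            (if i = n - N then y n / of_real (c n) else 0)"
          using n by auto
      qed
      also have "\<dots> = y n / of_real (c n)" using k by simp
      finally show ?thesis .
    qed
    obtain Dp where Dp: "Dp > 0" "\<And>z. z \<in> E \<Longrightarrow> norm (poly (p n) z) \<le> Dp"
      using compact_continuous_image[OF pc compact_E] bounded_pos[of "poly (p n) ` E"]
      by (auto simp: compact_imp_bounded)
    have "L2_inner \<mu> G (poly (p n)) = y n / of_real (c n)"
    proof (rule ccontr)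
      define a where "a = norm (L2_inner \<mu> G (poly (p n)) - y n / of_real (c n))"
      assume "L2_inner \<mu> G (poly (p n)) \<noteq> y n / of_real (c n)"
      then have a: "a > 0" by (simp add: a_def)
      \<comment> \<open>Long partial sums have inner product exactly \<open>y n / c n\<close>, so a
        discrepancy \<open>a\<close> must come from the uniform error on \<open>E\<close>; error
        below \<open>b\<close> makes it at most \<open>a / 2\<close>. The summand 1 keeps the
        denominator positive.\<close>
      define b where "b = a / (2 * (Dp * measure \<mu> (space \<mu>) + 1))"
      have den: "Dp * measure \<mu> (space \<mu>) + 1 > 0" using Dp(1) by (intro add_nonneg_pos) auto
      have b: "b > 0" using a den by (simp add: b_def)
      have "\<forall>\<^sub>F k in sequentially. \<forall>z\<in>region r. dist (s k z) (G z) < b"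
        using G_lim b unfolding uniform_limit_iff s_def by blast
      then obtain K where K: "\<And>k z. k \<ge> K \<Longrightarrow> z \<in> region r \<Longrightarrow> dist (s k z) (G z) < b"
        unfolding eventually_sequentially by blast
      define k where "k = max K (Suc (n - N))"
      have "L2_inner \<mu> (\<lambda>z. G z - s k z) (poly (p n)) = L2_inner \<mu> G (poly (p n)) - y n / of_real (c n)"
        by (subst L2_inner_diff[OF mu compact_E G_cont s_cont pc], subst s_val) (auto simp: k_def)
      moreover have "norm (L2_inner \<mu> (\<lambda>z. G z - s k z) (poly (p n))) \<le> b * Dp * measure \<mu> (space \<mu>)"
      proof (rule L2_inner_bound[OF mu compact_E])
        show "continuous_on E (\<lambda>z. G z - s k z)" by (intro continuous_intros G_cont s_cont)
        show "norm (G z - s k z) \<le> b" if "z \<in> E" for z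
          using K[of k z] that E_sub by (auto simp: k_def dist_norm norm_minus_commute less_imp_le)
      qed (use pc Dp in auto)
      ultimately have "a \<le> b * (Dp * measure \<mu> (space \<mu>))" by (simp add: a_def mult.assoc)
      also have "\<dots> \<le> b * (Dp * measure \<mu> (space \<mu>) + 1)" using b by (intro mult_left_mono) auto
      also have "\<dots> = a / 2"
      proof -
        have "a / (2 * X) * X = a / 2" if "X > 0" for X :: real using that by simp
        then show ?thesis unfolding b_def using den by blast
      qed
      finally show False using a by simp
    qed
    moreover have "L2_inner \<mu> (poly q) (poly (p n)) = 0"
      by (rule orthonormal_lower_degree[OF mu compact_E orth]) (use q(1) n in \<open>auto simp: N_def\<close>)
    moreover have "L2_inner \<mu> F (poly (p n)) = L2_inner \<mu> (\<lambda>z. G z + poly q z) (poly (p n))"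
      by (rule L2_inner_cong[OF mu]) (use q(2) E_sub in \<open>force simp: algebra_simps\<close>)
    moreover have "L2_inner \<mu> (\<lambda>z. G z + poly q z) (poly (p n)) =
        L2_inner \<mu> G (poly (p n)) + L2_inner \<mu> (poly q) (poly (p n))"
      by (rule L2_inner_add[OF mu compact_E G_cont _ pc]) (intro continuous_intros)
    ultimately show ?thesis using c_pos[of n] by (simp add: scaled_coeff_def)
  qed
  show thesis
  proof
    show "scaled_coeff F n = upper_sum inv_kernel (\<lambda>n. f (int n)) n" if "n \<ge> N" for n
      using main[OF that] by (simp add: y_def)
    show "f (int n) = upper_sum p_kernel (scaled_coeff F) n" if "n \<ge> N" for n
      unfolding f_eq[OF that] upper_sum_def using that by (simp add: main)
  qed
qed

end

section \<open>Equivalence of the ratio limits\<close>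

lemma ratio_tendsto_transfer:
  assumes g: "ratio_tendsto g (\<lambda>n. g (Suc n)) \<tau>"
    and y: "(\<lambda>n. y n / g n) \<longlonglongrightarrow> \<beta>" "\<beta> \<noteq> 0"
  shows "ratio_tendsto y (\<lambda>n. y (Suc n)) \<tau>"
proof -
  have "\<forall>\<^sub>F n in sequentially. y n / g n \<noteq> 0"
    using y by (rule tendsto_imp_eventually_ne)
  then have nz: "\<forall>\<^sub>F n in sequentially. y n \<noteq> 0 \<and> g n \<noteq> 0"
    by (rule eventually_mono) auto
  then have nz': "\<forall>\<^sub>F n in sequentially. y (Suc n) \<noteq> 0 \<and> g (Suc n) \<noteq> 0"
    using eventually_sequentially_Suc[of "\<lambda>n. y n \<noteq> 0 \<and> g n \<noteq> 0"] by blast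
  have lim: "(\<lambda>n. g n / g (Suc n)) \<longlonglongrightarrow> \<tau>" using g by (simp add: ratio_tendsto_def)
  have "(\<lambda>n. (y n / g n) * inverse (y (Suc n) / g (Suc n)) * (g n / g (Suc n))) \<longlonglongrightarrow> \<beta> * inverse \<beta> * \<tau>"
    using y(2) by (intro tendsto_mult tendsto_inverse y(1) LIMSEQ_Suc[OF y(1)] lim)
  moreover have "\<forall>\<^sub>F n in sequentially.
      (y n / g n) * inverse (y (Suc n) / g (Suc n)) * (g n / g (Suc n)) = y n / y (Suc n)"
    using nz nz' by eventually_elim simp
  ultimately have "(\<lambda>n. y n / y (Suc n)) \<longlonglongrightarrow> \<beta> * inverse \<beta> * \<tau>"
    by (rule Lim_transform_eventually)
  moreover have "\<forall>\<^sub>F n in sequentially. y (Suc n) \<noteq> 0" using nz' by (rule eventually_mono) blast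
  ultimately show ?thesis using y(2) by (simp add: ratio_tendsto_def)
qed

lemma ratio_tendsto_mult_slow:
  assumes g: "ratio_tendsto g (\<lambda>n. g (Suc n)) \<tau>"
    and d: "\<And>n. d n \<noteq> 0" "(\<lambda>n. d n / d (Suc n)) \<longlonglongrightarrow> 1"
  shows "ratio_tendsto (\<lambda>n. d n * g n) (\<lambda>n. d (Suc n) * g (Suc n)) \<tau>"
proof -
  have "(\<lambda>n. (d n / d (Suc n)) * (g n / g (Suc n))) \<longlonglongrightarrow> 1 * \<tau>"
    by (intro tendsto_mult d(2)) (use g in \<open>simp add: ratio_tendsto_def\<close>)
  then show ?thesis using g d(1) by (simp add: ratio_tendsto_def)
qed

lemma upper_sum_const_inverse:
  assumes k: "subexponential k" and b: "subexponential b"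
    and inv: "\<And>l. (\<Sum>i\<le>l. b i * k (l - i)) = (if l = 0 then 1 else 0)"
    and f: "\<And>n. norm (f n) \<le> C / R ^ n" and R: "R > 1"
  shows "upper_sum (\<lambda>_. b) (upper_sum (\<lambda>_. k) f) n = f n"
proof -
  define r where "r = (1 + R) / 2"
  have r: "1 < r" "r < R" using R by (auto simp: r_def)
  obtain Ck where Ck: "Ck \<ge> 0" "\<And>j. norm (k j) \<le> Ck * r ^ j" using k r unfolding subexponential_def by blast
  obtain Cb where Cb: "Cb \<ge> 0" "\<And>j. norm (b j) \<le> Cb * r ^ j" using b r unfolding subexponential_def by blast
  show ?thesis
  proof (rule upper_sum_inverse[where C = Cb and D = Ck and r = r and R = R and W = "C / R ^ n"])
    show "norm (f (n + j)) \<le> C / R ^ n / R ^ j" for j using f[of "n + j"] by (simp add: power_add)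
  qed (use Ck Cb r inv in auto)
qed

lemma laurent_coeffs_cong:
  assumes "laurent_coeffs_outside_disk f a" "\<And>w. norm w > 1 \<Longrightarrow> f w = g w"
  shows "laurent_coeffs_outside_disk g a"
  using assms unfolding laurent_coeffs_outside_disk_def by metis

context exterior_domain
begin

text \<open>Here \<open>v\<close> belongs to \<open>\<phi>(1 / w) F(\<Psi>(w))\<close> and
  \<open>q\<close> to \<open>(\<Psi>(w) - l) F(\<Psi>(w))\<close>. The zero-free factor acts by the
  Toeplitz kernel \<open>k\<close> with inverse \<open>b\<close>, so \<open>v\<close> and
  \<open>f\<close> determine each other; the linear factor leaves a two-term recurrence.\<close>

lemma laurent_coeffs_times_Psi:
  assumes f: "laurent_coeffs_outside_disk (\<lambda>w. F (\<Psi> w)) f"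
  obtains k b v \<phi> q where "subexponential k" "subexponential b"
    "\<And>l. (\<Sum>i\<le>l. b i * k (l - i)) = (if l = 0 then 1 else 0)"
    "\<And>u. norm u < 1 \<Longrightarrow> (\<lambda>j. k j * u ^ j) sums \<phi> u" "\<And>u. norm u < 1 \<Longrightarrow> (\<lambda>j. b j * u ^ j) sums inverse (\<phi> u)"
    "\<And>u. norm u < 1 \<Longrightarrow> \<phi> u \<noteq> 0"
    "\<And>n. v n = upper_sum (\<lambda>_. k) (\<lambda>n. f (int n)) n"
    "\<exists>R>1. \<exists>C. \<forall>n. norm (v n) \<le> C / R ^ n"
    "laurent_coeffs_outside_disk (\<lambda>w. (\<Psi> w - l) * F (\<Psi> w)) q"
    "\<And>n. q (int (Suc n)) = v n - (if l \<in> E then 0 else \<Phi> l) * v (Suc n)"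
proof -
  define \<tau> where "\<tau> = (if l \<in> E then 0 else \<Phi> l)"
  obtain \<phi> where \<phi>: "\<phi> holomorphic_on ball 0 1" "\<And>u. norm u < 1 \<Longrightarrow> \<phi> u \<noteq> 0"
    "\<And>w. norm w > 1 \<Longrightarrow> \<Psi> w - l = (w - \<tau>) * \<phi> (1 / w)"
    unfolding \<tau>_def using Psi_linear_factor[of l] by metis
  define vi where "vi n = (\<Sum>j. taylor_coeff \<phi> j * f (n + int j))" for n
  have L1: "laurent_coeffs_outside_disk (\<lambda>w. \<phi> (1 / w) * F (\<Psi> w)) vi"
    unfolding vi_def by (rule laurent_coeffs_times_taylor[OF f \<phi>(1)])
  obtain \<rho> where \<rho>: "\<rho> > 1" "\<And>R. 1 < R \<Longrightarrow> R < \<rho> \<Longrightarrow> \<exists>C. \<forall>n::nat. norm (vi (int n)) \<le> C / R ^ n"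
    using laurent_coeffs_decay[OF L1] by metis
  note inv = taylor_coeff_inverse[OF \<phi>(1,2)]
  show thesis
  proof (rule that[of "taylor_coeff \<phi>" "taylor_coeff (\<lambda>u. inverse (\<phi> u))" \<phi> "\<lambda>n. vi (int n)" "\<lambda>n. vi (n - 1) - \<tau> * vi n"])
    show "\<exists>R>1. \<exists>C. \<forall>n. norm (vi (int n)) \<le> C / R ^ n"
      using \<rho>(2)[of "(1 + \<rho>) / 2"] \<rho>(1) by (intro exI[of _ "(1 + \<rho>) / 2"]) auto
    show "laurent_coeffs_outside_disk (\<lambda>w. (\<Psi> w - l) * F (\<Psi> w)) (\<lambda>n. vi (n - 1) - \<tau> * vi n)"
      by (rule laurent_coeffs_cong[OF laurent_coeffs_times_linear[OF L1]]) (simp add: \<phi>(3) mult.assoc)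
    show "vi (int n) = upper_sum (\<lambda>_. taylor_coeff \<phi>) (\<lambda>n. f (int n)) n" for n
      by (simp add: vi_def upper_sum_def)
    show "vi (int (Suc n) - 1) - \<tau> * vi (int (Suc n)) =
        vi (int n) - (if l \<in> E then 0 else \<Phi> l) * vi (int (Suc n))" for n
      by (simp add: \<tau>_def)
  qed (use \<phi> inv in \<open>auto intro: taylor_coeff_subexponential taylor_coeff_sums\<close>)
qed

end

context strong_asymptotics
begin

lemma scaled_coeff_ratio_iff:
  "ratio_tendsto (scaled_coeff F) (\<lambda>n. scaled_coeff F (Suc n)) \<tau> \<longleftrightarrow>
   ratio_tendsto (\<lambda>n. L2_inner \<mu> F (poly (p n))) (\<lambda>n. L2_inner \<mu> F (poly (p (Suc n)))) \<tau>"
proof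
  have nz: "complex_of_real (c n) \<noteq> 0" for n using c_pos[of n] by simp
  have lim: "(\<lambda>n. complex_of_real (c n) / complex_of_real (c (Suc n))) \<longlonglongrightarrow> 1"
    using tendsto_of_real[OF c_ratio, where 'a = complex] by simp
  show "ratio_tendsto (scaled_coeff F) (\<lambda>n. scaled_coeff F (Suc n)) \<tau>"
    if "ratio_tendsto (\<lambda>n. L2_inner \<mu> F (poly (p n))) (\<lambda>n. L2_inner \<mu> F (poly (p (Suc n)))) \<tau>"
    using ratio_tendsto_mult_slow[OF that, of "\<lambda>n. complex_of_real (c n)", OF nz lim]
    by (simp add: scaled_coeff_def[abs_def])
  have lim': "(\<lambda>n. inverse (complex_of_real (c n)) / inverse (complex_of_real (c (Suc n)))) \<longlonglongrightarrow> 1"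
    using tendsto_inverse[OF lim] by (simp add: field_simps)
  show "ratio_tendsto (\<lambda>n. L2_inner \<mu> F (poly (p n))) (\<lambda>n. L2_inner \<mu> F (poly (p (Suc n)))) \<tau>"
    if "ratio_tendsto (scaled_coeff F) (\<lambda>n. scaled_coeff F (Suc n)) \<tau>"
    using ratio_tendsto_mult_slow[OF that, of "\<lambda>n. inverse (complex_of_real (c n))"] nz lim'
    by (simp add: scaled_coeff_def[abs_def] mult.assoc[symmetric])
qed

lemma s_coeff_sums: "norm u < 1 \<Longrightarrow> (\<lambda>j. s_coeff j * u ^ j) sums S_disc_fun u"
  unfolding s_coeff_def by (rule taylor_coeff_sums[OF S_disc_holo])

lemma s_inv_coeff_sums: "norm u < 1 \<Longrightarrow> (\<lambda>j. s_inv_coeff j * u ^ j) sums inverse (S_disc_fun u)"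
  unfolding s_inv_coeff_def
  by (rule taylor_coeff_sums[OF taylor_coeff_inverse(1)[OF S_disc_holo S_disc_nonzero]])

text \<open>The annulus of convergence reaches beyond the unit circle; the resulting strict decay
  places \<tau> in the range of \<open>\<Phi>\<close>.\<close>

lemma laurent_ratio_gt_1:
  assumes f: "laurent_coeffs_outside_disk g f"
    and ratio: "ratio_tendsto (\<lambda>n. f (int n)) (\<lambda>n. f (int (Suc n))) \<tau>"
  shows "norm \<tau> > 1"
proof -
  obtain \<rho> where \<rho>: "\<rho> > 1" "\<And>R. 1 < R \<Longrightarrow> R < \<rho> \<Longrightarrow> \<exists>C. \<forall>n::nat. norm (f (int n)) \<le> C / R ^ n"
    using laurent_coeffs_decay[OF f] by metis
  define R where "R = (1 + \<rho>) / 2"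
  have R: "1 < R" "R < \<rho>" using \<rho>(1) by (auto simp: R_def)
  obtain C where C: "\<And>n. norm (f (int n)) \<le> C / R ^ n" using \<rho>(2)[OF R] by blast
  have "R \<le> norm \<tau>"
    by (rule ratio_limit_ge_decay[where g = "\<lambda>n. f (int n)" and N = 0]) (use ratio R C in auto)
  then show ?thesis using R by simp
qed

text \<open>With an external \<open>g\<close> the same statement serves \<open>F\<close> itself,
  with \<open>\<alpha> = 1\<close>, and \<open>(z - l) F\<close>, with
  \<open>\<alpha> = 0\<close>.\<close>

lemma fourier_over_laurent:
  assumes F: "F \<in> holo_near E" and f: "laurent_coeffs_outside_disk (\<lambda>w. F (\<Psi> w)) f"
    and ratio: "ratio_tendsto g (\<lambda>n. g (Suc n)) \<tau>" and \<tau>: "norm \<tau> > 1"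
    and lim: "(\<lambda>n. f (int n) / g n) \<longlonglongrightarrow> \<alpha>"
  shows "(\<lambda>n. scaled_coeff F n / g n) \<longlonglongrightarrow> \<alpha> * inverse (S_disc_fun (1 / \<tau>))"
proof -
  obtain N where N: "\<And>n. n \<ge> N \<Longrightarrow> scaled_coeff F n = upper_sum inv_kernel (\<lambda>n. f (int n)) n"
    using scaled_coeff_expansion[OF F f] by metis
  have "norm (1 / \<tau>) < 1" using \<tau> by (simp add: norm_divide divide_less_eq)
  then have sm: "(\<Sum>j. s_inv_coeff j * (1 / \<tau>) ^ j) = inverse (S_disc_fun (1 / \<tau>))"
    using sums_unique[OF s_inv_coeff_sums] by simp
  have "(\<lambda>n. upper_sum inv_kernel (\<lambda>n. f (int n)) n / g n) \<longlonglongrightarrow> \<alpha> * inverse (S_disc_fun (1 / \<tau>))"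
    using upper_sum_ratio[OF inv_kernel_limit s_inv_coeff_subexp ratio \<tau> lim] unfolding sm .
  then show ?thesis
    by (rule Lim_transform_eventually) (use N in \<open>auto simp: eventually_sequentially intro!: exI[of _ N]\<close>)
qed

lemma S_disc_nonzero_at:
  assumes "norm \<tau> > 1"
  shows "S_disc_fun (1 / \<tau>) \<noteq> 0"
  using assms by (intro S_disc_nonzero) (simp add: norm_divide divide_less_eq)

lemma laurent_ratio_imp_fourier_ratio:
  assumes F: "F \<in> holo_near E" and f: "laurent_coeffs_outside_disk (\<lambda>w. F (\<Psi> w)) f"
    and ratio: "ratio_tendsto (\<lambda>n. f (int n)) (\<lambda>n. f (int (Suc n))) \<tau>"
  shows "(\<lambda>n. scaled_coeff F n / f (int n)) \<longlonglongrightarrow> inverse (S_disc_fun (1 / \<tau>))"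
    and "ratio_tendsto (scaled_coeff F) (\<lambda>n. scaled_coeff F (Suc n)) \<tau>"
proof -
  note \<tau> = laurent_ratio_gt_1[OF f ratio]
  have "\<forall>\<^sub>F n in sequentially. f (int n) / f (int n) = 1"
    using ratio_tendsto_nonzero[of "\<lambda>n. f (int n)", OF ratio] by (rule eventually_mono) auto
  then have "(\<lambda>n. f (int n) / f (int n)) \<longlonglongrightarrow> 1" by (rule tendsto_eventually)
  from fourier_over_laurent[OF F f, of "\<lambda>n. f (int n)", OF ratio \<tau> this]
  show lim: "(\<lambda>n. scaled_coeff F n / f (int n)) \<longlonglongrightarrow> inverse (S_disc_fun (1 / \<tau>))" by simp
  show "ratio_tendsto (scaled_coeff F) (\<lambda>n. scaled_coeff F (Suc n)) \<tau>"
    by (rule ratio_tendsto_transfer[of "\<lambda>n. f (int n)", OF ratio lim])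
       (use S_disc_nonzero_at[OF \<tau>] in simp)
qed

lemma fourier_ratio_imp_laurent_ratio:
  assumes F: "F \<in> holo_near E" and f: "laurent_coeffs_outside_disk (\<lambda>w. F (\<Psi> w)) f"
    and ratio: "ratio_tendsto (scaled_coeff F) (\<lambda>n. scaled_coeff F (Suc n)) \<tau>"
  shows "ratio_tendsto (\<lambda>n. f (int n)) (\<lambda>n. f (int (Suc n))) \<tau>"
proof -
  obtain N where N: "\<And>n. n \<ge> N \<Longrightarrow> scaled_coeff F n = upper_sum inv_kernel (\<lambda>n. f (int n)) n"
    "\<And>n. n \<ge> N \<Longrightarrow> f (int n) = upper_sum p_kernel (scaled_coeff F) n"
    using scaled_coeff_expansion[OF F f] by metis
  obtain \<rho> where \<rho>: "\<rho> > 1" "\<And>R. 1 < R \<Longrightarrow> R < \<rho> \<Longrightarrow> \<exists>C. \<forall>n::nat. norm (f (int n)) \<le> C / R ^ n"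
    using laurent_coeffs_decay[OF f] by metis
  define R where "R = (1 + \<rho>) / 2"
  define r where "r = (1 + R) / 2"
  have R: "1 < r" "r < R" "R < \<rho>" using \<rho>(1) by (auto simp: R_def r_def)
  obtain C where C: "\<And>n. norm (f (int n)) \<le> C / R ^ n" using \<rho>(2)[of R] R by auto
  obtain CB NB where CB: "CB \<ge> 0" "\<And>n j. n \<ge> NB \<Longrightarrow> norm (inv_kernel n j) \<le> CB * r ^ j"
    using kernel_limit_bound[OF inv_kernel_limit s_inv_coeff_subexp R(1)] by metis
  \<comment> \<open>The scaled Fourier coefficients inherit the decay of \<open>f\<close> through
    \<open>inv_kernel\<close>; \<open>|\<tau>| > 1\<close> is needed to evaluate the generating
    function at \<open>1 / \<tau>\<close>.\<close>
  have "R \<le> norm \<tau>"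
  proof (rule ratio_limit_ge_decay[OF ratio, where N = "max N NB" and C = "CB * C / (1 - r / R)"])
    fix n assume n: "n \<ge> max N NB"
    have "norm (upper_sum inv_kernel (\<lambda>n. f (int n)) n) \<le> CB * (C / R ^ n) / (1 - r / R)"
    proof (rule upper_sum_bound(2))
      show "norm (f (int (n + j))) \<le> C / R ^ n / R ^ j" for j
        using C[of "n + j"] by (simp add: power_add)
    qed (use n CB R in auto)
    then show "norm (scaled_coeff F n) \<le> CB * C / (1 - r / R) / R ^ n"
      using N(1)[of n] n by (simp add: mult.commute)
  qed (use R in simp)
  then have \<tau>: "norm \<tau> > 1" using R by simp
  have "\<forall>\<^sub>F n in sequentially. scaled_coeff F n / scaled_coeff F n = 1"
    using ratio_tendsto_nonzero[OF ratio] by (rule eventually_mono) auto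
  then have one: "(\<lambda>n. scaled_coeff F n / scaled_coeff F n) \<longlonglongrightarrow> 1" by (rule tendsto_eventually)
  have "norm (1 / \<tau>) < 1" using \<tau> by (simp add: norm_divide divide_less_eq)
  then have sm: "(\<Sum>j. s_coeff j * (1 / \<tau>) ^ j) = S_disc_fun (1 / \<tau>)"
    using sums_unique[OF s_coeff_sums] by simp
  have "(\<lambda>n. upper_sum p_kernel (scaled_coeff F) n / scaled_coeff F n) \<longlonglongrightarrow> 1 * S_disc_fun (1 / \<tau>)"
    using upper_sum_ratio[OF p_kernel_limit s_coeff_subexp ratio \<tau> one] unfolding sm .
  then have "(\<lambda>n. f (int n) / scaled_coeff F n) \<longlonglongrightarrow> 1 * S_disc_fun (1 / \<tau>)"
    by (rule Lim_transform_eventually) (use N(2) in \<open>auto simp: eventually_sequentially intro!: exI[of _ N]\<close>)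
  from ratio_tendsto_transfer[OF ratio this]
  show ?thesis using S_disc_nonzero_at[OF \<tau>] by simp
qed

section \<open>Multiplication by \<open>z - l\<close> and condition (b)\<close>

lemma holo_near_continuous: "F \<in> holo_near E \<Longrightarrow> continuous_on E F"
  unfolding holo_near_def using holomorphic_on_imp_continuous_on continuous_on_subset by blast

lemma holo_near_linear: "F \<in> holo_near E \<Longrightarrow> (\<lambda>z. (z - l) * F z) \<in> holo_near E"
  unfolding holo_near_def mem_Collect_eq
  by (elim exE conjE, intro exI conjI holomorphic_intros) assumption+

text \<open>Through this identity, (b) with limit \<open>l\<close> says that the coefficients of
  \<open>(z - l) F\<close> are negligible against those of \<open>F\<close>.\<close>

lemma scaled_coeff_linear:
  assumes "F \<in> holo_near E"
  shows "scaled_coeff (\<lambda>z. (z - l) * F z) n =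
    of_real (c n) * (L2_inner \<mu> (\<lambda>z. z * F z) (poly (p n)) - l * L2_inner \<mu> F (poly (p n)))"
proof -
  note F = holo_near_continuous[OF assms]
  have "L2_inner \<mu> (\<lambda>z. z * F z - l * F z) (poly (p n)) =
      L2_inner \<mu> (\<lambda>z. z * F z) (poly (p n)) - L2_inner \<mu> (\<lambda>z. l * F z) (poly (p n))"
    by (rule L2_inner_diff[OF mu compact_E]) (intro continuous_intros F)+
  then show ?thesis by (simp add: scaled_coeff_def L2_inner_cmult left_diff_distrib)
qed

text \<open>For \<open>l = \<Psi> \<tau>\<close> the Laurent coefficients of
  \<open>(\<Psi> - l) F(\<Psi>)\<close> are the differences \<open>v n - \<tau> * v (Suc n)\<close>,
  which the ratio limit makes negligible; the inverse kernel carries this over to the Fourier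
  side.\<close>

lemma laurent_ratio_imp_multiplication_ratio:
  assumes F: "F \<in> holo_near E" and f: "laurent_coeffs_outside_disk (\<lambda>w. F (\<Psi> w)) f"
    and ratio: "ratio_tendsto (\<lambda>n. f (int n)) (\<lambda>n. f (int (Suc n))) \<tau>"
  shows "ratio_tendsto (\<lambda>n. L2_inner \<mu> (\<lambda>z. z * F z) (poly (p n)))
           (\<lambda>n. L2_inner \<mu> F (poly (p n))) (\<Psi> \<tau>)"
proof -
  note \<tau> = laurent_ratio_gt_1[OF f ratio]
  define l where "l = \<Psi> \<tau>"
  have l: "l \<notin> E" "\<Phi> l = \<tau>" using Psi_notin[OF \<tau>] \<tau> by (auto simp: l_def)
  define g where "g n = f (int n)" for n
  have ratio_g: "ratio_tendsto g (\<lambda>n. g (Suc n)) \<tau>" unfolding g_def by (rule ratio)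
  obtain k b v \<phi> q where k: "subexponential k" "subexponential b"
    "\<And>l. (\<Sum>i\<le>l. b i * k (l - i)) = (if l = 0 then 1 else 0)"
    and k_sums: "\<And>u. norm u < 1 \<Longrightarrow> (\<lambda>j. k j * u ^ j) sums \<phi> u"
    and b_sums: "\<And>u. norm u < 1 \<Longrightarrow> (\<lambda>j. b j * u ^ j) sums inverse (\<phi> u)"
    and \<phi>_nz: "\<And>u. norm u < 1 \<Longrightarrow> \<phi> u \<noteq> 0"
    and v: "\<And>n. v n = upper_sum (\<lambda>_. k) g n"
    and v_dec: "\<exists>R>1. \<exists>C. \<forall>n. norm (v n) \<le> C / R ^ n"
    and q: "laurent_coeffs_outside_disk (\<lambda>w. (\<Psi> w - l) * F (\<Psi> w)) q"
    and q_eq: "\<And>n. q (int (Suc n)) = v n - (if l \<in> E then 0 else \<Phi> l) * v (Suc n)"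
    by (rule laurent_coeffs_times_Psi[OF f, of l, folded g_def]) (rule that, assumption+)
  have g_nz: "\<forall>\<^sub>F n in sequentially. g n \<noteq> 0" by (rule ratio_tendsto_nonzero[OF ratio_g])
  have "(\<lambda>n. g n / g n) \<longlonglongrightarrow> 1"
    by (rule tendsto_eventually, rule eventually_mono[OF g_nz]) simp
  from upper_sum_ratio[OF kernel_limit_const k(1) ratio_g \<tau> this]
  have "(\<lambda>n. upper_sum (\<lambda>_. k) g n / g n) \<longlonglongrightarrow> 1 * (\<Sum>j. k j * (1 / \<tau>) ^ j)" .
  \<comment> \<open>Whatever the value of \<beta>, the limits \<open>\<beta> * \<tau>\<close> and
    \<open>\<tau> * \<beta>\<close> cancel.\<close>
  then obtain \<beta> where v_lim: "(\<lambda>n. v n / g n) \<longlonglongrightarrow> \<beta>"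
    unfolding v g_def by blast
  have "(\<lambda>n. (v n / g n) * (g n / g (Suc n)) - \<tau> * (v (Suc n) / g (Suc n))) \<longlonglongrightarrow> \<beta> * \<tau> - \<tau> * \<beta>"
    by (intro tendsto_diff tendsto_mult v_lim LIMSEQ_Suc[OF v_lim] tendsto_const)
       (use ratio_g in \<open>simp add: ratio_tendsto_def\<close>)
  moreover have "\<forall>\<^sub>F n in sequentially.
      (v n / g n) * (g n / g (Suc n)) - \<tau> * (v (Suc n) / g (Suc n)) = q (int (Suc n)) / g (Suc n)"
    using g_nz by eventually_elim (simp only: q_eq l if_False, simp add: diff_divide_distrib)
  ultimately have "(\<lambda>n. q (int (Suc n)) / g (Suc n)) \<longlonglongrightarrow> \<beta> * \<tau> - \<tau> * \<beta>"
    by (rule Lim_transform_eventually)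
  then have "(\<lambda>n. q (int n) / g n) \<longlonglongrightarrow> \<beta> * \<tau> - \<tau> * \<beta>"
    using LIMSEQ_imp_Suc[of "\<lambda>n. q (int n) / g n"] by blast
  then have q_lim: "(\<lambda>n. q (int n) / g n) \<longlonglongrightarrow> 0" by (simp add: mult.commute)
  have Q_lim: "(\<lambda>n. scaled_coeff (\<lambda>z. (z - l) * F z) n / g n) \<longlonglongrightarrow> 0 * inverse (S_disc_fun (1 / \<tau>))"
    by (rule fourier_over_laurent[OF holo_near_linear[OF F] q ratio_g \<tau> q_lim])
  have y_lim: "(\<lambda>n. scaled_coeff F n / g n) \<longlonglongrightarrow> inverse (S_disc_fun (1 / \<tau>))"
    unfolding g_def by (rule laurent_ratio_imp_fourier_ratio(1)[OF F f ratio])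
  have nz: "inverse (S_disc_fun (1 / \<tau>)) \<noteq> 0" using S_disc_nonzero_at[OF \<tau>] by simp
  have y_nz: "\<forall>\<^sub>F n in sequentially. scaled_coeff F n / g n \<noteq> 0"
    by (rule tendsto_imp_eventually_ne[OF y_lim nz])
  have "(\<lambda>n. (scaled_coeff (\<lambda>z. (z - l) * F z) n / g n) / (scaled_coeff F n / g n) + l) \<longlonglongrightarrow>
      (0 * inverse (S_disc_fun (1 / \<tau>))) / inverse (S_disc_fun (1 / \<tau>)) + l"
    by (intro tendsto_add tendsto_divide Q_lim y_lim nz tendsto_const)
  moreover have "\<forall>\<^sub>F n in sequentially.
      (scaled_coeff (\<lambda>z. (z - l) * F z) n / g n) / (scaled_coeff F n / g n) + l =
      L2_inner \<mu> (\<lambda>z. z * F z) (poly (p n)) / L2_inner \<mu> F (poly (p n))"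
    using y_nz
  proof eventually_elim
    case (elim n)
    then have n0: "L2_inner \<mu> F (poly (p n)) \<noteq> 0" "g n \<noteq> 0" by (auto simp: scaled_coeff_def)
    then show ?case using c_pos[of n] unfolding scaled_coeff_linear[OF F]
      by (simp add: scaled_coeff_def diff_divide_distrib)
  qed
  ultimately have "(\<lambda>n. L2_inner \<mu> (\<lambda>z. z * F z) (poly (p n)) / L2_inner \<mu> F (poly (p n))) \<longlonglongrightarrow>
      (0 * inverse (S_disc_fun (1 / \<tau>))) / inverse (S_disc_fun (1 / \<tau>)) + l"
    by (rule Lim_transform_eventually)
  moreover have "\<forall>\<^sub>F n in sequentially. L2_inner \<mu> F (poly (p n)) \<noteq> 0"
    using y_nz by (rule eventually_mono) (auto simp: scaled_coeff_def)
  ultimately show ?thesis by (simp add: ratio_tendsto_def l_def)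
qed

text \<open>A bound on the tail of \<open>v\<close> passes to \<open>f\<close>, to the coefficients
  of \<open>F\<close>, with a gain \<open>\<epsilon>\<close> to those of \<open>(z - l) F\<close>,
  and back to \<open>q\<close>; this is the hypothesis \<open>rec\<close> of
  \<open>perturbed_recurrence\<close>. The case \<open>l \<in> E\<close> corresponds to
  \<open>\<tau> = 0\<close>, which that lemma excludes.\<close>

lemma multiplication_ratio_imp_laurent_ratio:
  assumes F: "F \<in> holo_near E" and f: "laurent_coeffs_outside_disk (\<lambda>w. F (\<Psi> w)) f"
    and ratio: "ratio_tendsto (\<lambda>n. L2_inner \<mu> (\<lambda>z. z * F z) (poly (p n)))
           (\<lambda>n. L2_inner \<mu> F (poly (p n))) l"
  shows "l \<notin> E" and "ratio_tendsto (\<lambda>n. f (int n)) (\<lambda>n. f (int (Suc n))) (\<Phi> l)"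
proof -
  define \<tau> where "\<tau> = (if l \<in> E then 0 else \<Phi> l)"
  define g where "g n = f (int n)" for n
  define Q where "Q = (\<lambda>z. (z - l) * F z)"
  obtain k b v \<phi> q where k: "subexponential k" "subexponential b"
    "\<And>l. (\<Sum>i\<le>l. b i * k (l - i)) = (if l = 0 then 1 else 0)"
    and k_sums: "\<And>u. norm u < 1 \<Longrightarrow> (\<lambda>j. k j * u ^ j) sums \<phi> u"
    and b_sums: "\<And>u. norm u < 1 \<Longrightarrow> (\<lambda>j. b j * u ^ j) sums inverse (\<phi> u)"
    and \<phi>_nz: "\<And>u. norm u < 1 \<Longrightarrow> \<phi> u \<noteq> 0"
    and v: "\<And>n. v n = upper_sum (\<lambda>_. k) g n"
    and v_dec: "\<exists>R>1. \<exists>C. \<forall>n. norm (v n) \<le> C / R ^ n"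
    and q: "laurent_coeffs_outside_disk (\<lambda>w. (\<Psi> w - l) * F (\<Psi> w)) q"
    and q_eq: "\<And>n. q (int (Suc n)) = v n - \<tau> * v (Suc n)"
    by (rule laurent_coeffs_times_Psi[OF f, of l, folded g_def \<tau>_def]) (rule that, assumption+)
  obtain Rv Cv where Rv: "Rv > 1" "\<And>n. norm (v n) \<le> Cv / Rv ^ n" using v_dec by blast
  have \<tau>1: "\<tau> = 0 \<or> norm \<tau> > 1" using Phi_gt_1 by (auto simp: \<tau>_def)
  \<comment> \<open>\<open>R\<close> must stay below the decay rate of \<open>v\<close> and, if
    \<tau> is nonzero, below \<open>|\<tau>|\<close>; for \<open>\<tau> = 0\<close> the number 2 is
    a placeholder. The rate \<open>r\<close> between 1 and \<open>R\<close> is for the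
    kernels.\<close>
  define R0 where "R0 = min Rv (if \<tau> = 0 then 2 else norm \<tau>)"
  define R where "R = (1 + R0) / 2"
  define r where "r = (1 + R) / 2"
  have "R0 > 1" using Rv(1) \<tau>1 by (auto simp: R0_def)
  then have R: "1 < R" "R < R0" "1 < r" "r < R" by (auto simp: R_def r_def)
  have R': "R < Rv" "\<tau> = 0 \<or> norm \<tau> > R" using R(2) by (auto simp: R0_def split: if_splits)
  have g_eq: "g n = upper_sum (\<lambda>_. b) v n" for n
  proof -
    obtain \<rho> where \<rho>: "\<rho> > 1" "\<And>R. 1 < R \<Longrightarrow> R < \<rho> \<Longrightarrow> \<exists>C. \<forall>n::nat. norm (f (int n)) \<le> C / R ^ n"
      using laurent_coeffs_decay[OF f] by metis
    have Rf: "1 < (1 + \<rho>) / 2" "(1 + \<rho>) / 2 < \<rho>" using \<rho>(1) by auto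
    obtain C where C: "\<And>n. norm (g n) \<le> C / ((1 + \<rho>) / 2) ^ n"
      using \<rho>(2)[OF Rf] unfolding g_def by blast
    have "v = upper_sum (\<lambda>_. k) g" using v by blast
    then show ?thesis using upper_sum_const_inverse[OF k C Rf(1)] by simp
  qed
  obtain Cb where Cb: "Cb \<ge> 0" "\<And>j. norm (b j) \<le> Cb * r ^ j"
    using k(2) R(3) unfolding subexponential_def by blast
  obtain CB NB where CB: "CB \<ge> 0" "\<And>n j. n \<ge> NB \<Longrightarrow> norm (inv_kernel n j) \<le> CB * r ^ j"
    using kernel_limit_bound[OF inv_kernel_limit s_inv_coeff_subexp R(3)] by metis
  obtain CA NA where CA: "CA \<ge> 0" "\<And>n j. n \<ge> NA \<Longrightarrow> norm (p_kernel n j) \<le> CA * r ^ j"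
    using kernel_limit_bound[OF p_kernel_limit s_coeff_subexp R(3)] by metis
  obtain N1 where N1: "\<And>n. n \<ge> N1 \<Longrightarrow> scaled_coeff F n = upper_sum inv_kernel g n"
    unfolding g_def using scaled_coeff_expansion[OF F f] by metis
  have QF: "Q \<in> holo_near E" unfolding Q_def by (rule holo_near_linear[OF F])
  have "laurent_coeffs_outside_disk (\<lambda>w. Q (\<Psi> w)) q" using q by (simp add: Q_def)
  then obtain N2 where N2: "\<And>n. n \<ge> N2 \<Longrightarrow> q (int n) = upper_sum p_kernel (scaled_coeff Q) n"
    using scaled_coeff_expansion[OF QF] by metis
  define \<epsilon> where "\<epsilon> n = L2_inner \<mu> (\<lambda>z. z * F z) (poly (p n)) / L2_inner \<mu> F (poly (p n)) - l" for n
  have \<epsilon>_lim: "\<epsilon> \<longlonglongrightarrow> 0"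
    unfolding \<epsilon>_def using ratio by (intro LIM_zero) (simp add: ratio_tendsto_def)
  obtain N3 where N3: "\<And>n. n \<ge> N3 \<Longrightarrow> L2_inner \<mu> F (poly (p n)) \<noteq> 0"
    using ratio unfolding ratio_tendsto_def eventually_sequentially by blast
  have Q_eq: "scaled_coeff Q n = \<epsilon> n * scaled_coeff F n" if "n \<ge> N3" for n
    unfolding Q_def scaled_coeff_linear[OF F] using N3[OF that]
    by (simp add: \<epsilon>_def scaled_coeff_def left_diff_distrib right_diff_distrib)
  define t where "t = 1 - r / R"
  have t: "t > 0" using R by (simp add: t_def)
  have decay: "(\<lambda>n. norm (v n) * R ^ n) \<longlonglongrightarrow> 0"
  proof (rule Lim_null_comparison)
    show "\<forall>\<^sub>F n in sequentially. norm (norm (v n) * R ^ n) \<le> Cv * (R / Rv) ^ n"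
    proof (intro always_eventually allI)
      fix n
      have "norm (v n) * R ^ n \<le> Cv / Rv ^ n * R ^ n" using Rv(2) R by (intro mult_right_mono) auto
      then show "norm (norm (v n) * R ^ n) \<le> Cv * (R / Rv) ^ n"
        using R by (simp add: power_divide)
    qed
    have "(\<lambda>n. (R / Rv) ^ n) \<longlonglongrightarrow> 0" using R R' by (intro LIMSEQ_realpow_zero) auto
    then show "(\<lambda>n. Cv * (R / Rv) ^ n) \<longlonglongrightarrow> 0" by (rule tendsto_mult_right_zero)
  qed
  \<comment> \<open>If \<open>v\<close> vanished from some index on, so would \<open>f\<close> and
    the Fourier coefficients of \<open>F\<close>, against the nonzero denominators contained in
    (b).\<close>
  have inf: "\<exists>n\<ge>N. v n \<noteq> 0" for N
  proof (rule ccontr)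
    assume "\<not> (\<exists>n\<ge>N. v n \<noteq> 0)"
    then have "g n = 0" if "n \<ge> N" for n using that by (simp add: g_eq upper_sum_def)
    then have "scaled_coeff F n = 0" if "n \<ge> max N N1" for n
      using that by (simp add: N1 upper_sum_def)
    then have "scaled_coeff F (max N (max N1 N3)) = 0" by simp
    then show False using N3[of "max N (max N1 N3)"] c_pos[of "max N (max N1 N3)"]
      by (simp add: scaled_coeff_def)
  qed
  have rec: "\<exists>M. \<forall>n\<ge>M. \<forall>W. (\<forall>j. norm (v (Suc n + j)) \<le> W / R ^ j) \<longrightarrow>
               norm (v n - \<tau> * v (Suc n)) \<le> e * W" if e: "e > 0" for e
  proof -
    \<comment> \<open>The combined bound for the three kernels \<open>b\<close>,
      \<open>inv_kernel\<close> and \<open>p_kernel\<close>, each with its geometric factor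
      \<open>1 / t\<close>.\<close>
    define X where "X = CA * (CB * (Cb / t) / t) / t"
    have X: "X \<ge> 0" using CA CB Cb t by (simp add: X_def)
    define \<eta> where "\<eta> = e / (X + 1)"
    have \<eta>: "\<eta> > 0" using e X by (simp add: \<eta>_def)
    have \<eta>X: "\<eta> * X \<le> e"
    proof -
      have "\<eta> * X \<le> \<eta> * (X + 1)" using \<eta> by (intro mult_left_mono) auto
      also have "\<dots> = e" using X by (simp add: \<eta>_def)
      finally show ?thesis .
    qed
    obtain N4 where N4: "\<And>n. n \<ge> N4 \<Longrightarrow> norm (\<epsilon> n) \<le> \<eta>"
      using LIMSEQ_D[OF \<epsilon>_lim \<eta>] by (auto intro: less_imp_le)
    define M where "M = max (max NA NB) (max (max N1 N2) (max N3 N4))"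
    have "norm (v n - \<tau> * v (Suc n)) \<le> e * W"
      if n: "n \<ge> M" and W: "\<And>j. norm (v (Suc n + j)) \<le> W / R ^ j" for n W
    proof -
      \<comment> \<open>The difference \<open>v n - \<tau> * v (Suc n)\<close> is the coefficient
        \<open>q\<close> at \<open>n + 1\<close>, where the tail bounded by \<open>W\<close> also
        starts.\<close>
      define m where "m = Suc n"
      have m: "m \<ge> NA" "m \<ge> NB" "m \<ge> N1" "m \<ge> N2" "m \<ge> N3" "m \<ge> N4"
        using n by (auto simp: m_def M_def)
      have W0: "W \<ge> 0" using W[of 0] by (simp add: order_trans[OF norm_ge_zero])
      have t1: "norm (g (m + i)) \<le> (Cb * W / t) / R ^ i" for i
        unfolding g_eq t_def
        by (rule upper_sum_tail_bound[where C = Cb and r = r]) (use Cb W R in \<open>auto simp: m_def\<close>)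
      have t2: "norm (scaled_coeff F (m + i)) \<le> (CB * (Cb * W / t) / t) / R ^ i" for i
      proof -
        have "norm (upper_sum inv_kernel g (m + i)) \<le> (CB * (Cb * W / t) / (1 - r / R)) / R ^ i"
          by (rule upper_sum_tail_bound[where C = CB and r = r]) (use CB R m t1 in auto)
        then show ?thesis using m by (simp add: N1 t_def)
      qed
      have t3: "norm (scaled_coeff Q (m + i)) \<le> (\<eta> * (CB * (Cb * W / t) / t)) / R ^ i" for i
      proof -
        have "norm (\<epsilon> (m + i)) * norm (scaled_coeff F (m + i)) \<le> \<eta> * ((CB * (Cb * W / t) / t) / R ^ i)"
          using \<eta> m by (intro mult_mono N4 t2) auto
        then show ?thesis using m by (simp add: Q_eq norm_mult)
      qed
      have "norm (upper_sum p_kernel (scaled_coeff Q) m) \<le> CA * (\<eta> * (CB * (Cb * W / t) / t)) / (1 - r / R)"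
        by (rule upper_sum_bound(2)[where K = p_kernel and n = m, OF CA(2)[OF m(1)] t3]) (use CA R in auto)
      also have "\<dots> = \<eta> * X * W" by (simp add: X_def t_def)
      also have "\<dots> \<le> e * W" using \<eta>X W0 by (rule mult_right_mono)
      finally show ?thesis using N2[OF m(4)] q_eq[of n] by (simp add: m_def)
    qed
    then show ?thesis by blast
  qed
  have "R > 0" using R by simp
  note pr = perturbed_recurrence[OF decay this R'(2) inf rec]
  show "l \<notin> E" using pr(1) by (auto simp: \<tau>_def)
  then have \<tau>: "\<tau> = \<Phi> l" "norm \<tau> > 1" using \<tau>1 pr(1) by (auto simp: \<tau>_def)
  have one: "(\<lambda>n. v n / v n) \<longlonglongrightarrow> 1"
  proof (rule tendsto_eventually)
    have "\<forall>\<^sub>F n in sequentially. v n \<noteq> 0" by (rule ratio_tendsto_nonzero[OF pr(2)])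
    then show "\<forall>\<^sub>F n in sequentially. v n / v n = 1" by eventually_elim (rule divide_self)
  qed
  have small: "norm (1 / \<tau>) < 1" using \<tau> by (simp add: norm_divide divide_less_eq)
  have "(\<lambda>n. upper_sum (\<lambda>_. b) v n / v n) \<longlonglongrightarrow> 1 * (\<Sum>j. b j * (1 / \<tau>) ^ j)"
    by (rule upper_sum_ratio[OF kernel_limit_const k(2) pr(2) \<tau>(2) one])
  then have "(\<lambda>n. g n / v n) \<longlonglongrightarrow> inverse (\<phi> (1 / \<tau>))"
    using sums_unique[OF b_sums[OF small]] by (simp add: g_eq)
  from ratio_tendsto_transfer[OF pr(2) this] \<phi>_nz[OF small]
  have "ratio_tendsto g (\<lambda>n. g (Suc n)) \<tau>" by simp
  then show "ratio_tendsto (\<lambda>n. f (int n)) (\<lambda>n. f (int (Suc n))) (\<Phi> l)"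
    unfolding g_def \<tau>(1) .
qed

end

text \<open>Injectivity of \<open>\<Phi>\<close> off \<open>E\<close> makes the \<open>l\<close> in
  the outer clauses unique, so \<tau> and \<lambda> determine each other. In the middle clause
  \<open>l\<close> is a priori any complex number; its lying off \<open>E\<close> is part of the
  conclusion.\<close>

theorem theorem4:
  fixes E :: "complex set" and \<Phi> F :: "complex \<Rightarrow> complex" and \<mu> :: "complex measure"
    and p :: "nat \<Rightarrow> complex poly" and f :: "int \<Rightarrow> complex"
  assumes "admissible_compact E"
    and "exterior_map E \<Phi>"
    and "F \<in> holo_near E"
    and "\<mu> \<in> strong_asymp_measures E"
    and "orthonormal_polys \<mu> p"
    and "laurent_coeffs_outside_disk (\<lambda>w. F (exterior_inverse E \<Phi> w)) f"
  shows
    "let Fn = (\<lambda>n. L2_inner \<mu> F (poly (p n)));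
         zFn = (\<lambda>n. L2_inner \<mu> (\<lambda>z. z * F z) (poly (p n)));
         A = (\<lambda>\<tau>. ratio_tendsto Fn (\<lambda>n. Fn (n + 1)) \<tau>);
         B = (\<lambda>l. ratio_tendsto zFn Fn l);
         C = (\<lambda>\<tau>. ratio_tendsto (\<lambda>n. f (int n)) (\<lambda>n. f (int (n + 1))) \<tau>)
     in (\<forall>\<tau>. A \<tau> \<longrightarrow> (\<exists>l. l \<notin> E \<and> \<Phi> l = \<tau> \<and> B l) \<and> C \<tau>) \<and>
        (\<forall>l. B l \<longrightarrow> l \<notin> E \<and> A (\<Phi> l) \<and> C (\<Phi> l)) \<and>
        (\<forall>\<tau>. C \<tau> \<longrightarrow> A \<tau> \<and> (\<exists>l. l \<notin> E \<and> \<Phi> l = \<tau> \<and> B l))"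
proof -
  have mu: "\<mu> \<in> measures_on E" using assms(4) by (simp add: strong_asymp_measures_def)
  from assms(4)[unfolded strong_asymp_measures_def mem_Collect_eq, THEN conjunct2, rule_format,
      OF conjI[OF assms(2,5)]]
  obtain c :: "nat \<Rightarrow> real" and S where cS: "\<forall>n. 0 < c n" "S holomorphic_on - E" "\<forall>z\<in>- E. S z \<noteq> 0"
    "\<exists>L. L \<noteq> 0 \<and> (S \<longlongrightarrow> L) at_infinity"
    "\<forall>K. closed K \<and> K \<subseteq> - E \<longrightarrow>
       uniform_limit K (\<lambda>n z. poly (p n) z / (complex_of_real (c n) * \<Phi> z ^ n)) S sequentially"
    "(\<lambda>n. c n / c (Suc n)) \<longlonglongrightarrow> 1"
    by (elim exE conjE) (rule that, (assumption | intro exI conjI)+)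
  interpret strong_asymptotics E \<Phi> \<mu> p c S
    by unfold_locales (use assms(1,2,5) mu cS in \<open>auto simp: admissible_compact_def\<close>)
  note F = assms(3) and f = assms(6)
  have CA: "ratio_tendsto (\<lambda>n. L2_inner \<mu> F (poly (p n))) (\<lambda>n. L2_inner \<mu> F (poly (p (Suc n)))) \<tau>"
    if "ratio_tendsto (\<lambda>n. f (int n)) (\<lambda>n. f (int (Suc n))) \<tau>" for \<tau>
    using laurent_ratio_imp_fourier_ratio(2)[OF F f that] unfolding scaled_coeff_ratio_iff .
  have AC: "ratio_tendsto (\<lambda>n. f (int n)) (\<lambda>n. f (int (Suc n))) \<tau>"
    if "ratio_tendsto (\<lambda>n. L2_inner \<mu> F (poly (p n))) (\<lambda>n. L2_inner \<mu> F (poly (p (Suc n)))) \<tau>" for \<tau>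
    by (rule fourier_ratio_imp_laurent_ratio[OF F f]) (simp only: scaled_coeff_ratio_iff that)
  have CB: "\<exists>l. l \<notin> E \<and> \<Phi> l = \<tau> \<and> ratio_tendsto (\<lambda>n. L2_inner \<mu> (\<lambda>z. z * F z) (poly (p n)))
           (\<lambda>n. L2_inner \<mu> F (poly (p n))) l"
    if "ratio_tendsto (\<lambda>n. f (int n)) (\<lambda>n. f (int (Suc n))) \<tau>" for \<tau>
    using laurent_ratio_imp_multiplication_ratio[OF F f that] laurent_ratio_gt_1[OF f that]
      Psi_notin[of \<tau>] Phi_Psi[of \<tau>] by blast
  note BC = multiplication_ratio_imp_laurent_ratio[OF F f]
  show ?thesis
    unfolding Let_def Suc_eq_plus1[symmetric] using CA AC CB BC by blast
qed

end
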